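(* Let $\mathbb{X}\subseteq\mathbb{P}^n$ be a $0$-dimensional scheme, and let $1\le m\le n+1$. (a) For $i<m$, we have $\mathrm{HF}_{\Omega^m_{R_{\mathbb{X}}/K}}(i)=0$. (b) For $m\le i<\alpha_{\mathbb{X}}+m-1$, we have $\mathrm{HF}_{\Omega^m_{R_{\mathbb{X}}/K}}(i)=\binom{n+1}{m}\binom{n+i-m}{n}$. (c) The Hilbert polynomial of $\Omega^m_{R_{\mathbb{X}}/K}$ is constant. (d) We have $\mathrm{HF}_{\Omega^m_{R_{\mathbb{X}}/K}}(r_{\mathbb{X}}+m)\ge\mathrm{HF}_{\Omega^m_{R_{\mathbb{X}}/K}}(r_{\mathbb{X}}+m+1)\ge\cdots$, and if $\mathrm{ri}(\Omega^m_{R_{\mathbb{X}}/K})\ge r_{\mathbb{X}}+m$ then $$\mathrm{HF}_{\Omega^m_{R_{\mathbb{X}}/K}}(r_{\mathbb{X}}+m)>\mathrm{HF}_{\Omega^m_{R_{\mathbb{X}}/K}}(r_{\mathbb{X}}+m+1)>\cdots>\mathrm{HF}_{\Omega^m_{R_{\mathbb{X}}/K}}(\mathrm{ri}(\Omega^m_{R_{\mathbb{X}}/K})).$$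
   Context: $K$ is a field of characteristic zero, $S=K[X_0,\dots,X_n]$ ($n\ge 1$) with the standard grading is the homogeneous coordinate ring of $\mathbb{P}^n$ over $K$. For a $0$-dimensional subscheme $\mathbb{X}\subseteq\mathbb{P}^n$, $I_{\mathbb{X}}\subseteq S$ is its saturated homogeneous vanishing ideal, $R_{\mathbb{X}}=S/I_{\mathbb{X}}$, and $x_i$ is the image of $X_i$. Coordinates are chosen so that no point of $\mathbb{X}$ lies on the hyperplane $X_0=0$; hence $x_0$ is a non-zerodivisor of $R_{\mathbb{X}}$. $\alpha_{\mathbb{X}}=\min\{i\in\mathbb{N}\mid (I_{\mathbb{X}})_i\ne 0\}$. $\Omega^1_{R_{\mathbb{X}}/K}$ is the module of Kähler differentials of $R_{\mathbb{X}}/K$, a graded $R_{\mathbb{X}}$-module with $\deg(dx_i)=1$, and $\Omega^m_{R_{\mathbb{X}}/K}=\bigwedge^m_{R_{\mathbb{X}}}\Omega^1_{R_{\mathbb{X}}/K}$. For a finitely generated graded module $M$, $\mathrm{HF}_M(i)=\dim_K M_i$, $\mathrm{HP}_M$ is its Hilbert polynomial, and $\mathrm{ri}(M)=\min\{i\in\mathbb{Z}\mid \mathrm{HF}_M(j)=\mathrm{HP}_M(j)\text{ for all }j\ge i\}$ (with $\mathrm{ri}(M)=-\infty$ if $\mathrm{HF}_M(j)=\mathrm{HP}_M(j)$ for all $j\in\mathbb{Z}$) is its regularity index; $r_{\mathbb{X}}=\mathrm{ri}(R_{\mathbb{X}})$. *)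

theory Defs
  imports
    "HOL-Library.Poly_Mapping"
    "HOL-Library.Extended"
    "HOL-Computational_Algebra.Polynomial"
    "HOL-Algebra.QuotRing"
    "Jordan_Normal_Form.Missing_VectorSpace"
begin

section \<open>Free modules, quotient modules, Kaehler differentials and exterior powers\<close>

text \<open>The fields \<open>mult\<close> and \<open>one\<close> of the module records below are irrelevant: the locale
  \<open>module\<close> of HOL-Algebra only uses the additive group and \<open>smult\<close>.\<close>

definition free_module :: "('a, 'c) ring_scheme \<Rightarrow> 'x set \<Rightarrow> ('a, 'x \<Rightarrow> 'a) module" where
  "free_module R X = \<lparr>
     carrier = {f. (\<forall>x\<in>X. f x \<in> carrier R) \<and> (\<forall>x. x \<notin> X \<longrightarrow> f x = \<zero>\<^bsub>R\<^esub>)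
                   \<and> finite {x. f x \<noteq> \<zero>\<^bsub>R\<^esub>}},
     monoid.mult = undefined, one = undefined,
     ring.zero = (\<lambda>x. \<zero>\<^bsub>R\<^esub>),
     add = (\<lambda>f g x. f x \<oplus>\<^bsub>R\<^esub> g x),
     smult = (\<lambda>a f x. a \<otimes>\<^bsub>R\<^esub> f x)\<rparr>"

definition free_gen :: "('a, 'c) ring_scheme \<Rightarrow> 'x \<Rightarrow> 'x \<Rightarrow> 'a" where
  "free_gen R x = (\<lambda>y. if y = x then \<one>\<^bsub>R\<^esub> else \<zero>\<^bsub>R\<^esub>)"

definition quotient_module :: "('a, 'b, 'c) module_scheme \<Rightarrow> 'b set \<Rightarrow> ('a, 'b set) module" where
  "quotient_module M N = \<lparr>
     carrier = a_rcosets\<^bsub>M\<^esub> N,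
     monoid.mult = undefined, one = undefined,
     ring.zero = N,
     add = set_add M,
     smult = (\<lambda>a C. \<Union>x\<in>C. N +>\<^bsub>M\<^esub> (a \<odot>\<^bsub>M\<^esub> x))\<rparr>"

definition self_module :: "('a, 'c) ring_scheme \<Rightarrow> ('a, 'a) module" where
  "self_module R = \<lparr>carrier = carrier R, monoid.mult = monoid.mult R, one = one R,
     ring.zero = ring.zero R, add = add R, smult = monoid.mult R\<rparr>"

text \<open>\<open>\<Omega>\<^sup>1\<close> of a commutative ring \<open>R\<close> relative to a subring with carrier \<open>k\<close>
  (for an algebra over \<open>K\<close>: the image of \<open>K\<close> in \<open>R\<close>): the free module on symbols \<open>d a\<close>,
  \<open>a \<in> R\<close>, modulo additivity, the Leibniz rule, and \<open>d c = 0\<close> for \<open>c \<in> k\<close>.\<close>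

definition kaehler_relations :: "('a, 'c) ring_scheme \<Rightarrow> 'a set \<Rightarrow> ('a \<Rightarrow> 'a) set" where
  "kaehler_relations R k =
     (let F = free_module R (carrier R); e = free_gen R in
      LinearCombinations.module.span R F
       ({e (a \<oplus>\<^bsub>R\<^esub> b) \<ominus>\<^bsub>F\<^esub> (e a \<oplus>\<^bsub>F\<^esub> e b) | a b. a \<in> carrier R \<and> b \<in> carrier R}
      \<union> {e (a \<otimes>\<^bsub>R\<^esub> b) \<ominus>\<^bsub>F\<^esub> (a \<odot>\<^bsub>F\<^esub> e b \<oplus>\<^bsub>F\<^esub> b \<odot>\<^bsub>F\<^esub> e a) | a b. a \<in> carrier R \<and> b \<in> carrier R}
      \<union> e ` k))"

definition kaehler_module :: "('a, 'c) ring_scheme \<Rightarrow> 'a set \<Rightarrow> ('a, ('a \<Rightarrow> 'a) set) module" where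
  "kaehler_module R k = quotient_module (free_module R (carrier R)) (kaehler_relations R k)"

definition kaehler_d :: "('a, 'c) ring_scheme \<Rightarrow> 'a set \<Rightarrow> 'a \<Rightarrow> ('a \<Rightarrow> 'a) set" where
  "kaehler_d R k a = kaehler_relations R k +>\<^bsub>free_module R (carrier R)\<^esub> free_gen R a"

text \<open>The \<open>m\<close>-th exterior power of \<open>M\<close>: the free module on \<open>m\<close>-tuples of elements of \<open>M\<close>
  modulo multilinearity and the alternating relations.\<close>

definition tuples :: "('a, 'b, 'c) module_scheme \<Rightarrow> nat \<Rightarrow> 'b list set" where
  "tuples M m = {ws. length ws = m \<and> set ws \<subseteq> carrier M}"

definition exterior_relations ::
  "('a, 'c) ring_scheme \<Rightarrow> ('a, 'b, 'd) module_scheme \<Rightarrow> nat \<Rightarrow> ('b list \<Rightarrow> 'a) set" where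
  "exterior_relations R M m =
     (let F = free_module R (tuples M m); e = free_gen R in
      LinearCombinations.module.span R F
       ({e (ws[i := v \<oplus>\<^bsub>M\<^esub> w]) \<ominus>\<^bsub>F\<^esub> (e (ws[i := v]) \<oplus>\<^bsub>F\<^esub> e (ws[i := w])) | ws i v w.
           ws \<in> tuples M m \<and> i < m \<and> v \<in> carrier M \<and> w \<in> carrier M}
      \<union> {e (ws[i := a \<odot>\<^bsub>M\<^esub> v]) \<ominus>\<^bsub>F\<^esub> a \<odot>\<^bsub>F\<^esub> e (ws[i := v]) | ws i a v.
           ws \<in> tuples M m \<and> i < m \<and> a \<in> carrier R \<and> v \<in> carrier M}
      \<union> {e ws | ws. ws \<in> tuples M m \<and> (\<exists>i j. i < j \<and> j < m \<and> ws ! i = ws ! j)}))"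

definition exterior_power ::
  "('a, 'c) ring_scheme \<Rightarrow> ('a, 'b, 'd) module_scheme \<Rightarrow> nat \<Rightarrow> ('a, ('b list \<Rightarrow> 'a) set) module" where
  "exterior_power R M m = quotient_module (free_module R (tuples M m)) (exterior_relations R M m)"

definition wedge ::
  "('a, 'c) ring_scheme \<Rightarrow> ('a, 'b, 'd) module_scheme \<Rightarrow> 'b list \<Rightarrow> ('b list \<Rightarrow> 'a) set" where
  "wedge R M ws =
     exterior_relations R M (length ws) +>\<^bsub>free_module R (tuples M (length ws))\<^esub> free_gen R ws"


section \<open>Gradings and Hilbert functions\<close>

text \<open>A grading is given by the family \<open>G\<close> of its homogeneous pieces, indexed by the integers.
  The induced grading on \<open>\<Omega>\<^sup>1\<close> is the one for which \<open>d\<close> is homogeneous of degree 0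
  (so \<open>d x\<close> has degree 1 for \<open>x\<close> of degree 1), and degrees add up in wedge products.\<close>

definition kaehler_piece ::
  "('a, 'c) ring_scheme \<Rightarrow> 'a set \<Rightarrow> (int \<Rightarrow> 'a set) \<Rightarrow> int \<Rightarrow> ('a \<Rightarrow> 'a) set set" where
  "kaehler_piece R k G s =
     LinearCombinations.module.span (R\<lparr>carrier := k\<rparr>) (kaehler_module R k)
       {a \<odot>\<^bsub>kaehler_module R k\<^esub> kaehler_d R k b | a b i j. a \<in> G i \<and> b \<in> G j \<and> i + j = s}"

definition exterior_piece ::
  "('a, 'c) ring_scheme \<Rightarrow> 'a set \<Rightarrow> ('a, 'b, 'd) module_scheme \<Rightarrow> (int \<Rightarrow> 'b set) \<Rightarrow> nat \<Rightarrow> int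
     \<Rightarrow> ('b list \<Rightarrow> 'a) set set" where
  "exterior_piece R k M G m s =
     LinearCombinations.module.span (R\<lparr>carrier := k\<rparr>) (exterior_power R M m)
       {wedge R M ws | ws ds. length ws = m \<and> length ds = m
          \<and> (\<forall>j<m. ws ! j \<in> G (ds ! j)) \<and> sum_list ds = s}"

text \<open>Here \<open>k\<close> is a subfield of \<open>R\<close>, and dimensions are taken over it.\<close>

definition hilbert_function ::
  "('a, 'c) ring_scheme \<Rightarrow> 'a set \<Rightarrow> ('a, 'b, 'd) module_scheme \<Rightarrow> (int \<Rightarrow> 'b set) \<Rightarrow> int \<Rightarrow> nat" where
  "hilbert_function R k M G s = vectorspace.dim (R\<lparr>carrier := k\<rparr>) (M\<lparr>carrier := G s\<rparr>)"

definition is_hilbert_polynomial :: "(int \<Rightarrow> nat) \<Rightarrow> rat poly \<Rightarrow> bool" where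
  "is_hilbert_polynomial H p \<longleftrightarrow> (\<exists>N. \<forall>i\<ge>N. of_nat (H i) = poly p (of_int i))"

definition hilbert_polynomial :: "(int \<Rightarrow> nat) \<Rightarrow> rat poly" where
  "hilbert_polynomial H = (THE p. is_hilbert_polynomial H p)"

definition regularity_index :: "(int \<Rightarrow> nat) \<Rightarrow> int extended" where
  "regularity_index H =
     (let agree = (\<lambda>j. of_nat (H j) = poly (hilbert_polynomial H) (of_int j))
      in if \<forall>j. agree j then Minf else Fin (LEAST i. \<forall>j\<ge>i. agree j))"


section \<open>Zero-dimensional subschemes of projective space\<close>

text \<open>Polynomials in the variables \<open>X\<^sub>i\<close>, \<open>i \<in> nat\<close>; a monomial maps each variable to its exponent.\<close>

type_synonym 'k mpoly = "(nat \<Rightarrow>\<^sub>0 nat) \<Rightarrow>\<^sub>0 'k"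

definition var :: "nat \<Rightarrow> 'k::field mpoly" where
  "var i = Poly_Mapping.single (Poly_Mapping.single i 1) 1"

definition const :: "'k \<Rightarrow> 'k::field mpoly" where
  "const c = Poly_Mapping.single 0 c"

definition mdeg :: "(nat \<Rightarrow>\<^sub>0 nat) \<Rightarrow> nat" where
  "mdeg t = (\<Sum>i\<in>Poly_Mapping.keys t. Poly_Mapping.lookup t i)"

text \<open>\<open>K[X\<^sub>0,\<dots>,X\<^sub>n]\<close>\<close>

definition poly_ring :: "nat \<Rightarrow> 'k::field mpoly ring" where
  "poly_ring n = \<lparr>carrier = {p. \<forall>t\<in>Poly_Mapping.keys p. Poly_Mapping.keys t \<subseteq> {..n}},
     monoid.mult = (*), one = 1, ring.zero = 0, add = (+)\<rparr>"

definition forms :: "nat \<Rightarrow> int \<Rightarrow> 'k::field mpoly set" where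
  "forms n s = {p \<in> carrier (poly_ring n). \<forall>t\<in>Poly_Mapping.keys p. int (mdeg t) = s}"

definition homogeneous_ideal :: "nat \<Rightarrow> 'k::field mpoly set \<Rightarrow> bool" where
  "homogeneous_ideal n I \<longleftrightarrow>
     ideal I (poly_ring n) \<and> I = genideal (poly_ring n) (I \<inter> (\<Union>s. forms n s))"

definition saturated_ideal :: "nat \<Rightarrow> 'k::field mpoly set \<Rightarrow> bool" where
  "saturated_ideal n I \<longleftrightarrow>
     (\<forall>f\<in>carrier (poly_ring n). (\<exists>N. \<forall>g\<in>forms n (int N). g * f \<in> I) \<longrightarrow> f \<in> I)"

text \<open>The points of the closed subscheme \<open>Proj (S/I)\<close>, as homogeneous prime ideals of \<open>S\<close>
  that contain \<open>I\<close> but not the irrelevant ideal.\<close>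

definition scheme_points :: "nat \<Rightarrow> 'k::field mpoly set \<Rightarrow> 'k mpoly set set" where
  "scheme_points n I =
     {P. homogeneous_ideal n P \<and> primeideal P (poly_ring n) \<and> I \<subseteq> P \<and> \<not> var ` {..n} \<subseteq> P}"

text \<open>Closed subschemes of \<open>P\<^sup>n\<close> correspond to saturated homogeneous ideals. Such a scheme has
  dimension 0 if it is nonempty and has no proper specialisations among its points, i.e. all chains of
  irreducible closed subsets have length 0.\<close>

definition zero_dim_scheme :: "nat \<Rightarrow> 'k::field mpoly set \<Rightarrow> bool" where
  "zero_dim_scheme n I \<longleftrightarrow> homogeneous_ideal n I \<and> saturated_ideal n I
     \<and> scheme_points n I \<noteq> {}
     \<and> (\<forall>P\<in>scheme_points n I. \<forall>Q\<in>scheme_points n I. P \<subseteq> Q \<longrightarrow> P = Q)"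

definition initial_degree :: "nat \<Rightarrow> 'k::field mpoly set \<Rightarrow> nat" where
  "initial_degree n I = (LEAST s. \<exists>f \<in> I \<inter> forms n (int s). f \<noteq> 0)"

definition coord_ring :: "nat \<Rightarrow> 'k::field mpoly set \<Rightarrow> 'k mpoly set ring" where
  "coord_ring n I = poly_ring n Quot I"

definition coord_base :: "nat \<Rightarrow> 'k::field mpoly set \<Rightarrow> 'k mpoly set set" where
  "coord_base n I = range (\<lambda>c. I +>\<^bsub>poly_ring n\<^esub> const c)"

definition coord_piece :: "nat \<Rightarrow> 'k::field mpoly set \<Rightarrow> int \<Rightarrow> 'k mpoly set set" where
  "coord_piece n I s = (\<lambda>f. I +>\<^bsub>poly_ring n\<^esub> f) ` forms n s"

definition HF_coord :: "nat \<Rightarrow> 'k::field mpoly set \<Rightarrow> int \<Rightarrow> nat" where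
  "HF_coord n I =
     hilbert_function (coord_ring n I) (coord_base n I) (self_module (coord_ring n I)) (coord_piece n I)"

definition HF_Omega :: "nat \<Rightarrow> 'k::field mpoly set \<Rightarrow> nat \<Rightarrow> int \<Rightarrow> nat" where
  "HF_Omega n I m =
     (let R = coord_ring n I; k = coord_base n I; \<Omega> = kaehler_module R k;
          G = kaehler_piece R k (coord_piece n I)
      in hilbert_function R k (exterior_power R \<Omega> m) (exterior_piece R k \<Omega> G m))"

end

theory Submission
  imports Defs "HOL-Library.Function_Algebras"
begin

text \<open>Sending \<open>dX\<^sub>J\<close> to the basis vector \<open>e\<^sub>J\<close> identifies \<open>\<Omega>\<^sup>m\<close> with the quotient of the
  \<open>m\<close>-th exterior power \<open>\<Lambda>\<^sup>m\<close> of the free \<open>S\<close>-module \<open>S\<^bsup>n+1\<^esup>\<close> by \<open>I\<Lambda>\<^sup>m + dI \<and> \<Lambda>\<^bsup>m-1\<^esup>\<close>, the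
  basis vectors having degree \<open>m\<close>. The relations live in coefficient degrees \<open>\<ge> \<alpha> - 1\<close>, so
  below them the Hilbert function is that of \<open>\<Lambda>\<^sup>m\<close>. Of the hypotheses on the scheme only three
  consequences matter: \<open>I\<close> is homogeneous and proper, \<open>x\<^sub>0\<close> is a nonzerodivisor of \<open>R = S/I\<close>, and
  multiplication by \<open>x\<^sub>0\<close> maps \<open>R\<^sub>d\<close> onto \<open>R\<^bsub>d+1\<^esub>\<close> for \<open>d \<ge> r\<close>. Surjectivity passes to \<open>\<Omega>\<^sup>m\<close>, so its Hilbert
  function is nonincreasing from \<open>r + m\<close> on and eventually constant. Modulo \<open>I\<close>, every relation of
  coefficient degree \<open>d + 2\<close>, \<open>d \<ge> r\<close>, is a combination of the \<open>X\<^sub>i\<close> with relations of degree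
  \<open>d + 1\<close> as coefficients. Hence if \<open>x\<^sub>0\<close> is injective on \<open>\<Omega>\<^sup>m\<close> in one degree \<open>\<ge> r + m\<close>, it is
  injective in all later ones: two equal consecutive values force the Hilbert function to be constant
  from there, which is the strictness claim.\<close>

section \<open>Modules by generators and relations, exterior powers\<close>

text \<open>The easy half of the identification is \<open>Psi\<close>, sending the basis form of
  \<open>J\<close> to the wedge of the \<open>dx j\<close>, \<open>j\<close> in \<open>J\<close>.
  Bounding its kernel needs a map back, and that map must start from a free module on all tuples
  over \<Omega>, itself a quotient of the free module on all elements of R. It is built from chosen
  polynomial representatives and is well defined only modulo relations; so congruence modulo a
  submodule of coefficient functions replaces a second quotient. Working over S instead of R keeps
  homogeneous components at hand.

  The number r is given by dimensions. It becomes surjectivity of x_0 from degree r on because x_0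
  is injective on R.

  The shift from d + 1 to d + 2 has this origin. A relation df \<and> w with w of positive degree
  gives up a variable of w. If w is constant, f has degree d + 3 and must be a combination of the
  X_i with coefficients u_i in I of degree d + 2, which surjectivity of x_0 in degree d + 1
  provides. The product rule then leaves the terms u_i dX_i; they are the reason why the
  decomposition holds only modulo I.\<close>

lemma (in module) span_induct:
  assumes S: "S \<subseteq> carrier M" and x: "x \<in> LinearCombinations.module.span R M S"
    and zero: "P \<zero>\<^bsub>M\<^esub>"
    and add: "\<And>x y. x \<in> carrier M \<Longrightarrow> y \<in> carrier M \<Longrightarrow> P x \<Longrightarrow> P y \<Longrightarrow> P (x \<oplus>\<^bsub>M\<^esub> y)"
    and smult: "\<And>a x. a \<in> carrier R \<Longrightarrow> x \<in> carrier M \<Longrightarrow> P x \<Longrightarrow> P (a \<odot>\<^bsub>M\<^esub> x)"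
    and base: "\<And>x. x \<in> S \<Longrightarrow> P x"
  shows "P x"
proof -
  have "LinearCombinations.submodule R {x \<in> carrier M. P x} M"
    by (rule LinearCombinations.submodule.intro) (use zero add smult in \<open>auto intro: module_axioms\<close>)
  then have "span S \<subseteq> {x \<in> carrier M. P x}"
    by (rule span_is_subset[rotated]) (use S base in auto)
  with x show ?thesis by auto
qed

text \<open>Negatives come from scaling by minus one. This opens the coset lemmas for abelian
  subgroups to submodules.\<close>

lemma submodule_abelian_subgroup:
  fixes R :: "('a, 'c) ring_scheme" and M :: "('a, 'b, 'd) module_scheme" (structure)
  assumes "LinearCombinations.submodule R N M"
  shows "abelian_subgroup N M"
proof -
  interpret LinearCombinations.submodule R N M by fact
  interpret module R M by (rule module)
  show ?thesis
  proof (rule abelian_subgroupI3)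
    show "additive_subgroup N M"
    proof (rule additive_subgroup.intro, unfold_locales)
      fix x assume "x \<in> N"
      then have "(\<ominus>\<^bsub>R\<^esub> \<one>\<^bsub>R\<^esub>) \<odot> x \<in> N" by simp
      with \<open>x \<in> N\<close> show "inv\<^bsub>add_monoid M\<^esub> x \<in> N"
        using subset smult_minus_1[of x] by (metis a_inv_def subsetD)
    qed (use subset in auto)
  qed unfold_locales
qed

context
  fixes R :: "('a, 'c) ring_scheme" and M :: "('a, 'b, 'd) module_scheme" and N :: "'b set"
  assumes sub: "LinearCombinations.submodule R N M"
begin

interpretation sm: LinearCombinations.submodule R N M by (rule sub)
interpretation module R M by (rule sm.module)
interpretation abelian_subgroup N M by (rule submodule_abelian_subgroup[OF sub])

lemma quotient_module_carrier: "carrier (quotient_module M N) = (\<lambda>x. N +>\<^bsub>M\<^esub> x) ` carrier M"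
  by (auto simp: quotient_module_def A_RCOSETS_def' a_r_coset_def')

lemma quotient_module_zero: "\<zero>\<^bsub>quotient_module M N\<^esub> = N"
  by (simp add: quotient_module_def)

lemma quotient_module_add:
  "x \<in> carrier M \<Longrightarrow> y \<in> carrier M \<Longrightarrow>
    (N +>\<^bsub>M\<^esub> x) \<oplus>\<^bsub>quotient_module M N\<^esub> (N +>\<^bsub>M\<^esub> y) = N +>\<^bsub>M\<^esub> (x \<oplus>\<^bsub>M\<^esub> y)"
  by (simp add: quotient_module_def a_rcos_sum)

lemma coset_eq_iff:
  assumes "x \<in> carrier M" "y \<in> carrier M"
  shows "N +>\<^bsub>M\<^esub> x = N +>\<^bsub>M\<^esub> y \<longleftrightarrow> x \<ominus>\<^bsub>M\<^esub> y \<in> N"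
proof -
  have "N +>\<^bsub>M\<^esub> x = N +>\<^bsub>M\<^esub> y \<longleftrightarrow> x \<in> N +>\<^bsub>M\<^esub> y"
    using a_rcos_self[OF assms(1)] a_repr_independence'[OF _ assms(2)] by metis
  also have "\<dots> \<longleftrightarrow> x \<ominus>\<^bsub>M\<^esub> y \<in> N"
    using a_rcos_module assms by (simp add: M.minus_eq)
  finally show ?thesis .
qed

lemma coset_zero: "N +>\<^bsub>M\<^esub> \<zero>\<^bsub>M\<^esub> = N"
  by (simp add: a_rcos_const)

lemma coset_eq_submodule_iff:
  assumes "x \<in> carrier M"
  shows "N +>\<^bsub>M\<^esub> x = N \<longleftrightarrow> x \<in> N"
  using a_rcos_const a_rcos_self[OF assms] by metis

lemma coset_memD:
  assumes "x \<in> carrier M" "c \<in> N +>\<^bsub>M\<^esub> x"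
  shows "c \<in> carrier M" "N +>\<^bsub>M\<^esub> c = N +>\<^bsub>M\<^esub> x"
  using a_elemrcos_carrier[OF assms] a_repr_independence'[OF assms(2,1)] by auto

text \<open>The scalar multiple of a coset is defined as a union over its elements. Since
  \<open>N\<close> is stable under scaling, all cosets in this union coincide, and the union is not
  empty.\<close>

lemma quotient_module_smult:
  assumes "a \<in> carrier R" "x \<in> carrier M"
  shows "a \<odot>\<^bsub>quotient_module M N\<^esub> (N +>\<^bsub>M\<^esub> x) = N +>\<^bsub>M\<^esub> (a \<odot>\<^bsub>M\<^esub> x)"
proof -
  have "N +>\<^bsub>M\<^esub> (a \<odot>\<^bsub>M\<^esub> c) = N +>\<^bsub>M\<^esub> (a \<odot>\<^bsub>M\<^esub> x)" if "c \<in> N +>\<^bsub>M\<^esub> x" for c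
  proof -
    have c: "c \<in> carrier M" "c \<ominus>\<^bsub>M\<^esub> x \<in> N"
      using coset_memD[OF assms(2) that] coset_eq_iff assms by auto
    have "a \<odot>\<^bsub>M\<^esub> c \<ominus>\<^bsub>M\<^esub> a \<odot>\<^bsub>M\<^esub> x = a \<odot>\<^bsub>M\<^esub> (c \<ominus>\<^bsub>M\<^esub> x)"
      using assms c by (simp add: M.minus_eq smult_r_distr smult_r_minus)
    then show ?thesis using c assms by (subst coset_eq_iff) auto
  qed
  moreover have "x \<in> N +>\<^bsub>M\<^esub> x" using assms a_rcos_self by simp
  ultimately have "(\<Union>c\<in>N +>\<^bsub>M\<^esub> x. N +>\<^bsub>M\<^esub> (a \<odot>\<^bsub>M\<^esub> c)) = N +>\<^bsub>M\<^esub> (a \<odot>\<^bsub>M\<^esub> x)" by blast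
  then show ?thesis by (simp only: quotient_module_def module.simps)
qed

lemma module_quotient_module: "module R (quotient_module M N)"
proof -
  let ?Q = "quotient_module M N"
  note Q = quotient_module_carrier quotient_module_add quotient_module_smult
  have Z: "\<zero>\<^bsub>?Q\<^esub> = N +>\<^bsub>M\<^esub> \<zero>\<^bsub>M\<^esub>" by (simp add: quotient_module_zero coset_zero)
  show ?thesis
  proof (rule module_criteria)
    show "cring R" by (rule is_cring)
    show "\<forall>v\<in>carrier ?Q. \<exists>w\<in>carrier ?Q. v \<oplus>\<^bsub>?Q\<^esub> w = \<zero>\<^bsub>?Q\<^esub>"
    proof
      fix v assume "v \<in> carrier ?Q"
      then obtain x where x: "x \<in> carrier M" "v = N +>\<^bsub>M\<^esub> x" by (auto simp: Q)
      then show "\<exists>w\<in>carrier ?Q. v \<oplus>\<^bsub>?Q\<^esub> w = \<zero>\<^bsub>?Q\<^esub>"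
        by (intro bexI[of _ "N +>\<^bsub>M\<^esub> (\<ominus>\<^bsub>M\<^esub> x)"]) (auto simp: Q Z M.r_neg)
    qed
    show "\<forall>v w. v \<in> carrier ?Q \<and> w \<in> carrier ?Q \<longrightarrow> v \<oplus>\<^bsub>?Q\<^esub> w = w \<oplus>\<^bsub>?Q\<^esub> v"
      by (auto simp: Q M.a_comm)
    show "\<forall>v w x. v \<in> carrier ?Q \<and> w \<in> carrier ?Q \<and> x \<in> carrier ?Q \<longrightarrow>
        v \<oplus>\<^bsub>?Q\<^esub> w \<oplus>\<^bsub>?Q\<^esub> x = v \<oplus>\<^bsub>?Q\<^esub> (w \<oplus>\<^bsub>?Q\<^esub> x)"
      by (auto simp: Q M.a_assoc)
  qed (auto simp: Q Z smult_assoc1 smult_l_distr smult_r_distr)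
qed

end

section \<open>Free modules on a set, and exterior powers by generators and relations\<close>

lemma free_module_simps:
  "carrier (free_module R X) = {f. (\<forall>x\<in>X. f x \<in> carrier R) \<and> (\<forall>x. x \<notin> X \<longrightarrow> f x = \<zero>\<^bsub>R\<^esub>)
     \<and> finite {x. f x \<noteq> \<zero>\<^bsub>R\<^esub>}}"
  "\<zero>\<^bsub>free_module R X\<^esub> = (\<lambda>x. \<zero>\<^bsub>R\<^esub>)"
  "f \<oplus>\<^bsub>free_module R X\<^esub> g = (\<lambda>x. f x \<oplus>\<^bsub>R\<^esub> g x)"
  "a \<odot>\<^bsub>free_module R X\<^esub> f = (\<lambda>x. a \<otimes>\<^bsub>R\<^esub> f x)"
  by (simp_all add: free_module_def)

lemma (in cring) free_module_carrier_closed: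
  "f \<in> carrier (free_module R X) \<Longrightarrow> f x \<in> carrier R"
  by (cases "x \<in> X") (auto simp: free_module_simps)

lemma (in cring) module_free_module: "module R (free_module R X)"
proof -
  let ?F = "free_module R X"
  have c: "v x \<in> carrier R" if "v \<in> carrier ?F" for v x
    using free_module_carrier_closed[OF that] .
  show ?thesis
  proof (rule module_criteria)
  show "cring R" by (rule is_cring)
  show "\<zero>\<^bsub>?F\<^esub> \<in> carrier ?F" by (auto simp: free_module_simps)
  show "\<forall>v w. v \<in> carrier ?F \<and> w \<in> carrier ?F \<longrightarrow> v \<oplus>\<^bsub>?F\<^esub> w \<in> carrier ?F"
  proof (intro allI impI, elim conjE)
    fix v w assume vw: "v \<in> carrier ?F" "w \<in> carrier ?F"
    have "finite {x. v x \<oplus> w x \<noteq> \<zero>}"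
      by (rule finite_subset[of _ "{x. v x \<noteq> \<zero>} \<union> {x. w x \<noteq> \<zero>}"])
        (use vw in \<open>auto simp: free_module_simps\<close>)
    with vw show "v \<oplus>\<^bsub>?F\<^esub> w \<in> carrier ?F" by (auto simp: free_module_simps)
  qed
  show "\<forall>c v. c \<in> carrier R \<and> v \<in> carrier ?F \<longrightarrow> c \<odot>\<^bsub>?F\<^esub> v \<in> carrier ?F"
  proof (intro allI impI, elim conjE)
    fix c v assume cv: "c \<in> carrier R" "v \<in> carrier ?F"
    have "finite {x. c \<otimes> v x \<noteq> \<zero>}"
      by (rule finite_subset[of _ "{x. v x \<noteq> \<zero>}"]) (use cv in \<open>auto simp: free_module_simps\<close>)
    with cv show "c \<odot>\<^bsub>?F\<^esub> v \<in> carrier ?F" by (auto simp: free_module_simps)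
  qed
  show "\<forall>v\<in>carrier ?F. \<exists>w\<in>carrier ?F. v \<oplus>\<^bsub>?F\<^esub> w = \<zero>\<^bsub>?F\<^esub>"
  proof
    fix v assume v: "v \<in> carrier ?F"
    have "finite {x. \<ominus> v x \<noteq> \<zero>}"
      by (rule finite_subset[of _ "{x. v x \<noteq> \<zero>}"]) (use v in \<open>auto simp: free_module_simps\<close>)
    moreover have "\<And>x. v x \<in> carrier R" using free_module_carrier_closed[OF v] .
    ultimately show "\<exists>w\<in>carrier ?F. v \<oplus>\<^bsub>?F\<^esub> w = \<zero>\<^bsub>?F\<^esub>" using v
      by (intro bexI[of _ "\<lambda>x. \<ominus> v x"]) (auto simp: free_module_simps r_neg)
  qed
qed (auto simp: free_module_simps(2-4) m_assoc l_distr r_distr a_ac fun_eq_iff c)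
qed

lemma (in cring) free_gen_closed: "x \<in> X \<Longrightarrow> free_gen R x \<in> carrier (free_module R X)"
  by (auto simp: free_module_simps free_gen_def)

text \<open>The generating set inside \<open>exterior_relations\<close>, split off so that maps out
  of the exterior power can be checked on generators.\<close>

definition exterior_relators ::
  "('a, 'c) ring_scheme \<Rightarrow> ('a, 'b, 'd) module_scheme \<Rightarrow> nat \<Rightarrow> ('b list \<Rightarrow> 'a) set" where
  "exterior_relators R M m =
     (let F = free_module R (tuples M m); e = free_gen R in
       ({e (ws[i := v \<oplus>\<^bsub>M\<^esub> w]) \<ominus>\<^bsub>F\<^esub> (e (ws[i := v]) \<oplus>\<^bsub>F\<^esub> e (ws[i := w])) | ws i v w.
           ws \<in> tuples M m \<and> i < m \<and> v \<in> carrier M \<and> w \<in> carrier M}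
      \<union> {e (ws[i := a \<odot>\<^bsub>M\<^esub> v]) \<ominus>\<^bsub>F\<^esub> a \<odot>\<^bsub>F\<^esub> e (ws[i := v]) | ws i a v.
           ws \<in> tuples M m \<and> i < m \<and> a \<in> carrier R \<and> v \<in> carrier M}
      \<union> {e ws | ws. ws \<in> tuples M m \<and> (\<exists>i j. i < j \<and> j < m \<and> ws ! i = ws ! j)}))"

lemma exterior_relations_eq_span: "exterior_relations R M m =
    LinearCombinations.module.span R (free_module R (tuples M m)) (exterior_relators R M m)"
  by (simp only: exterior_relations_def exterior_relators_def Let_def)

context module
begin

lemma tuples_update: "ws \<in> tuples M m \<Longrightarrow> v \<in> carrier M \<Longrightarrow> ws[i := v] \<in> tuples M m"
  using set_update_subset_insert[of ws i v] by (auto simp: tuples_def)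

lemma exterior_relators_closed:
  "exterior_relators R M m \<subseteq> carrier (free_module R (tuples M m))"
proof -
  interpret F: module R "free_module R (tuples M m)" by (rule R.module_free_module)
  show ?thesis unfolding exterior_relators_def Let_def
    by (intro Un_least subsetI; elim CollectE exE conjE; hypsubst;
        intro F.M.minus_closed F.M.a_closed F.smult_closed R.free_gen_closed tuples_update M.a_closed smult_closed;
        assumption)
qed

lemma exterior_relations_submodule:
  "LinearCombinations.submodule R (exterior_relations R M m) (free_module R (tuples M m))"
proof -
  interpret F: module R "free_module R (tuples M m)" by (rule R.module_free_module)
  show ?thesis unfolding exterior_relations_eq_span
    by (rule F.span_is_submodule[OF exterior_relators_closed])
qed

lemma module_exterior_power: "module R (exterior_power R M m)"
  unfolding exterior_power_def by (rule module_quotient_module[OF exterior_relations_submodule])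

lemma exterior_relators_mem: "exterior_relators R M m \<subseteq> exterior_relations R M m"
proof -
  interpret F: module R "free_module R (tuples M m)" by (rule R.module_free_module)
  show ?thesis unfolding exterior_relations_eq_span
    by (rule F.in_own_span[OF exterior_relators_closed])
qed

lemma wedge_closed:
  assumes "set ws \<subseteq> carrier M"
  shows "wedge R M ws \<in> carrier (exterior_power R M (length ws))"
proof -
  have "ws \<in> tuples M (length ws)" using assms by (simp add: tuples_def)
  then show ?thesis unfolding exterior_power_def wedge_def
    by (auto simp: quotient_module_carrier[OF exterior_relations_submodule] intro: R.free_gen_closed)
qed

lemma exterior_relator_add:
  assumes "ws \<in> tuples M m" "i < m" "v \<in> carrier M" "w \<in> carrier M"
  shows "free_gen R (ws[i := v \<oplus>\<^bsub>M\<^esub> w]) \<ominus>\<^bsub>free_module R (tuples M m)\<^esub>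
     (free_gen R (ws[i := v]) \<oplus>\<^bsub>free_module R (tuples M m)\<^esub> free_gen R (ws[i := w]))
     \<in> exterior_relations R M m"
  by (rule set_mp[OF exterior_relators_mem], unfold exterior_relators_def Let_def, intro UnI1) (use assms in blast)

lemma exterior_relator_smult:
  assumes "ws \<in> tuples M m" "i < m" "a \<in> carrier R" "v \<in> carrier M"
  shows "free_gen R (ws[i := a \<odot>\<^bsub>M\<^esub> v]) \<ominus>\<^bsub>free_module R (tuples M m)\<^esub>
     a \<odot>\<^bsub>free_module R (tuples M m)\<^esub> free_gen R (ws[i := v]) \<in> exterior_relations R M m"
  by (rule set_mp[OF exterior_relators_mem], unfold exterior_relators_def Let_def, rule UnI1, rule UnI2) (use assms in blast)

lemma exterior_relator_repeat:
  assumes "ws \<in> tuples M m" "i < j" "j < m" "ws ! i = ws ! j"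
  shows "free_gen R ws \<in> exterior_relations R M m"
  by (rule set_mp[OF exterior_relators_mem], unfold exterior_relators_def Let_def, rule UnI2) (use assms in blast)

text \<open>The entry is marked by splitting the list as \<open>as @ v # bs\<close> instead of by an
  index, since later inductions on lists meet it in this form.\<close>

lemma wedge_add:
  assumes "set as \<subseteq> carrier M" "set bs \<subseteq> carrier M" "v \<in> carrier M" "w \<in> carrier M"
    and m: "m = Suc (length as + length bs)"
  shows "wedge R M (as @ (v \<oplus>\<^bsub>M\<^esub> w) # bs) =
    wedge R M (as @ v # bs) \<oplus>\<^bsub>exterior_power R M m\<^esub> wedge R M (as @ w # bs)"
proof -
  let ?F = "free_module R (tuples M m)" and ?N = "exterior_relations R M m"
  interpret F: module R ?F by (rule R.module_free_module)
  have len: "length (as @ x # bs) = m" for x using m by simp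
  have cl: "free_gen R (as @ x # bs) \<in> carrier ?F" if "x \<in> carrier M" for x
    by (rule R.free_gen_closed) (use that assms in \<open>auto simp: tuples_def\<close>)
  have "free_gen R ((as @ v # bs)[length as := v \<oplus>\<^bsub>M\<^esub> w]) \<ominus>\<^bsub>?F\<^esub>
      (free_gen R ((as @ v # bs)[length as := v]) \<oplus>\<^bsub>?F\<^esub> free_gen R ((as @ v # bs)[length as := w])) \<in> ?N"
    by (rule exterior_relator_add) (use assms in \<open>auto simp: tuples_def\<close>)
  then have "free_gen R (as @ (v \<oplus>\<^bsub>M\<^esub> w) # bs) \<ominus>\<^bsub>?F\<^esub>
      (free_gen R (as @ v # bs) \<oplus>\<^bsub>?F\<^esub> free_gen R (as @ w # bs)) \<in> ?N" by simp
  then show ?thesis unfolding wedge_def len exterior_power_def using assms(3,4)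
    by (simp add: quotient_module_add[OF exterior_relations_submodule]
        coset_eq_iff[OF exterior_relations_submodule] cl)
qed

lemma wedge_smult:
  assumes "set as \<subseteq> carrier M" "set bs \<subseteq> carrier M" "a \<in> carrier R" "v \<in> carrier M"
    and m: "m = Suc (length as + length bs)"
  shows "wedge R M (as @ (a \<odot>\<^bsub>M\<^esub> v) # bs) = a \<odot>\<^bsub>exterior_power R M m\<^esub> wedge R M (as @ v # bs)"
proof -
  let ?F = "free_module R (tuples M m)" and ?N = "exterior_relations R M m"
  interpret F: module R ?F by (rule R.module_free_module)
  have len: "length (as @ x # bs) = m" for x using m by simp
  have cl: "free_gen R (as @ x # bs) \<in> carrier ?F" if "x \<in> carrier M" for x
    by (rule R.free_gen_closed) (use that assms in \<open>auto simp: tuples_def\<close>)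
  have "free_gen R ((as @ v # bs)[length as := a \<odot>\<^bsub>M\<^esub> v]) \<ominus>\<^bsub>?F\<^esub>
      a \<odot>\<^bsub>?F\<^esub> free_gen R ((as @ v # bs)[length as := v]) \<in> ?N"
    by (rule exterior_relator_smult) (use assms in \<open>auto simp: tuples_def\<close>)
  then have "free_gen R (as @ (a \<odot>\<^bsub>M\<^esub> v) # bs) \<ominus>\<^bsub>?F\<^esub> a \<odot>\<^bsub>?F\<^esub> free_gen R (as @ v # bs) \<in> ?N" by simp
  then show ?thesis unfolding wedge_def len exterior_power_def using assms(3,4)
    by (simp add: quotient_module_smult[OF exterior_relations_submodule]
        coset_eq_iff[OF exterior_relations_submodule] cl)
qed

lemma wedge_repeat:
  assumes "set as \<subseteq> carrier M" "set bs \<subseteq> carrier M" "set cs \<subseteq> carrier M" "v \<in> carrier M"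
    and m: "m = length as + length bs + length cs + 2"
  shows "wedge R M (as @ v # bs @ v # cs) = \<zero>\<^bsub>exterior_power R M m\<^esub>"
proof -
  let ?ws = "as @ v # bs @ v # cs"
  have len: "length ?ws = m" using m by simp
  have ws: "?ws \<in> tuples M m" using assms by (auto simp: tuples_def)
  have "free_gen R ?ws \<in> exterior_relations R M m"
    by (rule exterior_relator_repeat[OF ws, of "length as" "Suc (length as + length bs)"])
      (use m in \<open>auto simp: nth_append nth_Cons'\<close>)
  with R.free_gen_closed[OF ws] show ?thesis
    unfolding wedge_def len exterior_power_def
    by (simp add: coset_eq_submodule_iff[OF exterior_relations_submodule]
       quotient_module_zero[OF exterior_relations_submodule])
qed

text \<open>Polarisation: with \<open>u \<oplus> v\<close> in both neighbouring places the wedge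
  vanishes, and expanding it leaves just the two mixed terms.\<close>

lemma wedge_swap:
  assumes "set as \<subseteq> carrier M" "set cs \<subseteq> carrier M" "u \<in> carrier M" "v \<in> carrier M"
    and m: "m = length as + length cs + 2"
  shows "wedge R M (as @ u # v # cs) = \<ominus>\<^bsub>exterior_power R M m\<^esub> wedge R M (as @ v # u # cs)"
proof -
  let ?E = "exterior_power R M m"
  interpret E: module R ?E by (rule module_exterior_power)
  let ?w = "\<lambda>x y. wedge R M (as @ x # y # cs)"
  have cl: "?w x y \<in> carrier ?E" if "x \<in> carrier M" "y \<in> carrier M" for x y
  proof -
    have "wedge R M (as @ x # y # cs) \<in> carrier (exterior_power R M (length (as @ x # y # cs)))"
      by (rule wedge_closed) (use assms that in auto)
    then show ?thesis using m by simp
  qed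
  have r: "?w x x = \<zero>\<^bsub>?E\<^esub>" if "x \<in> carrier M" for x
    using wedge_repeat[of as "[]" cs x m] assms that by simp
  have l: "?w (x \<oplus>\<^bsub>M\<^esub> y) z = ?w x z \<oplus>\<^bsub>?E\<^esub> ?w y z"
    if "x \<in> carrier M" "y \<in> carrier M" "z \<in> carrier M" for x y z
    using wedge_add[of as "z # cs" x y m] assms that by simp
  have rr: "?w z (x \<oplus>\<^bsub>M\<^esub> y) = ?w z x \<oplus>\<^bsub>?E\<^esub> ?w z y"
    if "x \<in> carrier M" "y \<in> carrier M" "z \<in> carrier M" for x y z
    using wedge_add[of "as @ [z]" cs x y m] assms that by simp
  have "\<zero>\<^bsub>?E\<^esub> = ?w (u \<oplus>\<^bsub>M\<^esub> v) (u \<oplus>\<^bsub>M\<^esub> v)" using r assms(3,4) by simp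
  also have "\<dots> = ?w u v \<oplus>\<^bsub>?E\<^esub> ?w v u" using assms(3,4) by (simp add: l rr r[OF assms(3)] r[OF assms(4)] cl E.M.a_comm)
  finally show ?thesis using cl assms E.M.minus_equality by metis
qed

end

text \<open>An exterior form \<open>\<Sum>\<^sub>J w\<^sub>J e\<^sub>J\<close> is encoded by its coefficient function \<open>J \<mapsto> w\<^sub>J\<close>, and a vector
  by \<open>j \<mapsto> v\<^sub>j\<close>; \<open>ext v w\<close> is \<open>v \<and> w\<close>.\<close>

definition ext_sign :: "nat \<Rightarrow> nat set \<Rightarrow> 'a::comm_ring_1" where
  "ext_sign j J = (- 1) ^ card {i \<in> J. i < j}"

definition ext :: "(nat \<Rightarrow> 'a) \<Rightarrow> (nat set \<Rightarrow> 'a) \<Rightarrow> nat set \<Rightarrow> 'a::comm_ring_1" where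
  "ext v w J = (\<Sum>j\<in>J. ext_sign j J * v j * w (J - {j}))"

definition unit_vec :: "nat \<Rightarrow> nat \<Rightarrow> 'a::comm_ring_1" where
  "unit_vec j = (\<lambda>k. if k = j then 1 else 0)"

definition ext_basis :: "nat set \<Rightarrow> nat set \<Rightarrow> 'a::comm_ring_1" where
  "ext_basis J = (\<lambda>J'. if J' = J then 1 else 0)"

lemma ext_add_left: "ext (u + v) w = ext u w + ext v w"
  by (auto simp: ext_def fun_eq_iff algebra_simps sum.distrib)

lemma ext_add_right: "ext v (w + w') = ext v w + ext v w'"
  by (auto simp: ext_def fun_eq_iff algebra_simps sum.distrib)

lemma ext_scale_right: "ext v (\<lambda>J. h * w J) = (\<lambda>J. h * ext v w J)"
  by (auto simp: ext_def fun_eq_iff sum_distrib_left algebra_simps intro!: sum.cong)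

lemma ext_scale_left: "ext (\<lambda>j. h * v j) w = ext v (\<lambda>J. h * w J)"
  by (auto simp: ext_def fun_eq_iff algebra_simps intro!: sum.cong)

lemma ext_zero_right [simp]: "ext v (\<lambda>_. 0) = (\<lambda>_. 0)"
  by (auto simp: ext_def fun_eq_iff)

lemma ext_zero_left [simp]: "ext (\<lambda>_. 0) w = (\<lambda>_. 0)"
  by (auto simp: ext_def fun_eq_iff)

lemma ext_diff_left: "ext (u - v) w = ext u w - ext v w"
  by (auto simp: ext_def fun_eq_iff algebra_simps sum_subtractf)

lemma ext_diff_right: "ext v (w - w') = ext v w - ext v w'"
  by (auto simp: ext_def fun_eq_iff algebra_simps sum_subtractf)

text \<open>Removing \<open>j\<close> lowers the number of indices below \<open>k\<close> by one,
  whereas removing \<open>k\<close> does not affect the number below \<open>j\<close>; so exactly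
  one sign flips.\<close>

lemma ext_sign_swap:
  assumes "finite J" "j \<in> J" "k \<in> J" "j < k"
  shows "ext_sign j J * ext_sign k (J - {j}) = - (ext_sign k J * ext_sign j (J - {k}) :: 'a::comm_ring_1)"
proof -
  have 1: "{i \<in> J - {k}. i < j} = {i \<in> J. i < j}" using assms by auto
  have 2: "{i \<in> J. i < k} = insert j {i \<in> J - {j}. i < k}" using assms by auto
  have 3: "card {i \<in> J. i < k} = Suc (card {i \<in> J - {j}. i < k})"
    unfolding 2 using assms by (subst card_insert_disjoint) auto
  show ?thesis unfolding ext_sign_def 1 3 by simp
qed

lemma ext_anticommute: "ext u (ext v w) = - ext v (ext u w)" for w :: "nat set \<Rightarrow> 'a::comm_ring_1"
proof
  fix J :: "nat set"
  show "ext u (ext v w) J = (- ext v (ext u w)) J"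
  proof (cases "finite J")
    case False then show ?thesis by (simp add: ext_def)
  next
    case fin: True
    \<comment> \<open>The diagonal is set to zero so that both indices run over all of
      \<open>J\<close> and the two sums can be exchanged.\<close>
    define F where "F u v j k = (if k = j then 0 else
      ext_sign j J * ext_sign k (J - {j}) * u j * v k * w (J - {j} - {k}))" for u v :: "nat \<Rightarrow> 'a" and j k
    have E: "ext u (ext v w) J = (\<Sum>j\<in>J. \<Sum>k\<in>J. F u v j k)" for u v
    proof -
      have "ext_sign j J * u j * ext v w (J - {j}) = (\<Sum>k\<in>J. F u v j k)" if "j \<in> J" for j
      proof -
        have "(\<Sum>k\<in>J. F u v j k) = (\<Sum>k\<in>J - {j}. F u v j k)"
          by (rule sum.mono_neutral_right) (use fin in \<open>auto simp: F_def\<close>)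
        then show ?thesis
          by (auto simp: ext_def F_def sum_distrib_left algebra_simps intro!: sum.cong)
      qed
      then show ?thesis by (simp add: ext_def[of u])
    qed
    have anti: "F u v j k = - F v u k j" if "j \<in> J" "k \<in> J" for j k
    proof -
      have JJ: "J - {j} - {k} = J - {k} - {j}" by auto
      consider "j = k" | "j < k" | "k < j" by linarith
      then show ?thesis
      proof cases
        case 2
        then show ?thesis using ext_sign_swap[OF fin that(1,2) 2, where ?'a='a]
          by (simp add: F_def JJ algebra_simps)
      next
        case 3
        then show ?thesis using ext_sign_swap[OF fin that(2,1) 3, where ?'a='a]
          by (simp add: F_def JJ algebra_simps)
      qed (simp add: F_def)
    qed
    have "ext u (ext v w) J = (\<Sum>j\<in>J. \<Sum>k\<in>J. - F v u k j)"
      unfolding E by (intro sum.cong refl anti)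
    also have "\<dots> = - (\<Sum>k\<in>J. \<Sum>j\<in>J. F v u k j)"
      by (subst sum.swap) (simp add: sum_negf)
    finally show ?thesis by (simp add: E)
  qed
qed

text \<open>Anticommutation with itself only gives that twice the form is zero; characteristic zero
  allows division by 2.\<close>

lemma ext_twice [simp]: "ext v (ext v w) = (\<lambda>_. 0 :: 'a::{idom,ring_char_0})"
proof -
  have "ext v (ext v w) J = - ext v (ext v w) J" for J
    using ext_anticommute[of v v w] by (simp add: fun_eq_iff)
  then have "2 * ext v (ext v w) J = 0" for J by (metis add.right_inverse mult_2)
  then show ?thesis by (simp add: fun_eq_iff)
qed

text \<open>The outer \<open>v\<close> is moved inwards by anticommutation until it meets the other
  one.\<close>

lemma ext_repeat:
  "ext v (foldr ext bs (ext v w)) = (\<lambda>_. 0 :: 'a::{idom,ring_char_0})"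
proof (induction bs)
  case (Cons b bs)
  have "ext v (ext b (foldr ext bs (ext v w))) = - ext b (ext v (foldr ext bs (ext v w)))"
    by (rule ext_anticommute)
  with Cons show ?case by (simp add: fun_eq_iff[of "ext v (ext b _)"])
qed simp

lemma foldr_ext_zero [simp]: "foldr ext vs (\<lambda>_. 0) = (\<lambda>_. 0)"
  by (induction vs) auto

lemma ext_unit_basis:
  assumes "finite J"
  shows "ext (unit_vec j) (ext_basis J) = (if j \<in> J then (\<lambda>_. 0)
    else (\<lambda>J'. ext_sign j (insert j J) * ext_basis (insert j J) J'))"
proof
  fix J' :: "nat set"
  let ?R = "if j \<in> J then (\<lambda>_. 0) else (\<lambda>J'. ext_sign j (insert j J) * ext_basis (insert j J) J')"
  show "ext (unit_vec j) (ext_basis J) J' = (?R J' :: 'a)"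
  proof (cases "finite J' \<and> j \<in> J'")
    case True
    have "ext (unit_vec j) (ext_basis J) J' =
        (\<Sum>k\<in>J'. if k = j then ext_sign j J' * ext_basis J (J' - {j}) else (0 :: 'a))"
      unfolding ext_def by (intro sum.cong) (auto simp: unit_vec_def)
    also have "\<dots> = ext_sign j J' * ext_basis J (J' - {j})" using True by simp
    also have "\<dots> = ?R J'"
    proof (cases "J' - {j} = J")
      case eq: True
      then have "J' = insert j J" "j \<notin> J" using True by auto
      then show ?thesis by (simp add: ext_basis_def)
    next
      case False
      then have "j \<in> J \<or> J' \<noteq> insert j J" by auto
      with False show ?thesis by (auto simp: ext_basis_def)
    qed
    finally show ?thesis .
  next
    \<comment> \<open>An infinite \<open>J'\<close> falls under this case too: sums over it are zero
      by convention, and \<open>insert j J\<close> is finite.\<close>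
    case False
    then have "J' \<noteq> insert j J" using assms(1) by auto
    moreover have "ext (unit_vec j) (ext_basis J) J' = (0 :: 'a)"
      using False by (cases "finite J'") (auto simp: ext_def unit_vec_def intro!: sum.neutral)
    ultimately show ?thesis by (simp add: ext_basis_def)
  qed
qed

text \<open>In an increasing list each new index lies below all indices already present, so every
  sign is 1.\<close>

lemma foldr_ext_unit:
  "sorted_wrt (<) js \<Longrightarrow> foldr ext (map unit_vec js) (ext_basis {}) = ext_basis (set js)"
proof (induction js)
  case (Cons j js)
  then have "{i \<in> insert j (set js). i < j} = {}" "j \<notin> set js" by auto
  moreover from this have "ext_sign j (insert j (set js)) = (1 :: 'a)"
    by (simp only: ext_sign_def card.empty power_0)
  ultimately show ?case using Cons by (simp add: ext_unit_basis)
qed simp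

lemma foldr_ext_diff: "foldr ext vs (w - w') = foldr ext vs w - foldr ext vs w'"
  by (induction vs) (simp_all only: foldr_Nil foldr_Cons o_apply id_apply ext_diff_right)

lemma foldr_ext_add: "foldr ext vs (w + w') = foldr ext vs w + foldr ext vs w'"
  by (induction vs) (simp_all only: foldr_Nil foldr_Cons o_apply id_apply ext_add_right)

lemma foldr_ext_scale: "foldr ext vs (\<lambda>J. h * w J) = (\<lambda>J. h * foldr ext vs w J)"
  by (induction vs) (simp_all only: foldr_Nil foldr_Cons o_apply id_apply ext_scale_right)

section \<open>Finitely supported maps: induction and the degree of a monomial\<close>

abbreviation keys where "keys \<equiv> Poly_Mapping.keys"
abbreviation lookup where "lookup \<equiv> Poly_Mapping.lookup"
abbreviation single where "single \<equiv> Poly_Mapping.single"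

lemma poly_mapping_sum_single: "p = (\<Sum>t\<in>keys p. single t (lookup p t))"
  by (rule poly_mapping_eqI)
    (simp add: lookup_sum lookup_single when_def not_in_keys_iff_lookup_eq_zero)

lemma poly_mapping_induct [case_names single add]:
  fixes p :: "'a::zero \<Rightarrow>\<^sub>0 'b::comm_monoid_add"
  assumes single: "\<And>t c. P (single t c)" and add: "\<And>p q. P p \<Longrightarrow> P q \<Longrightarrow> P (p + q)"
  shows "P p"
proof -
  have "P (\<Sum>t\<in>T. single t (lookup p t))" if "finite T" for T
    using that by (induction T) (use single[of 0 0] in \<open>auto intro: single add\<close>)
  then show ?thesis using poly_mapping_sum_single[of p] finite_keys by metis
qed

lemma mdeg_superset: "finite T \<Longrightarrow> keys t \<subseteq> T \<Longrightarrow> mdeg t = (\<Sum>i\<in>T. lookup t i)"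
  unfolding mdeg_def by (rule sum.mono_neutral_left) (auto simp: in_keys_iff)

lemma mdeg_add [simp]: "mdeg (s + t) = mdeg s + mdeg t"
proof -
  let ?T = "keys s \<union> keys t"
  have "keys (s + t) \<subseteq> ?T" by (rule keys_add)
  then show ?thesis
    by (simp add: mdeg_superset[of ?T] lookup_add sum.distrib)
qed

lemma mdeg_single [simp]: "mdeg (single i c) = c"
  by (simp add: mdeg_def)

lemma mdeg_zero [simp]: "mdeg 0 = 0"
  by (simp add: mdeg_def)

section \<open>Derivatives and homogeneous components of polynomials\<close>

text \<open>The formal partial derivative. The truncated subtraction \<open>t - single k 1\<close>
  is wrong only if \<open>X_k\<close> does not occur in \<open>t\<close>, and then the coefficient
  is zero.\<close>

definition pd :: "nat \<Rightarrow> 'k::field mpoly \<Rightarrow> 'k mpoly" where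
  "pd k p = (\<Sum>t\<in>keys p. single (t - single k 1) (of_nat (lookup t k) * lookup p t))"

lemma pd_superset:
  "finite T \<Longrightarrow> keys p \<subseteq> T \<Longrightarrow>
    pd k p = (\<Sum>t\<in>T. single (t - single k 1) (of_nat (lookup t k) * lookup p t))"
  unfolding pd_def by (rule sum.mono_neutral_left) (auto simp: in_keys_iff)

lemma pd_add [simp]: "pd k (p + q) = pd k p + pd k q"
  using keys_add[of p q]
  by (simp add: pd_superset[of "keys p \<union> keys q"] lookup_add distrib_left single_add sum.distrib)

lemma pd_single: "pd k (single t c) = single (t - single k 1) (of_nat (lookup t k) * c)"
  by (subst pd_superset[of "{t}"]) auto

lemma pd_0 [simp]: "pd k 0 = 0"
  by (simp add: pd_def)

lemma pd_minus [simp]: "pd k (- p) = - pd k p"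
  using pd_add[of k p "- p"] by (simp add: eq_neg_iff_add_eq_0 add.commute)

lemma pd_diff [simp]: "pd k (p - q) = pd k p - pd k q"
  using pd_add[of k p "- q"] by simp

lemma pd_sum: "pd k (\<Sum>x\<in>A. f x) = (\<Sum>x\<in>A. pd k (f x))"
  by (induction A rule: infinite_finite_induct) auto

text \<open>Both sides are additive in each factor, which reduces the Leibniz rule to two
  monomials.\<close>

lemma pd_mult: "pd k (p * q) = p * pd k q + q * pd k p" for p :: "'k::field mpoly"
proof (induction p arbitrary: q rule: poly_mapping_induct)
  case (single s c)
  show ?case
  proof (induction q rule: poly_mapping_induct)
    case (single t d)
    \<comment> \<open>If \<open>lookup t k\<close> is zero the exponents may differ, but both
      coefficients vanish.\<close>
    have 1: "single (s + (t - single k 1)) (of_nat (lookup t k) * (c * d)) =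
        single (s + t - single k 1) (of_nat (lookup t k) * (c * d))"
    proof (cases "lookup t k = 0")
      case False
      then have "s + (t - single k 1) = s + t - single k 1"
        by (intro poly_mapping_eqI) (auto simp: lookup_add lookup_minus lookup_single when_def)
      then show ?thesis by simp
    qed simp
    have 2: "single (t + (s - single k 1)) (of_nat (lookup s k) * (c * d)) =
        single (s + t - single k 1) (of_nat (lookup s k) * (c * d))"
    proof (cases "lookup s k = 0")
      case False
      then have "t + (s - single k 1) = s + t - single k 1"
        by (intro poly_mapping_eqI) (auto simp: lookup_add lookup_minus lookup_single when_def)
      then show ?thesis by simp
    qed simp
    have "single s c * pd k (single t d) + single t d * pd k (single s c) =
        single (s + (t - single k 1)) (of_nat (lookup t k) * (c * d)) +
        single (t + (s - single k 1)) (of_nat (lookup s k) * (c * d))"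
      by (simp add: pd_single mult_single mult_ac)
    also have "\<dots> = single (s + t - single k 1) (of_nat (lookup (s + t) k) * (c * d))"
      unfolding 1 2 single_add[symmetric] by (simp add: lookup_add algebra_simps)
    also have "\<dots> = pd k (single s c * single t d)"
      by (simp add: pd_single mult_single)
    finally show ?case by simp
  next
    case (add p q)
    then show ?case by (simp add: algebra_simps)
  qed
next
  case (add p r)
  then show ?case by (simp add: distrib_left distrib_right add_ac)
qed

lemma pd_const [simp]: "pd k (const c) = 0"
  by (simp add: const_def pd_single)

lemma pd_var: "pd k (var i) = (if i = k then 1 else 0)"
  by (auto simp: var_def pd_single lookup_single when_def)

text \<open>The homogeneous component of degree \<open>d\<close>. A natural number suffices as index
  because forms of negative degree are zero.\<close>

definition hc :: "nat \<Rightarrow> 'k::field mpoly \<Rightarrow> 'k mpoly" where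
  "hc d p = (\<Sum>t\<in>{t \<in> keys p. mdeg t = d}. single t (lookup p t))"

lemma lookup_hc: "lookup (hc d p) t = (if mdeg t = d then lookup p t else 0)"
proof -
  have "lookup (hc d p) t = (\<Sum>u\<in>{u \<in> keys p. mdeg u = d}. if u = t then lookup p u else 0)"
    by (auto simp: hc_def lookup_sum lookup_single when_def intro!: sum.cong)
  also have "\<dots> = (if mdeg t = d then lookup p t else 0)"
    by (subst sum.delta) (auto simp: in_keys_iff)
  finally show ?thesis .
qed

lemma keys_hc: "keys (hc d p) = {t \<in> keys p. mdeg t = d}"
  by (auto simp: in_keys_iff lookup_hc split: if_splits)

lemma hc_add [simp]: "hc d (p + q) = hc d p + hc d q"
  by (rule poly_mapping_eqI) (simp add: lookup_hc lookup_add)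

lemma hc_0 [simp]: "hc d 0 = 0"
  by (rule poly_mapping_eqI) (simp add: lookup_hc)

lemma hc_minus [simp]: "hc d (- p) = - hc d p"
  by (rule poly_mapping_eqI) (simp add: lookup_hc)

lemma hc_sum: "hc d (\<Sum>x\<in>A. f x) = (\<Sum>x\<in>A. hc d (f x))"
  by (induction A rule: infinite_finite_induct) auto

lemma hc_single: "hc d (single t c) = (if mdeg t = d then single t c else 0)"
  by (rule poly_mapping_eqI) (auto simp: lookup_hc lookup_single when_def)

lemma hc_mult: "hc d (p * q) = (\<Sum>i\<le>d. hc i p * hc (d - i) q)"
proof (induction p arbitrary: q rule: poly_mapping_induct)
  case (single s a)
  show ?case
  proof (induction q rule: poly_mapping_induct)
    case (single t b)
    have "(\<Sum>i\<le>d. hc i (single s a) * hc (d - i) (single t b)) =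
        (\<Sum>i\<le>d. if i = mdeg s then (if mdeg t = d - i then single (s + t) (a * b) else 0) else 0)"
      by (intro sum.cong) (auto simp: hc_single mult_single)
    also have "\<dots> = hc d (single s a * single t b)"
      by (auto simp: hc_single mult_single)
    finally show ?case by simp
  next
    case (add p q)
    then show ?case by (simp add: distrib_left sum.distrib)
  qed
next
  case (add p r)
  then show ?case by (simp add: distrib_right sum.distrib)
qed

lemma hc_pd: "hc d (pd k p) = pd k (hc (Suc d) p)"
proof (induction p rule: poly_mapping_induct)
  case (single t c)
  show ?case
  proof (cases "lookup t k = 0")
    case True
    then show ?thesis by (simp add: pd_single hc_single)
  next
    case False
    then have "t = (t - single k 1) + single k 1"
      by (intro poly_mapping_eqI) (auto simp: lookup_add lookup_minus lookup_single when_def)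
    then have "mdeg t = Suc (mdeg (t - single k 1))"
      by (metis mdeg_add mdeg_single Suc_eq_plus1)
    then show ?thesis by (simp add: pd_single hc_single)
  qed
qed simp

lemma sum_hc: "\<exists>D0. \<forall>D\<ge>D0. p = (\<Sum>d\<le>D. hc d p)"
proof -
  have "p = (\<Sum>d\<le>D. hc d p)" if "D \<ge> Max (insert 0 (mdeg ` keys p))" for D
  proof (rule poly_mapping_eqI)
    fix t
    have "mdeg t \<le> D" if "lookup p t \<noteq> 0"
      using \<open>D \<ge> _\<close> that by (subst (asm) Max_le_iff) (auto simp: in_keys_iff)
    then show "lookup p t = lookup (\<Sum>d\<le>D. hc d p) t"
      by (auto simp: lookup_sum lookup_hc)
  qed
  then show ?thesis by blast
qed

section \<open>The polynomial ring in the variables up to \<open>n\<close>, inside a type with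
  infinitely many variables, and its forms\<close>

lemma poly_ring_simps [simp]:
  "mult (poly_ring n) = (*)" "one (poly_ring n) = 1" "zero (poly_ring n) = 0" "add (poly_ring n) = (+)"
  by (simp_all add: poly_ring_def)

lemma carrier_poly_ring: "p \<in> carrier (poly_ring n) \<longleftrightarrow> (\<forall>t\<in>keys p. keys t \<subseteq> {..n})"
  by (simp add: poly_ring_def)

abbreviation pcarrier :: "nat \<Rightarrow> 'k::field mpoly set" where
  "pcarrier n \<equiv> carrier (poly_ring n)"

lemma pcarrier_single: "keys t \<subseteq> {..n} \<Longrightarrow> single t c \<in> pcarrier n"
  by (auto simp: carrier_poly_ring split: if_splits)

lemma pcarrier_0 [simp, intro]: "0 \<in> pcarrier n"
  by (simp add: carrier_poly_ring)

lemma pcarrier_const [simp, intro]: "const c \<in> pcarrier n"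
  by (auto simp: const_def intro: pcarrier_single)

lemma const_1: "const 1 = 1" by (simp add: const_def)
lemma const_0: "const 0 = 0" by (simp add: const_def)

lemma pcarrier_1 [simp, intro]: "1 \<in> pcarrier n"
  using pcarrier_const[of 1 n] by (simp add: const_1)

lemma pcarrier_var [intro]: "i \<le> n \<Longrightarrow> var i \<in> pcarrier n"
  by (auto simp: var_def intro!: pcarrier_single)

lemma pcarrier_add [intro]: "p \<in> pcarrier n \<Longrightarrow> q \<in> pcarrier n \<Longrightarrow> p + q \<in> pcarrier n"
  using keys_add[of p q] by (auto simp: carrier_poly_ring)

lemma pcarrier_minus [intro]: "p \<in> pcarrier n \<Longrightarrow> - p \<in> pcarrier n"
  by (simp add: carrier_poly_ring)

lemma pcarrier_diff [intro]: "p \<in> pcarrier n \<Longrightarrow> q \<in> pcarrier n \<Longrightarrow> p - q \<in> pcarrier n"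
  using pcarrier_add[of p n "- q"] by auto

lemma pcarrier_mult [intro]: "p \<in> pcarrier n \<Longrightarrow> q \<in> pcarrier n \<Longrightarrow> p * q \<in> pcarrier n"
proof -
  assume a: "p \<in> pcarrier n" "q \<in> pcarrier n"
  show ?thesis unfolding carrier_poly_ring
  proof
    fix t assume "t \<in> keys (p * q)"
    then obtain u v where "t = u + v" "u \<in> keys p" "v \<in> keys q" using keys_mult[of p q] by auto
    then show "keys t \<subseteq> {..n}" using a keys_add[of u v] unfolding carrier_poly_ring by blast
  qed
qed

lemma pcarrier_sum [intro]: "(\<And>x. x \<in> A \<Longrightarrow> f x \<in> pcarrier n) \<Longrightarrow> (\<Sum>x\<in>A. f x) \<in> pcarrier n"
  by (induction A rule: infinite_finite_induct) auto

lemma pcarrier_power [intro]: "p \<in> pcarrier n \<Longrightarrow> p ^ e \<in> pcarrier n"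
  by (induction e) auto

lemma pcarrier_pd [intro]: "p \<in> pcarrier n \<Longrightarrow> pd k p \<in> pcarrier n"
  unfolding pd_def
proof (intro pcarrier_sum pcarrier_single)
  fix t assume "p \<in> pcarrier n" "t \<in> keys p"
  then have "keys t \<subseteq> {..n}" by (auto simp: carrier_poly_ring)
  moreover have "keys (t - single k 1) \<subseteq> keys t" by (auto simp: in_keys_iff lookup_minus)
  ultimately show "keys (t - single k 1) \<subseteq> {..n}" by blast
qed

lemma pd_outside: "p \<in> pcarrier n \<Longrightarrow> n < k \<Longrightarrow> pd k p = 0"
  unfolding pd_def
proof (intro sum.neutral ballI)
  fix t assume "p \<in> pcarrier n" "n < k" "t \<in> keys p"
  then have "k \<notin> keys t" by (force simp: carrier_poly_ring)
  then show "single (t - single k 1) (of_nat (lookup t k) * lookup p t) = 0"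
    by (simp add: in_keys_iff)
qed

lemma cring_poly_ring: "cring (poly_ring n :: 'k::field mpoly ring)"
proof (rule cringI)
  show "abelian_group (poly_ring n :: 'k mpoly ring)"
  proof (rule abelian_groupI)
    fix x :: "'k mpoly" assume "x \<in> pcarrier n"
    then show "\<exists>y\<in>pcarrier n. y \<oplus>\<^bsub>poly_ring n\<^esub> x = \<zero>\<^bsub>poly_ring n\<^esub>"
      by (intro bexI[of _ "- x"]) auto
  qed (auto simp: algebra_simps)
  show "comm_monoid (poly_ring n :: 'k mpoly ring)"
    by (rule comm_monoidI) (auto simp: algebra_simps)
qed (auto simp: algebra_simps)

lemma poly_ring_a_inv: "p \<in> pcarrier n \<Longrightarrow> \<ominus>\<^bsub>poly_ring n\<^esub> p = - p"
proof -
  interpret cring "poly_ring n" by (rule cring_poly_ring)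
  assume "p \<in> pcarrier n"
  then show ?thesis by (intro minus_equality) auto
qed

lemma forms_iff: "p \<in> forms n s \<longleftrightarrow> p \<in> pcarrier n \<and> (\<forall>t\<in>keys p. int (mdeg t) = s)"
  by (simp add: forms_def)

lemma forms_pcarrier: "p \<in> forms n s \<Longrightarrow> p \<in> pcarrier n"
  by (simp add: forms_iff)

lemma forms_0 [simp, intro]: "0 \<in> forms n s"
  by (simp add: forms_iff)

lemma forms_add [intro]: "p \<in> forms n s \<Longrightarrow> q \<in> forms n s \<Longrightarrow> p + q \<in> forms n s"
  using keys_add[of p q] by (auto simp: forms_iff)

lemma forms_minus [intro]: "p \<in> forms n s \<Longrightarrow> - p \<in> forms n s"
  by (auto simp: forms_iff)

lemma forms_diff [intro]: "p \<in> forms n s \<Longrightarrow> q \<in> forms n s \<Longrightarrow> p - q \<in> forms n s"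
  using forms_add[of p n s "- q"] by auto

lemma forms_sum [intro]: "(\<And>x. x \<in> A \<Longrightarrow> f x \<in> forms n s) \<Longrightarrow> (\<Sum>x\<in>A. f x) \<in> forms n s"
  by (induction A rule: infinite_finite_induct) auto

lemma forms_mult: "p \<in> forms n s \<Longrightarrow> q \<in> forms n s' \<Longrightarrow> p * q \<in> forms n (s + s')"
proof -
  assume a: "p \<in> forms n s" "q \<in> forms n s'"
  have "int (mdeg t) = s + s'" if "t \<in> keys (p * q)" for t
  proof -
    obtain u v where "t = u + v" "u \<in> keys p" "v \<in> keys q" using keys_mult[of p q] \<open>t \<in> _\<close> by auto
    then show ?thesis using a by (auto simp: forms_iff)
  qed
  then show ?thesis using a by (auto simp: forms_iff)
qed

lemma forms_const [intro]: "const c \<in> forms n 0"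
  using pcarrier_const[of c n] by (auto simp: forms_iff const_def split: if_splits)

lemma forms_scale: "p \<in> forms n s \<Longrightarrow> const c * p \<in> forms n s"
  using forms_mult[OF forms_const, of p n s c] by simp

lemma forms_var [intro]: "i \<le> n \<Longrightarrow> var i \<in> forms n 1"
  by (auto simp: forms_iff var_def split: if_splits intro!: pcarrier_single)

lemma forms_single: "keys t \<subseteq> {..n} \<Longrightarrow> single t c \<in> forms n (int (mdeg t))"
  by (auto simp: forms_iff intro!: pcarrier_single split: if_splits)

lemma forms_neg: "s < 0 \<Longrightarrow> forms n s = {0}"
proof -
  assume "s < 0"
  then have "p = 0" if "p \<in> forms n s" for p :: "'a mpoly"
    using that by (intro poly_mapping_eqI) (force simp: forms_iff in_keys_iff)
  then show ?thesis by auto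
qed

text \<open>By \<open>hc_pd\<close>, every component of the derivative outside degree
  \<open>s - 1\<close> is the derivative of a vanishing component.\<close>

lemma forms_pd: "p \<in> forms n s \<Longrightarrow> pd k p \<in> forms n (s - 1)"
proof -
  assume p: "p \<in> forms n s"
  have "hc d (pd k p) = 0" if "int d \<noteq> s - 1" for d
  proof -
    have "hc (Suc d) p = 0"
      using p that by (intro poly_mapping_eqI) (force simp: lookup_hc forms_iff in_keys_iff)
    then show ?thesis by (simp add: hc_pd)
  qed
  then have "int (mdeg t) = s - 1" if "t \<in> keys (pd k p)" for t
    using that by (metis lookup_hc in_keys_iff lookup_zero)
  then show ?thesis using p by (auto simp: forms_iff)
qed

lemma pcarrier_hc: "p \<in> pcarrier n \<Longrightarrow> hc d p \<in> pcarrier n"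
  by (auto simp: carrier_poly_ring keys_hc)

lemma forms_hc: "p \<in> pcarrier n \<Longrightarrow> hc d p \<in> forms n (int d)"
  by (auto simp: forms_iff pcarrier_hc keys_hc)

lemma hc_forms: "p \<in> forms n s \<Longrightarrow> hc d p = (if s = int d then p else 0)"
  by (rule poly_mapping_eqI) (auto simp: lookup_hc forms_iff in_keys_iff)

text \<open>Exhibits monomials as products of variables, so that \<open>pcarrier_induct\<close>
  reaches all polynomials by ring operations.\<close>

lemma single_var: "single t c = const c * (\<Prod>i\<in>keys t. var i ^ lookup t i)"
proof -
  have pw: "var i ^ e = single (single i e) 1" for i e
    by (induction e) (auto simp: var_def mult_single single_add[symmetric])
  have "(\<Prod>i\<in>A. single (single i (lookup t i)) 1) = single (\<Sum>i\<in>A. single i (lookup t i)) (1::'a)" for A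
    by (induction A rule: infinite_finite_induct) (auto simp: mult_single)
  then show ?thesis
    by (simp add: pw const_def mult_single poly_mapping_sum_single[symmetric])
qed

section \<open>Kaehler differentials of the coordinate ring\<close>

definition kaehler_relators :: "('a, 'c) ring_scheme \<Rightarrow> 'a set \<Rightarrow> ('a \<Rightarrow> 'a) set" where
  "kaehler_relators R k =
     (let F = free_module R (carrier R); e = free_gen R in
       ({e (a \<oplus>\<^bsub>R\<^esub> b) \<ominus>\<^bsub>F\<^esub> (e a \<oplus>\<^bsub>F\<^esub> e b) | a b. a \<in> carrier R \<and> b \<in> carrier R}
      \<union> {e (a \<otimes>\<^bsub>R\<^esub> b) \<ominus>\<^bsub>F\<^esub> (a \<odot>\<^bsub>F\<^esub> e b \<oplus>\<^bsub>F\<^esub> b \<odot>\<^bsub>F\<^esub> e a) | a b. a \<in> carrier R \<and> b \<in> carrier R}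
      \<union> e ` k))"

lemma kaehler_relations_eq_span: "kaehler_relations R k =
    LinearCombinations.module.span R (free_module R (carrier R)) (kaehler_relators R k)"
  by (simp only: kaehler_relations_def kaehler_relators_def Let_def)

context
  fixes R :: "('a, 'c) ring_scheme" (structure) and k :: "'a set"
  assumes R: "cring R" and k: "k \<subseteq> carrier R"
begin

interpretation R: cring R by (rule R)
interpretation F: module R "free_module R (carrier R)" by (rule R.module_free_module)

lemma kaehler_relators_closed: "kaehler_relators R k \<subseteq> carrier (free_module R (carrier R))"
proof -
  have e: "free_gen R a \<in> carrier (free_module R (carrier R))" if "a \<in> carrier R" for a
    using that by (rule R.free_gen_closed)
  have "free_gen R ` k \<subseteq> carrier (free_module R (carrier R))" using e k by auto
  show ?thesis unfolding kaehler_relators_def Let_def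
    by (intro Un_least; (fact | (intro subsetI; elim CollectE exE conjE; hypsubst;
        intro F.M.minus_closed F.M.a_closed F.smult_closed e R.a_closed R.m_closed; assumption)))
qed

lemma kaehler_relations_submodule:
  "LinearCombinations.submodule R (kaehler_relations R k) (free_module R (carrier R))"
  unfolding kaehler_relations_eq_span by (rule F.span_is_submodule[OF kaehler_relators_closed])

lemma module_kaehler_module: "module R (kaehler_module R k)"
  unfolding kaehler_module_def by (rule module_quotient_module[OF kaehler_relations_submodule])

lemma kaehler_relators_mem: "kaehler_relators R k \<subseteq> kaehler_relations R k"
  unfolding kaehler_relations_eq_span by (rule F.in_own_span[OF kaehler_relators_closed])

lemma kaehler_d_closed: "a \<in> carrier R \<Longrightarrow> kaehler_d R k a \<in> carrier (kaehler_module R k)"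
  unfolding kaehler_module_def kaehler_d_def
  by (simp add: quotient_module_carrier[OF kaehler_relations_submodule] R.free_gen_closed)

lemma kaehler_d_add:
  assumes "a \<in> carrier R" "b \<in> carrier R"
  shows "kaehler_d R k (a \<oplus> b) = kaehler_d R k a \<oplus>\<^bsub>kaehler_module R k\<^esub> kaehler_d R k b"
proof -
  have "free_gen R (a \<oplus> b) \<ominus>\<^bsub>free_module R (carrier R)\<^esub>
      (free_gen R a \<oplus>\<^bsub>free_module R (carrier R)\<^esub> free_gen R b) \<in> kaehler_relations R k"
    by (rule set_mp[OF kaehler_relators_mem], unfold kaehler_relators_def Let_def, intro UnI1)
      (use assms in blast)
  then show ?thesis unfolding kaehler_module_def kaehler_d_def using assms
    by (simp add: quotient_module_add[OF kaehler_relations_submodule]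
        coset_eq_iff[OF kaehler_relations_submodule] R.free_gen_closed)
qed

lemma kaehler_d_mult:
  assumes "a \<in> carrier R" "b \<in> carrier R"
  shows "kaehler_d R k (a \<otimes> b) = a \<odot>\<^bsub>kaehler_module R k\<^esub> kaehler_d R k b
      \<oplus>\<^bsub>kaehler_module R k\<^esub> b \<odot>\<^bsub>kaehler_module R k\<^esub> kaehler_d R k a"
proof -
  let ?F = "free_module R (carrier R)"
  have "free_gen R (a \<otimes> b) \<ominus>\<^bsub>?F\<^esub>
      (a \<odot>\<^bsub>?F\<^esub> free_gen R b \<oplus>\<^bsub>?F\<^esub> b \<odot>\<^bsub>?F\<^esub> free_gen R a) \<in> kaehler_relations R k"
    by (rule set_mp[OF kaehler_relators_mem], unfold kaehler_relators_def Let_def, rule UnI1, rule UnI2)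
      (use assms in blast)
  then show ?thesis unfolding kaehler_module_def kaehler_d_def using assms
    by (simp add: quotient_module_add[OF kaehler_relations_submodule]
        quotient_module_smult[OF kaehler_relations_submodule]
        coset_eq_iff[OF kaehler_relations_submodule] R.free_gen_closed)
qed

lemma kaehler_d_base: "a \<in> k \<Longrightarrow> kaehler_d R k a = \<zero>\<^bsub>kaehler_module R k\<^esub>"
proof -
  assume a: "a \<in> k"
  have "free_gen R a \<in> kaehler_relations R k"
    by (rule set_mp[OF kaehler_relators_mem], unfold kaehler_relators_def Let_def, rule UnI2)
      (use a in blast)
  then show ?thesis unfolding kaehler_module_def kaehler_d_def using a k
    by (simp add: coset_eq_submodule_iff[OF kaehler_relations_submodule] R.free_gen_closed subsetD
       quotient_module_zero[OF kaehler_relations_submodule])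
qed

end

text \<open>Stands for the quotient of a module of polynomial-valued functions by \<open>N\<close>.
  The quotient is not formed; maps into it are maps to functions that are well behaved up to
  \<open>eqv\<close>.\<close>

locale pmodule =
  fixes n :: nat and N :: "('y \<Rightarrow> 'k::field_char_0 mpoly) set"
  assumes zero: "(\<lambda>_. 0) \<in> N"
    and add: "w \<in> N \<Longrightarrow> w' \<in> N \<Longrightarrow> w + w' \<in> N"
    and scale: "p \<in> pcarrier n \<Longrightarrow> w \<in> N \<Longrightarrow> (\<lambda>y. p * w y) \<in> N"
begin

definition eqv :: "('y \<Rightarrow> 'k mpoly) \<Rightarrow> ('y \<Rightarrow> 'k mpoly) \<Rightarrow> bool" where
  "eqv w w' \<longleftrightarrow> w - w' \<in> N"

lemma minus: "w \<in> N \<Longrightarrow> - w \<in> N"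
proof -
  assume "w \<in> N"
  moreover have "(- 1 :: 'k mpoly) \<in> pcarrier n" by (intro pcarrier_minus pcarrier_1)
  ultimately have "(\<lambda>y. - 1 * w y) \<in> N" using scale by blast
  moreover have "(\<lambda>y. - 1 * w y) = - w" by auto
  ultimately show ?thesis by simp
qed

lemma eqv_refl [simp, intro]: "eqv w w"
proof -
  have "w - w = (\<lambda>_. 0)" by auto
  with zero show ?thesis by (simp only: eqv_def)
qed

lemma eqv_sym: "eqv w w' \<Longrightarrow> eqv w' w"
  using minus[of "w - w'"] by (simp add: eqv_def)

lemma eqv_trans [trans]: "eqv w w' \<Longrightarrow> eqv w' w'' \<Longrightarrow> eqv w w''"
  using add[of "w - w'" "w' - w''"] by (simp add: eqv_def)

lemma eqv_add: "eqv w w' \<Longrightarrow> eqv v v' \<Longrightarrow> eqv (w + v) (w' + v')"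
  using add[of "w - w'" "v - v'"] by (simp add: eqv_def algebra_simps)

lemma eqv_minus: "eqv w w' \<Longrightarrow> eqv (- w) (- w')"
  using minus[of "w - w'"] by (simp add: eqv_def)

lemma eqv_diff: "eqv w w' \<Longrightarrow> eqv v v' \<Longrightarrow> eqv (w - v) (w' - v')"
  using eqv_add[OF _ eqv_minus, of w w' v v'] by simp

lemma eqv_scale: "p \<in> pcarrier n \<Longrightarrow> eqv w w' \<Longrightarrow> eqv (\<lambda>y. p * w y) (\<lambda>y. p * w' y)"
  using scale[of p "w - w'"] by (simp add: eqv_def fun_diff_def algebra_simps)

lemma eqv_mem: "eqv w w' \<Longrightarrow> w' \<in> N \<Longrightarrow> w \<in> N"
  using add[of "w - w'" w'] by (simp add: eqv_def)

lemma eqv_diff_mem: "eqv w (a - b) \<Longrightarrow> eqv a b \<Longrightarrow> w \<in> N"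
  using eqv_mem by (simp only: eqv_def[of a b])

lemma sum_mem: "(\<And>x. x \<in> A \<Longrightarrow> f x \<in> N) \<Longrightarrow> (\<lambda>y. \<Sum>x\<in>A. f x y) \<in> N"
proof (induction A rule: infinite_finite_induct)
  case (insert x A)
  then have "f x + (\<lambda>y. \<Sum>x\<in>A. f x y) \<in> N" by (intro add) auto
  with insert show ?case by (simp add: plus_fun_def)
qed (auto simp: zero)

end

text \<open>The presentation of \<Omega> and its exterior powers is worked out for an ideal of the
  polynomial ring; the grading and the coordinate \<open>x_0\<close> enter with
  \<open>coord_scheme\<close>.\<close>

locale coord_ideal =
  fixes n :: nat and I :: "'k::field_char_0 mpoly set"
  assumes ideal: "ideal I (poly_ring n)"
begin

abbreviation "R \<equiv> coord_ring n I"
abbreviation "k \<equiv> coord_base n I"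
abbreviation "pr f \<equiv> I +>\<^bsub>poly_ring n\<^esub> f"
abbreviation "\<Omega> \<equiv> kaehler_module R k"

sublocale P: cring "poly_ring n :: 'k mpoly ring" by (rule cring_poly_ring)
sublocale I: ideal I "poly_ring n" by (rule ideal)

lemma I_pcarrier: "g \<in> I \<Longrightarrow> g \<in> pcarrier n" using I.a_subset by blast
lemma I_0: "0 \<in> I" using I.zero_closed by simp
lemma I_add: "g \<in> I \<Longrightarrow> h \<in> I \<Longrightarrow> g + h \<in> I" using I.a_closed[of g h] by simp
lemma I_mult: "p \<in> pcarrier n \<Longrightarrow> g \<in> I \<Longrightarrow> p * g \<in> I" using I.I_l_closed[of g p] by simp
lemma I_minus: "g \<in> I \<Longrightarrow> - g \<in> I"
proof -
  assume "g \<in> I"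
  moreover have "(- 1 :: 'k mpoly) \<in> pcarrier n" by (intro pcarrier_minus pcarrier_1)
  ultimately show ?thesis using I_mult[of "- 1" g] by simp
qed
lemma I_diff: "g \<in> I \<Longrightarrow> h \<in> I \<Longrightarrow> g - h \<in> I" using I_add[OF _ I_minus, of g h] by simp
lemma I_sum: "(\<And>x. x \<in> A \<Longrightarrow> f x \<in> I) \<Longrightarrow> (\<Sum>x\<in>A. f x) \<in> I"
  by (induction A rule: infinite_finite_induct) (auto intro: I_0 I_add)

lemma cring_R: "cring R"
  unfolding coord_ring_def by (rule I.quotient_is_cring[OF cring_poly_ring])

sublocale R: cring R by (rule cring_R)

lemma carrier_R: "carrier R = (\<lambda>f. pr f) ` pcarrier n"
  by (auto simp: coord_ring_def FactRing_def A_RCOSETS_def' a_r_coset_def')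

lemma pr_closed [simp, intro]: "f \<in> pcarrier n \<Longrightarrow> pr f \<in> carrier R"
  by (auto simp: carrier_R)

lemma pr_add: "f \<in> pcarrier n \<Longrightarrow> g \<in> pcarrier n \<Longrightarrow> pr f \<oplus>\<^bsub>R\<^esub> pr g = pr (f + g)"
  using I.a_rcos_sum[of f g] by (simp add: coord_ring_def FactRing_def)

lemma pr_mult: "f \<in> pcarrier n \<Longrightarrow> g \<in> pcarrier n \<Longrightarrow> pr f \<otimes>\<^bsub>R\<^esub> pr g = pr (f * g)"
  using I.rcoset_mult_add[of f g] by (simp add: coord_ring_def FactRing_def)

lemma R_one: "\<one>\<^bsub>R\<^esub> = pr 1"
  by (simp add: coord_ring_def FactRing_def)

lemma R_zero: "\<zero>\<^bsub>R\<^esub> = pr 0"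
  using I.a_rcos_const[OF I_0] by (simp add: coord_ring_def FactRing_def)

lemma pr_eq_iff:
  assumes "f \<in> pcarrier n" "g \<in> pcarrier n"
  shows "pr f = pr g \<longleftrightarrow> f - g \<in> I"
proof -
  have "pr f = pr g \<longleftrightarrow> f \<in> pr g"
    using I.a_rcos_self[of f] I.a_repr_independence'[of f g] assms by metis
  also have "\<dots> \<longleftrightarrow> f - g \<in> I"
    using I.a_rcos_module[of g f] assms by (simp add: poly_ring_a_inv)
  finally show ?thesis .
qed

lemma pr_zero_iff: "f \<in> pcarrier n \<Longrightarrow> pr f = \<zero>\<^bsub>R\<^esub> \<longleftrightarrow> f \<in> I"
  by (simp add: R_zero pr_eq_iff)

lemma pr_minus: "f \<in> pcarrier n \<Longrightarrow> \<ominus>\<^bsub>R\<^esub> pr f = pr (- f)"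
  by (rule R.minus_equality) (simp_all add: pr_add R_zero pcarrier_minus)

lemma k_closed: "k \<subseteq> carrier R"
  by (auto simp: coord_base_def)

text \<open>The representative of zero must be zero for \<open>lin\<close> below to ignore the points outside a finite
  support.\<close>

definition rep :: "'k mpoly set \<Rightarrow> 'k mpoly" where
  "rep r = (if r = \<zero>\<^bsub>R\<^esub> then 0 else SOME f. f \<in> pcarrier n \<and> pr f = r)"

lemma rep_zero [simp]: "rep \<zero>\<^bsub>R\<^esub> = 0"
  by (simp add: rep_def)

lemma rep: assumes "r \<in> carrier R" shows rep_closed: "rep r \<in> pcarrier n" and pr_rep: "pr (rep r) = r"
proof -
  have "\<exists>f. f \<in> pcarrier n \<and> pr f = r" using assms by (auto simp: carrier_R)
  from someI_ex[OF this] show "rep r \<in> pcarrier n" "pr (rep r) = r"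
    by (auto simp: rep_def R_zero)
qed

lemma rep_pr: "f \<in> pcarrier n \<Longrightarrow> rep (pr f) - f \<in> I"
  using rep[of "pr f"] by (simp flip: pr_eq_iff)

text \<open>\<open>rep\<close> is a mere set-theoretic section of the projection, so it respects the
  ring operations only modulo \<open>I\<close>.\<close>

lemma rep_add:
  assumes "a \<in> carrier R" "b \<in> carrier R" shows "rep (a \<oplus>\<^bsub>R\<^esub> b) - (rep a + rep b) \<in> I"
proof -
  note ab = rep_closed[OF assms(1)] rep_closed[OF assms(2)]
  have "a \<oplus>\<^bsub>R\<^esub> b = pr (rep a + rep b)" using pr_add[OF ab] pr_rep assms by simp
  then show ?thesis using rep_pr[OF pcarrier_add[OF ab]] by simp
qed

lemma rep_mult:
  assumes "a \<in> carrier R" "b \<in> carrier R" shows "rep (a \<otimes>\<^bsub>R\<^esub> b) - rep a * rep b \<in> I"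
proof -
  note ab = rep_closed[OF assms(1)] rep_closed[OF assms(2)]
  have "a \<otimes>\<^bsub>R\<^esub> b = pr (rep a * rep b)" using pr_mult[OF ab] pr_rep assms by simp
  then show ?thesis using rep_pr[OF pcarrier_mult[OF ab]] by simp
qed

text \<open>The linear extension of \<open>\<phi>\<close> to formal sums, with the coefficients
  lifted from R to polynomials. It is linear only up to multiples of elements of
  \<open>I\<close>.\<close>

definition lin :: "('x \<Rightarrow> 'y \<Rightarrow> 'k mpoly) \<Rightarrow> ('x \<Rightarrow> 'k mpoly set) \<Rightarrow> 'y \<Rightarrow> 'k mpoly" where
  "lin \<phi> c y = (\<Sum>x\<in>{x. c x \<noteq> \<zero>\<^bsub>R\<^esub>}. rep (c x) * \<phi> x y)"

lemma lin_superset: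
  assumes "finite X" "{x. c x \<noteq> \<zero>\<^bsub>R\<^esub>} \<subseteq> X"
  shows "lin \<phi> c = (\<lambda>y. \<Sum>x\<in>X. rep (c x) * \<phi> x y)"
  unfolding lin_def using assms by (intro ext sum.mono_neutral_left) auto

end

text \<open>Assumption \<open>N_I\<close> makes the choice of representatives invisible: changing a
  coefficient by an element of \<open>I\<close> changes \<open>lin\<close> by an element of
  \<open>N\<close>.\<close>

locale free_lift = coord_ideal n I + pmodule n N
  for n :: nat and I :: "'k::field_char_0 mpoly set" and N :: "('y \<Rightarrow> 'k mpoly) set" +
  fixes X :: "'x set" and \<phi> :: "'x \<Rightarrow> 'y \<Rightarrow> 'k mpoly" and S :: "('x \<Rightarrow> 'k mpoly set) set"
  assumes N_I: "\<And>x g. x \<in> X \<Longrightarrow> g \<in> I \<Longrightarrow> (\<lambda>y. g * \<phi> x y) \<in> N"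
begin

abbreviation "F \<equiv> free_module R X"
sublocale F: module R F by (rule R.module_free_module)

lemma lin_add:
  assumes "c \<in> carrier F" "c' \<in> carrier F"
  shows "eqv (lin \<phi> (c \<oplus>\<^bsub>F\<^esub> c')) (lin \<phi> c + lin \<phi> c')"
proof -
  let ?X = "{x. c x \<noteq> \<zero>\<^bsub>R\<^esub>} \<union> {x. c' x \<noteq> \<zero>\<^bsub>R\<^esub>}"
  have fin: "finite ?X" and X: "?X \<subseteq> X" using assms by (auto simp: free_module_simps)
  have c: "c x \<in> carrier R" "c' x \<in> carrier R" for x
    by (rule R.free_module_carrier_closed[OF assms(1)], rule R.free_module_carrier_closed[OF assms(2)])
  have "lin \<phi> (c \<oplus>\<^bsub>F\<^esub> c') - (lin \<phi> c + lin \<phi> c') =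
      (\<lambda>y. \<Sum>x\<in>?X. (rep (c x \<oplus>\<^bsub>R\<^esub> c' x) - (rep (c x) + rep (c' x))) * \<phi> x y)"
  proof -
    have 1: "lin \<phi> (c \<oplus>\<^bsub>F\<^esub> c') = (\<lambda>y. \<Sum>x\<in>?X. rep (c x \<oplus>\<^bsub>R\<^esub> c' x) * \<phi> x y)"
      by (subst lin_superset[OF fin]) (auto simp: free_module_simps)
    have 2: "lin \<phi> c = (\<lambda>y. \<Sum>x\<in>?X. rep (c x) * \<phi> x y)"
      "lin \<phi> c' = (\<lambda>y. \<Sum>x\<in>?X. rep (c' x) * \<phi> x y)"
      by (rule lin_superset[OF fin]; blast)+
    show ?thesis unfolding 1 2
      by (simp add: fun_diff_def plus_fun_def left_diff_distrib distrib_right sum.distrib sum_subtractf)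
  qed
  also have "\<dots> \<in> N"
    by (intro sum_mem N_I rep_add c) (use X in auto)
  finally show ?thesis by (simp add: eqv_def)
qed

lemma lin_smult:
  assumes "c \<in> carrier F" "a \<in> carrier R"
  shows "eqv (lin \<phi> (a \<odot>\<^bsub>F\<^esub> c)) (\<lambda>y. rep a * lin \<phi> c y)"
proof -
  let ?X = "{x. c x \<noteq> \<zero>\<^bsub>R\<^esub>}"
  have fin: "finite ?X" and X: "?X \<subseteq> X" using assms by (auto simp: free_module_simps)
  have c: "c x \<in> carrier R" for x by (rule R.free_module_carrier_closed[OF assms(1)])
  have "lin \<phi> (a \<odot>\<^bsub>F\<^esub> c) - (\<lambda>y. rep a * lin \<phi> c y) =
      (\<lambda>y. \<Sum>x\<in>?X. (rep (a \<otimes>\<^bsub>R\<^esub> c x) - rep a * rep (c x)) * \<phi> x y)"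
  proof -
    have 1: "lin \<phi> (a \<odot>\<^bsub>F\<^esub> c) = (\<lambda>y. \<Sum>x\<in>?X. rep (a \<otimes>\<^bsub>R\<^esub> c x) * \<phi> x y)"
    proof -
      have "(a \<odot>\<^bsub>F\<^esub> c) x = \<zero>\<^bsub>R\<^esub>" if "c x = \<zero>\<^bsub>R\<^esub>" for x
        using that R.r_null[OF assms(2)] by (simp only: free_module_simps(4))
      then have "{x. (a \<odot>\<^bsub>F\<^esub> c) x \<noteq> \<zero>\<^bsub>R\<^esub>} \<subseteq> ?X" by blast
      from lin_superset[OF fin this] show ?thesis by (simp only: free_module_simps(4))
    qed
    show ?thesis unfolding 1 lin_def
      by (simp add: fun_diff_def left_diff_distrib sum_subtractf sum_distrib_left mult.assoc)
  qed
  also have "\<dots> \<in> N"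
    by (intro sum_mem N_I rep_mult c assms) (use X in auto)
  finally show ?thesis by (simp add: eqv_def)
qed

lemma lin_gen: assumes "x \<in> X" shows "eqv (lin \<phi> (free_gen R x)) (\<phi> x)"
proof -
  have "lin \<phi> (free_gen R x) = (\<lambda>y. rep (pr 1) * \<phi> x y)"
    by (subst lin_superset[of "{x}"]) (auto simp: free_gen_def R_one)
  then have "lin \<phi> (free_gen R x) - \<phi> x = (\<lambda>y. (rep (pr 1) - 1) * \<phi> x y)"
    by (auto simp: fun_eq_iff algebra_simps)
  also have "\<dots> \<in> N" by (intro N_I rep_pr assms) auto
  finally show ?thesis by (simp add: eqv_def)
qed

lemma lin_minus: assumes "c \<in> carrier F" "c' \<in> carrier F"
  shows "eqv (lin \<phi> (c \<ominus>\<^bsub>F\<^esub> c')) (lin \<phi> c - lin \<phi> c')"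
proof -
  have "c = (c \<ominus>\<^bsub>F\<^esub> c') \<oplus>\<^bsub>F\<^esub> c'"
    using assms by (simp add: a_minus_def F.M.a_assoc F.M.l_neg)
  then have "eqv (lin \<phi> c) (lin \<phi> (c \<ominus>\<^bsub>F\<^esub> c') + lin \<phi> c')"
    using lin_add[of "c \<ominus>\<^bsub>F\<^esub> c'" c'] assms by simp
  from eqv_diff[OF this eqv_refl[of "lin \<phi> c'"]] show ?thesis
    by (simp add: eqv_sym)
qed

lemma lin_zero: "lin \<phi> \<zero>\<^bsub>F\<^esub> = (\<lambda>_. 0)"
  by (auto simp: lin_def free_module_simps)

lemma lin_span:
  assumes S: "S \<subseteq> carrier F" "\<And>s. s \<in> S \<Longrightarrow> lin \<phi> s \<in> N"
    and c: "c \<in> LinearCombinations.module.span R F S"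
  shows "lin \<phi> c \<in> N"
  using S(1) c
proof (rule F.span_induct)
  show "lin \<phi> \<zero>\<^bsub>F\<^esub> \<in> N" using zero by (simp add: lin_zero)
  show "lin \<phi> (x \<oplus>\<^bsub>F\<^esub> y) \<in> N" if "x \<in> carrier F" "y \<in> carrier F" "lin \<phi> x \<in> N" "lin \<phi> y \<in> N" for x y
    by (rule eqv_mem[OF lin_add[OF that(1,2)] add[OF that(3,4)]])
  show "lin \<phi> (a \<odot>\<^bsub>F\<^esub> x) \<in> N" if "a \<in> carrier R" "x \<in> carrier F" "lin \<phi> x \<in> N" for a x
    by (rule eqv_mem[OF lin_smult[OF that(2,1)] scale[OF rep_closed[OF that(1)] that(3)]])
qed (rule S(2))

end

text \<open>The universal property of a module given by generators \<open>X\<close> and relators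
  \<open>S\<close>. It is instantiated twice, for \<Omega> and for its exterior powers.\<close>

locale quotient_lift = free_lift n I N X \<phi> S
  for n :: nat and I :: "'k::field_char_0 mpoly set" and N :: "('y \<Rightarrow> 'k mpoly) set"
    and X :: "'x set" and \<phi> :: "'x \<Rightarrow> 'y \<Rightarrow> 'k mpoly" and S :: "('x \<Rightarrow> 'k mpoly set) set" +
  assumes S: "S \<subseteq> carrier F" "\<And>s. s \<in> S \<Longrightarrow> lin \<phi> s \<in> N"
begin

abbreviation "rel \<equiv> LinearCombinations.module.span R F S"
abbreviation "Q \<equiv> quotient_module F rel"

lemma rel_submodule: "LinearCombinations.submodule R rel F"
  by (rule F.span_is_submodule[OF S(1)])

definition lift :: "('x \<Rightarrow> 'k mpoly set) set \<Rightarrow> 'y \<Rightarrow> 'k mpoly" where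
  "lift C = lin \<phi> (SOME c. c \<in> carrier F \<and> rel +>\<^bsub>F\<^esub> c = C)"

lemma lift_lin: assumes "C \<in> carrier Q" shows "\<exists>c\<in>carrier F. lift C = lin \<phi> c"
proof -
  have "\<exists>c. c \<in> carrier F \<and> rel +>\<^bsub>F\<^esub> c = C"
    using assms quotient_module_carrier[OF rel_submodule] by auto
  from someI_ex[OF this] show ?thesis unfolding lift_def by blast
qed

text \<open>The representative chosen in \<open>lift\<close> and \<open>c\<close> differ by a
  relation, and \<open>lin\<close> sends relations into \<open>N\<close>.\<close>

lemma lift_coset: assumes "c \<in> carrier F" shows "eqv (lift (rel +>\<^bsub>F\<^esub> c)) (lin \<phi> c)"
proof -
  define c' where "c' = (SOME c'. c' \<in> carrier F \<and> rel +>\<^bsub>F\<^esub> c' = rel +>\<^bsub>F\<^esub> c)"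
  have "c' \<in> carrier F \<and> rel +>\<^bsub>F\<^esub> c' = rel +>\<^bsub>F\<^esub> c"
    unfolding c'_def by (rule someI[of _ c]) (use assms in auto)
  then have c': "c' \<in> carrier F" "c' \<ominus>\<^bsub>F\<^esub> c \<in> rel"
    using coset_eq_iff[OF rel_submodule] assms by auto
  have "lin \<phi> (c' \<ominus>\<^bsub>F\<^esub> c) \<in> N" by (rule lin_span[OF S c'(2)])
  then have "lin \<phi> c' - lin \<phi> c \<in> N"
    by (rule eqv_mem[OF eqv_sym[OF lin_minus[OF c'(1) assms]]])
  then show ?thesis by (simp only: eqv_def lift_def c'_def)
qed

lemma lift_add:
  assumes "v \<in> carrier Q" "w \<in> carrier Q"
  shows "eqv (lift (v \<oplus>\<^bsub>Q\<^esub> w)) (lift v + lift w)"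
proof -
  obtain c c' where c: "c \<in> carrier F" "c' \<in> carrier F" "v = rel +>\<^bsub>F\<^esub> c" "w = rel +>\<^bsub>F\<^esub> c'"
    using assms quotient_module_carrier[OF rel_submodule] by auto
  have "eqv (lift (v \<oplus>\<^bsub>Q\<^esub> w)) (lin \<phi> (c \<oplus>\<^bsub>F\<^esub> c'))"
    using c lift_coset by (simp add: quotient_module_add[OF rel_submodule])
  also have "eqv \<dots> (lin \<phi> c + lin \<phi> c')" by (rule lin_add[OF c(1,2)])
  also have "eqv \<dots> (lift v + lift w)"
    unfolding c(3,4) by (intro eqv_add eqv_sym[OF lift_coset] c)
  finally show ?thesis .
qed

lemma lift_smult:
  assumes "a \<in> carrier R" "v \<in> carrier Q"
  shows "eqv (lift (a \<odot>\<^bsub>Q\<^esub> v)) (\<lambda>y. rep a * lift v y)"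
proof -
  obtain c where c: "c \<in> carrier F" "v = rel +>\<^bsub>F\<^esub> c"
    using assms quotient_module_carrier[OF rel_submodule] by auto
  have "eqv (lift (a \<odot>\<^bsub>Q\<^esub> v)) (lin \<phi> (a \<odot>\<^bsub>F\<^esub> c))"
    using c assms lift_coset by (simp add: quotient_module_smult[OF rel_submodule])
  also have "eqv \<dots> (\<lambda>y. rep a * lin \<phi> c y)" by (rule lin_smult[OF c(1) assms(1)])
  also have "eqv \<dots> (\<lambda>y. rep a * lift v y)"
    unfolding c(2) by (intro eqv_scale eqv_sym[OF lift_coset] rep_closed assms c)
  finally show ?thesis .
qed

lemma lift_gen: "x \<in> X \<Longrightarrow> eqv (lift (rel +>\<^bsub>F\<^esub> free_gen R x)) (\<phi> x)"
  by (rule eqv_trans[OF lift_coset lin_gen]) (auto intro: R.free_gen_closed)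

lemma lift_zero: "lift \<zero>\<^bsub>Q\<^esub> \<in> N"
proof -
  have "eqv (lift (rel +>\<^bsub>F\<^esub> \<zero>\<^bsub>F\<^esub>)) (lin \<phi> \<zero>\<^bsub>F\<^esub>)" by (rule lift_coset) simp
  then have "lift (rel +>\<^bsub>F\<^esub> \<zero>\<^bsub>F\<^esub>) \<in> N" by (rule eqv_mem) (use zero in \<open>simp only: lin_zero\<close>)
  then show ?thesis
    by (simp only: coset_zero[OF rel_submodule] quotient_module_zero[OF rel_submodule])
qed

end

lemma exterior_relators_cases:
  assumes "s \<in> exterior_relators R M m"
  obtains
    (add) ws i v w where "ws \<in> tuples M m" "i < m" "v \<in> carrier M" "w \<in> carrier M"
      "s = free_gen R (ws[i := v \<oplus>\<^bsub>M\<^esub> w]) \<ominus>\<^bsub>free_module R (tuples M m)\<^esub>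
         (free_gen R (ws[i := v]) \<oplus>\<^bsub>free_module R (tuples M m)\<^esub> free_gen R (ws[i := w]))"
  | (smult) ws i a v where "ws \<in> tuples M m" "i < m" "a \<in> carrier R" "v \<in> carrier M"
      "s = free_gen R (ws[i := a \<odot>\<^bsub>M\<^esub> v]) \<ominus>\<^bsub>free_module R (tuples M m)\<^esub>
         a \<odot>\<^bsub>free_module R (tuples M m)\<^esub> free_gen R (ws[i := v])"
  | (repeat) ws i j where "ws \<in> tuples M m" "i < j" "j < m" "ws ! i = ws ! j" "s = free_gen R ws"
  using assms unfolding exterior_relators_def Let_def
  by (elim UnE CollectE exE conjE) (erule (4) add smult repeat)+

section \<open>From differential forms to coefficient functions: the maps \<open>theta\<close>,
  \<open>phi\<close> and \<open>Phi\<close>\<close>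

context coord_ideal
begin

definition grad :: "'k mpoly \<Rightarrow> nat \<Rightarrow> 'k mpoly" where
  "grad f = (\<lambda>j. pd j f)"

definition vecs :: "(nat \<Rightarrow> 'k mpoly) set" where
  "vecs = {v. \<forall>j. v j \<in> pcarrier n \<and> (n < j \<longrightarrow> v j = 0)}"

text \<open>The Jacobian relations: the submodule generated by vectors over \<open>I\<close> and by
  gradients of elements of \<open>I\<close>. Modulo it the vectors in \<open>vecs\<close> present
  \<Omega>, with the unit vectors as the differentials of the variables.\<close>

inductive_set jac :: "(nat \<Rightarrow> 'k mpoly) set" where
  zero: "(\<lambda>_. 0) \<in> jac"
| add: "v \<in> jac \<Longrightarrow> w \<in> jac \<Longrightarrow> v + w \<in> jac"
| ideal: "v \<in> vecs \<Longrightarrow> (\<And>j. v j \<in> I) \<Longrightarrow> v \<in> jac"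
| grad: "h \<in> pcarrier n \<Longrightarrow> f \<in> I \<Longrightarrow> (\<lambda>j. h * grad f j) \<in> jac"

lemma grad_add: "grad (f + g) = grad f + grad g"
  by (auto simp: grad_def)

lemma grad_diff: "grad (f - g) = grad f - grad g"
  by (auto simp: grad_def)

lemma grad_vecs: "f \<in> pcarrier n \<Longrightarrow> grad f \<in> vecs"
  by (auto simp: vecs_def grad_def pd_outside intro: pcarrier_pd)

lemma unit_vec_vecs: "j \<le> n \<Longrightarrow> unit_vec j \<in> vecs"
  by (auto simp: vecs_def unit_vec_def)

lemma grad_var: "grad (var j) = unit_vec j"
  by (auto simp: grad_def unit_vec_def pd_var)

lemma grad_jac: "f \<in> I \<Longrightarrow> grad f \<in> jac"
  using jac.grad[of 1 f] by simp

lemma vecs_zero: "(\<lambda>_. 0) \<in> vecs" by (auto simp: vecs_def)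
lemma vecs_add: "v \<in> vecs \<Longrightarrow> w \<in> vecs \<Longrightarrow> v + w \<in> vecs" by (auto simp: vecs_def)
lemma vecs_scale: "p \<in> pcarrier n \<Longrightarrow> v \<in> vecs \<Longrightarrow> (\<lambda>j. p * v j) \<in> vecs" by (auto simp: vecs_def)
lemma vecs_sum: "(\<And>x. x \<in> A \<Longrightarrow> f x \<in> vecs) \<Longrightarrow> (\<lambda>j. \<Sum>x\<in>A. f x j) \<in> vecs"
  by (auto simp: vecs_def intro!: sum.neutral)

lemma jac_scale: "v \<in> jac \<Longrightarrow> p \<in> pcarrier n \<Longrightarrow> (\<lambda>j. p * v j) \<in> jac"
proof (induction rule: jac.induct)
  case (add v w)
  then have "(\<lambda>j. p * v j) + (\<lambda>j. p * w j) \<in> jac" by (intro jac.add) auto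
  then show ?case by (simp add: plus_fun_def distrib_left)
next
  case (grad h f)
  then have "(\<lambda>j. (p * h) * grad f j) \<in> jac" by (intro jac.grad) auto
  then show ?case by (simp add: mult.assoc)
qed (auto intro: jac.zero jac.ideal vecs_scale I_mult)

lemma pmodule_jac: "pmodule n jac"
  by unfold_locales (auto intro: jac.zero jac.add jac_scale)

interpretation J: pmodule n jac by (rule pmodule_jac)

lemma I_mult_right: "g \<in> I \<Longrightarrow> p \<in> pcarrier n \<Longrightarrow> g * p \<in> I"
  using I_mult[of p g] by (simp only: mult.commute)

lemma vecs_pcarrier: "v \<in> vecs \<Longrightarrow> v j \<in> pcarrier n" by (simp add: vecs_def)

lemma jac_ideal_scale:
  assumes "g \<in> I" "v \<in> vecs" shows "(\<lambda>j. g * v j) \<in> jac"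
  by (intro jac.ideal vecs_scale I_pcarrier I_mult_right vecs_pcarrier assms)

interpretation JL: free_lift n I jac "carrier R" "\<lambda>r. grad (rep r)" "kaehler_relators R k"
  by unfold_locales (intro jac_ideal_scale grad_vecs rep_closed)

abbreviation d\<^sub>R where "d\<^sub>R \<equiv> kaehler_d R k"

lemma jac_grad: "f - g \<in> I \<Longrightarrow> J.eqv (grad f) (grad g)"
  using grad_jac[of "f - g"] by (simp add: J.eqv_def grad_diff)

text \<open>\<open>rep\<close> is additive and multiplicative modulo \<open>I\<close>, and gradients
  of elements of \<open>I\<close> lie in \<open>jac\<close>; the rest is the Leibniz rule for
  \<open>pd\<close> and the vanishing of derivatives of constants.\<close>

lemma kaehler_relators_lin:
  assumes "s \<in> kaehler_relators R k" shows "lin (\<lambda>r. grad (rep r)) s \<in> jac"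
proof -
  let ?F = "free_module R (carrier R)" and ?L = "lin (\<lambda>r. grad (rep r))"
  note e = R.free_gen_closed[of _ "carrier R"]
  from assms consider
    a b where "a \<in> carrier R" "b \<in> carrier R"
      "s = free_gen R (a \<oplus>\<^bsub>R\<^esub> b) \<ominus>\<^bsub>?F\<^esub> (free_gen R a \<oplus>\<^bsub>?F\<^esub> free_gen R b)"
  | a b where "a \<in> carrier R" "b \<in> carrier R"
      "s = free_gen R (a \<otimes>\<^bsub>R\<^esub> b) \<ominus>\<^bsub>?F\<^esub> (a \<odot>\<^bsub>?F\<^esub> free_gen R b \<oplus>\<^bsub>?F\<^esub> b \<odot>\<^bsub>?F\<^esub> free_gen R a)"
  | c where "s = free_gen R c" "c \<in> k"
    unfolding kaehler_relators_def Let_def by blast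
  then show ?thesis
  proof cases
    case (1 a b)
    have "J.eqv (?L s) (?L (free_gen R (a \<oplus>\<^bsub>R\<^esub> b)) - ?L (free_gen R a \<oplus>\<^bsub>?F\<^esub> free_gen R b))"
      unfolding 1(3) by (rule JL.lin_minus) (use 1 in \<open>auto intro: e\<close>)
    also have "J.eqv \<dots> (grad (rep (a \<oplus>\<^bsub>R\<^esub> b)) - (grad (rep a) + grad (rep b)))"
      using 1 by (intro J.eqv_diff JL.lin_gen J.eqv_trans[OF JL.lin_add] J.eqv_add) (auto intro: e)
    finally show ?thesis
      using jac_grad[OF rep_add[OF 1(1,2)]] unfolding grad_add by (rule J.eqv_diff_mem)
  next
    case (2 a b)
    have "J.eqv (?L s) (?L (free_gen R (a \<otimes>\<^bsub>R\<^esub> b)) -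
        ?L (a \<odot>\<^bsub>?F\<^esub> free_gen R b \<oplus>\<^bsub>?F\<^esub> b \<odot>\<^bsub>?F\<^esub> free_gen R a))"
      unfolding 2(3) by (rule JL.lin_minus) (use 2 in \<open>auto intro: e\<close>)
    also have "J.eqv \<dots> (grad (rep (a \<otimes>\<^bsub>R\<^esub> b)) -
        ((\<lambda>y. rep a * grad (rep b) y) + (\<lambda>y. rep b * grad (rep a) y)))"
      using 2 by (intro J.eqv_diff JL.lin_gen J.eqv_trans[OF JL.lin_add] J.eqv_add
          J.eqv_trans[OF JL.lin_smult] J.eqv_scale rep_closed) (auto intro: e)
    also have "(\<lambda>y. rep a * grad (rep b) y) + (\<lambda>y. rep b * grad (rep a) y) = grad (rep a * rep b)"
      by (auto simp: grad_def pd_mult)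
    finally show ?thesis
      using jac_grad[OF rep_mult[OF 2(1,2)]] by (rule J.eqv_diff_mem)
  next
    case (3 c)
    then obtain c0 where c0: "c = pr (const c0)" by (auto simp: coord_base_def)
    have "J.eqv (?L s) (grad (rep c))"
      unfolding 3(1) by (rule JL.lin_gen) (use 3 k_closed in auto)
    also have "J.eqv \<dots> (grad (const c0))" unfolding c0 by (intro jac_grad rep_pr) auto
    also have "grad (const c0) = (\<lambda>_. 0)" by (auto simp: grad_def)
    finally show ?thesis using J.eqv_mem jac.zero by blast
  qed
qed

interpretation JQ: quotient_lift n I jac "carrier R" "\<lambda>r. grad (rep r)" "kaehler_relators R k"
  by unfold_locales (rule kaehler_relators_closed[OF cring_R k_closed], rule kaehler_relators_lin)

lemma Omega_eq: "\<Omega> = quotient_module (free_module R (carrier R))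
    (LinearCombinations.module.span R (free_module R (carrier R)) (kaehler_relators R k))"
  by (simp only: kaehler_module_def kaehler_relations_eq_span)

text \<open>Induced by sending \<open>d r\<close> to the gradient of a polynomial representing
  \<open>r\<close>; its values matter only modulo \<open>jac\<close>.\<close>

definition theta :: "('k mpoly set \<Rightarrow> 'k mpoly set) set \<Rightarrow> nat \<Rightarrow> 'k mpoly" where
  "theta = JQ.lift"

lemma theta_vecs: assumes "v \<in> carrier \<Omega>" shows "theta v \<in> vecs"
proof -
  obtain c where c: "c \<in> carrier (free_module R (carrier R))" "theta v = lin (\<lambda>r. grad (rep r)) c"
    using JQ.lift_lin assms unfolding Omega_eq theta_def by blast
  have "c x \<in> carrier R" for x by (rule R.free_module_carrier_closed[OF c(1)])
  moreover have "x \<in> carrier R" if "c x \<noteq> \<zero>\<^bsub>R\<^esub>" for x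
    using c(1) that by (auto simp: free_module_simps)
  ultimately have "(\<lambda>y. \<Sum>x\<in>{x. c x \<noteq> \<zero>\<^bsub>R\<^esub>}. rep (c x) * grad (rep x) y) \<in> vecs"
    by (intro vecs_sum vecs_scale grad_vecs rep_closed) auto
  then show ?thesis unfolding c(2) lin_def[abs_def] .
qed

lemma theta_add: "v \<in> carrier \<Omega> \<Longrightarrow> w \<in> carrier \<Omega> \<Longrightarrow>
    theta (v \<oplus>\<^bsub>\<Omega>\<^esub> w) - (theta v + theta w) \<in> jac"
  using JQ.lift_add unfolding Omega_eq theta_def J.eqv_def by blast

lemma theta_smult: "a \<in> carrier R \<Longrightarrow> v \<in> carrier \<Omega> \<Longrightarrow>
    theta (a \<odot>\<^bsub>\<Omega>\<^esub> v) - (\<lambda>j. rep a * theta v j) \<in> jac"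
  using JQ.lift_smult unfolding Omega_eq theta_def J.eqv_def by blast

lemma theta_d: assumes "f \<in> pcarrier n" shows "theta (d\<^sub>R (pr f)) - grad f \<in> jac"
proof -
  have "J.eqv (theta (d\<^sub>R (pr f))) (grad (rep (pr f)))"
    using JQ.lift_gen[of "pr f"] assms unfolding theta_def kaehler_d_def kaehler_relations_eq_span by blast
  also have "J.eqv \<dots> (grad f)" by (rule jac_grad[OF rep_pr[OF assms]])
  finally show ?thesis by (simp add: J.eqv_def)
qed

definition lam :: "nat \<Rightarrow> (nat set \<Rightarrow> 'k mpoly) set" where
  "lam m = {w. \<forall>J. w J \<in> pcarrier n \<and> (w J \<noteq> 0 \<longrightarrow> J \<subseteq> {..n} \<and> card J = m)}"

lemma lam_zero: "(\<lambda>_. 0) \<in> lam m" by (auto simp: lam_def)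
lemma lam_add: "v \<in> lam m \<Longrightarrow> w \<in> lam m \<Longrightarrow> v + w \<in> lam m"
proof -
  assume vw: "v \<in> lam m" "w \<in> lam m"
  have "(v + w) J \<noteq> 0 \<Longrightarrow> v J \<noteq> 0 \<or> w J \<noteq> 0" for J by auto
  with vw show ?thesis unfolding lam_def plus_fun_apply by blast
qed
lemma lam_scale: "p \<in> pcarrier n \<Longrightarrow> w \<in> lam m \<Longrightarrow> (\<lambda>J. p * w J) \<in> lam m" by (auto simp: lam_def)
lemma lam_pcarrier: "w \<in> lam m \<Longrightarrow> w J \<in> pcarrier n" by (auto simp: lam_def)
lemma lam_basis: "J \<subseteq> {..n} \<Longrightarrow> card J = m \<Longrightarrow> ext_basis J \<in> lam m"
  by (auto simp: lam_def ext_basis_def)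

lemma pcarrier_ext_sign: "ext_sign j J \<in> pcarrier n"
  unfolding ext_sign_def by (intro pcarrier_power pcarrier_minus pcarrier_1)

lemma ext_lam: assumes v: "v \<in> vecs" and w: "w \<in> lam m" shows "ext v w \<in> lam (Suc m)"
  unfolding lam_def mem_Collect_eq
proof (intro allI conjI impI)
  fix J
  show "ext v w J \<in> pcarrier n" unfolding ext_def using v w
    by (intro pcarrier_sum pcarrier_mult pcarrier_ext_sign) (auto simp: vecs_def lam_def)
  assume nz: "ext v w J \<noteq> 0"
  then have "finite J" by (rule contrapos_np) (simp add: ext_def)
  from nz obtain j where "j \<in> J" "ext_sign j J * v j * w (J - {j}) \<noteq> 0"
    unfolding ext_def by (rule sum.not_neutral_contains_not_neutral)
  then have "v j \<noteq> 0" "w (J - {j}) \<noteq> 0" by auto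
  then have j: "j \<le> n" "J - {j} \<subseteq> {..n}" "card (J - {j}) = m"
    using v w by (force simp: vecs_def lam_def)+
  show "J \<subseteq> {..n}" using j(1,2) by auto
  show "card J = Suc m" using j(3) \<open>finite J\<close> \<open>j \<in> J\<close> by (metis card_Suc_Diff1)
qed

lemma foldr_ext_lam: "set vs \<subseteq> vecs \<Longrightarrow> w \<in> lam m \<Longrightarrow> foldr ext vs w \<in> lam (length vs + m)"
  by (induction vs) (auto intro: ext_lam)

text \<open>Membership in \<open>I\<Lambda>\<^sup>m + dI \<and> \<Lambda>\<^bsup>m-1\<^esup>\<close>.\<close>

inductive extrel :: "nat \<Rightarrow> (nat set \<Rightarrow> 'k mpoly) \<Rightarrow> bool" where
  zero: "extrel m (\<lambda>_. 0)"
| add: "extrel m v \<Longrightarrow> extrel m w \<Longrightarrow> extrel m (v + w)"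
| ideal: "w \<in> lam m \<Longrightarrow> (\<And>J. w J \<in> I) \<Longrightarrow> extrel m w"
| grad: "f \<in> I \<Longrightarrow> w \<in> lam m \<Longrightarrow> extrel (Suc m) (ext (grad f) w)"

lemma extrel_scale: "extrel m w \<Longrightarrow> p \<in> pcarrier n \<Longrightarrow> extrel m (\<lambda>J. p * w J)"
proof (induction rule: extrel.induct)
  case (add m v w)
  then have "extrel m ((\<lambda>j. p * v j) + (\<lambda>j. p * w j))" by (intro extrel.add) auto
  then show ?case by (simp add: plus_fun_def distrib_left)
next
  case (grad f w m)
  then show ?case unfolding ext_scale_right[symmetric] by (intro extrel.grad lam_scale)
qed (auto intro: extrel.zero extrel.ideal lam_scale I_mult)

lemma pmodule_extrel: "pmodule n {w. extrel m w}"
  by unfold_locales (auto intro: extrel.zero extrel.add extrel_scale)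

interpretation X: pmodule n "{w. extrel m w}" for m by (rule pmodule_extrel)

lemma extrel_minus: "extrel m w \<Longrightarrow> extrel m (- w)"
  using X.minus[of w m] by simp

lemma extrel_lam: "extrel m w \<Longrightarrow> w \<in> lam m"
proof (induction rule: extrel.induct)
  case (add m v w)
  then show ?case by (intro lam_add)
qed (auto intro: lam_zero ext_lam grad_vecs I_pcarrier)

lemma ext_ideal: "(\<And>J. w J \<in> I) \<Longrightarrow> v \<in> vecs \<Longrightarrow> ext v w J \<in> I"
  unfolding ext_def by (intro I_sum I_mult pcarrier_mult pcarrier_ext_sign) (auto simp: vecs_def)

text \<open>Wedging from the left puts \<open>v\<close> in front of \<open>grad f\<close>;
  anticommutation brings the gradient back to the front, where a generator has it.\<close>

lemma ext_extrel: "extrel m w \<Longrightarrow> v \<in> vecs \<Longrightarrow> extrel (Suc m) (ext v w)"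
proof (induction rule: extrel.induct)
  case (ideal w m)
  then show ?case by (intro extrel.ideal ext_lam ext_ideal)
next
  case (grad f w m)
  then show ?case unfolding ext_anticommute[of v] by (intro extrel_minus extrel.grad ext_lam)
next
  case (add m v' w')
  then show ?case unfolding ext_add_right by (intro extrel.add) auto
qed (auto intro: extrel.zero)

lemma foldr_ext_extrel: "extrel m w \<Longrightarrow> set vs \<subseteq> vecs \<Longrightarrow> extrel (length vs + m) (foldr ext vs w)"
  by (induction vs) (auto intro: ext_extrel)

text \<open>Links the relations of \<Omega> to those of its exterior powers. A factor
  \<open>h\<close> in front of a gradient is passed on to \<open>w\<close>.\<close>

lemma ext_jac: "v \<in> jac \<Longrightarrow> w \<in> lam m \<Longrightarrow> extrel (Suc m) (ext v w)"
proof (induction rule: jac.induct)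
  case (ideal v)
  then have "ext v w J \<in> I" for J
    unfolding ext_def
    by (intro I_sum I_mult_right[OF _ lam_pcarrier] I_mult[OF pcarrier_ext_sign])
  with ideal show ?case by (intro extrel.ideal ext_lam)
next
  case (grad h f)
  then show ?case unfolding ext_scale_left by (intro extrel.grad lam_scale)
next
  case (add v' w')
  then show ?case unfolding ext_add_left by (intro extrel.add) auto
qed (auto intro: extrel.zero)

text \<open>\<open>ext_basis {}\<close> is the unit of the exterior algebra, in exterior degree
  zero.\<close>

definition phi :: "('k mpoly set \<Rightarrow> 'k mpoly set) set list \<Rightarrow> nat set \<Rightarrow> 'k mpoly" where
  "phi ws = foldr ext (map theta ws) (ext_basis {})"

lemma phi_lam: "set ws \<subseteq> carrier \<Omega> \<Longrightarrow> phi ws \<in> lam (length ws)"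
proof -
  assume "set ws \<subseteq> carrier \<Omega>"
  then have "set (map theta ws) \<subseteq> vecs" using theta_vecs by auto
  from foldr_ext_lam[OF this lam_basis[of "{}" 0]] show ?thesis by (simp add: phi_def)
qed

text \<open>Changing one entry within \<open>jac\<close> changes the wedge by a relation: the
  difference has \<open>theta x - y\<close> as one factor. Multilinearity of \<open>phi\<close> up
  to relations follows from this.\<close>

lemma phi_split:
  assumes "set as \<subseteq> carrier \<Omega>" "set bs \<subseteq> carrier \<Omega>" "x \<in> carrier \<Omega>" "y \<in> vecs"
    and "theta x - y \<in> jac" and m: "m = Suc (length as + length bs)"
  shows "extrel m (phi (as @ x # bs) - foldr ext (map theta as) (ext y (phi bs)))"
proof -
  have "extrel (Suc (length bs)) (ext (theta x - y) (phi bs))"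
    by (rule ext_jac[OF assms(5) phi_lam[OF assms(2)]])
  then have "extrel (length (map theta as) + Suc (length bs))
      (foldr ext (map theta as) (ext (theta x - y) (phi bs)))"
    by (rule foldr_ext_extrel) (use assms theta_vecs in auto)
  then show ?thesis by (simp add: m ext_diff_left foldr_ext_diff phi_def)
qed

text \<open>The entries are exchanged one by one: the head by \<open>ext_jac\<close>, the tail by
  induction, and the two differences telescope.\<close>

lemma phi_vecs:
  assumes "list_all2 (\<lambda>w v. w \<in> carrier \<Omega> \<and> v \<in> vecs \<and> theta w - v \<in> jac) ws vs"
  shows "extrel (length ws) (phi ws - foldr ext vs (ext_basis {}))"
  using assms
proof (induction rule: list_all2_induct)
  case Nil
  have "phi [] - foldr ext [] (ext_basis {}) = (\<lambda>_. 0)" by (auto simp: phi_def)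
  then show ?case using extrel.zero by (simp only: list.size)
next
  case (Cons w ws v vs)
  have ws: "set ws \<subseteq> carrier \<Omega>" using Cons(2)
    by (auto simp: list_all2_conv_all_nth in_set_conv_nth)
  have "extrel (Suc (length ws)) (ext (theta w - v) (phi ws))"
    using Cons by (intro ext_jac phi_lam ws) auto
  moreover have "extrel (Suc (length ws)) (ext v (phi ws - foldr ext vs (ext_basis {})))"
    by (rule ext_extrel[OF Cons.IH]) (use Cons in auto)
  ultimately have "extrel (Suc (length ws)) (ext (theta w - v) (phi ws) +
      ext v (phi ws - foldr ext vs (ext_basis {})))"
    by (rule extrel.add)
  also have "ext (theta w - v) (phi ws) + ext v (phi ws - foldr ext vs (ext_basis {})) =
      phi (w # ws) - foldr ext (v # vs) (ext_basis {})"
    by (auto simp: phi_def ext_diff_left ext_diff_right)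
  finally show ?case by simp
qed

lemma phi_append: "phi (as @ x # bs) = foldr ext (map theta as) (ext (theta x) (phi bs))"
  by (simp add: phi_def)

lemma phi_add:
  assumes "set as \<subseteq> carrier \<Omega>" "set bs \<subseteq> carrier \<Omega>" "v \<in> carrier \<Omega>" "w \<in> carrier \<Omega>"
    and m: "m = Suc (length as + length bs)"
  shows "X.eqv m (phi (as @ (v \<oplus>\<^bsub>\<Omega>\<^esub> w) # bs)) (phi (as @ v # bs) + phi (as @ w # bs))"
proof -
  interpret Om: module R \<Omega> by (rule module_kaehler_module[OF cring_R k_closed])
  show ?thesis
    using phi_split[OF assms(1,2) Om.M.a_closed[OF assms(3,4)]
        vecs_add[OF theta_vecs[OF assms(3)] theta_vecs[OF assms(4)]] theta_add[OF assms(3,4)] m]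
    unfolding X.eqv_def mem_Collect_eq phi_append ext_add_left foldr_ext_add .
qed

lemma phi_smult:
  assumes "set as \<subseteq> carrier \<Omega>" "set bs \<subseteq> carrier \<Omega>" "v \<in> carrier \<Omega>" "a \<in> carrier R"
    and m: "m = Suc (length as + length bs)"
  shows "X.eqv m (phi (as @ (a \<odot>\<^bsub>\<Omega>\<^esub> v) # bs)) (\<lambda>J. rep a * phi (as @ v # bs) J)"
proof -
  interpret Om: module R \<Omega> by (rule module_kaehler_module[OF cring_R k_closed])
  show ?thesis
    using phi_split[OF assms(1,2) Om.smult_closed[OF assms(4,3)]
        vecs_scale[OF rep_closed[OF assms(4)] theta_vecs[OF assms(3)]] theta_smult[OF assms(4,3)] m]
    unfolding X.eqv_def mem_Collect_eq phi_append ext_scale_left ext_scale_right foldr_ext_scale .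
qed

text \<open>This holds exactly and not only up to relations, because equal entries have the same
  chosen vector under \<open>theta\<close>.\<close>

lemma phi_repeat:
  assumes "i < j" "j < length ws" "ws ! i = ws ! j"
  shows "phi ws = (\<lambda>_. 0)"
proof -
  define as bs cs where "as = take i ws" and "bs = take (j - Suc i) (drop (Suc i) ws)"
    and "cs = drop (Suc j) ws"
  have "drop (Suc i) ws = bs @ ws ! j # cs"
    using id_take_nth_drop[of "j - Suc i" "drop (Suc i) ws"] assms by (simp add: bs_def cs_def)
  then have "ws = as @ ws ! j # bs @ ws ! j # cs"
    using id_take_nth_drop[of i ws] assms by (simp add: as_def)
  then have "phi ws = foldr ext (map theta as) (ext (theta (ws ! j))
      (foldr ext (map theta bs) (ext (theta (ws ! j)) (phi cs))))"
    by (metis phi_append)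
  then show ?thesis by (simp add: ext_repeat)
qed

lemma phi_ideal_scale: "ws \<in> tuples \<Omega> m \<Longrightarrow> g \<in> I \<Longrightarrow> extrel m (\<lambda>J. g * phi ws J)"
  using phi_lam[of ws]
  by (intro extrel.ideal lam_scale[OF I_pcarrier] I_mult_right lam_pcarrier[of _ m])
    (auto simp: tuples_def)

interpretation XL: free_lift n I "{w. extrel m w}" "tuples \<Omega> m" phi "exterior_relators R \<Omega> m" for m
  by unfold_locales (simp add: phi_ideal_scale)

text \<open>The three kinds of relator are handled by \<open>phi_add\<close>,
  \<open>phi_smult\<close> and \<open>phi_repeat\<close>; with this \<open>phi\<close> descends to
  the exterior power.\<close>

lemma exterior_relators_lin:
  assumes "s \<in> exterior_relators R \<Omega> m" shows "lin phi s \<in> {w. extrel m w}"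
proof -
  let ?F = "free_module R (tuples \<Omega> m)" and ?L = "lin phi"
  interpret Om: module R \<Omega> by (rule module_kaehler_module[OF cring_R k_closed])
  have e: "free_gen R ws \<in> carrier ?F" if "ws \<in> tuples \<Omega> m" for ws
    using that by (rule R.free_gen_closed)
  have split: "ws[i := x] = take i ws @ x # drop (Suc i) ws"
    "set (take i ws) \<subseteq> carrier \<Omega>" "set (drop (Suc i) ws) \<subseteq> carrier \<Omega>"
    "m = Suc (length (take i ws) + length (drop (Suc i) ws))"
    if "ws \<in> tuples \<Omega> m" "i < m" for ws i x
    using that set_take_subset[of i ws] set_drop_subset[of "Suc i" ws]
    by (auto simp: tuples_def upd_conv_take_nth_drop)
  from assms show ?thesis
  proof (cases rule: exterior_relators_cases)
    case 1: (add ws i v w)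
    note t = Om.tuples_update[OF 1(1) 1(3), of i] Om.tuples_update[OF 1(1) 1(4), of i]
      Om.tuples_update[OF 1(1) Om.M.a_closed[OF 1(3,4)], of i]
    have "X.eqv m (?L s) (?L (free_gen R (ws[i := v \<oplus>\<^bsub>\<Omega>\<^esub> w])) -
        ?L (free_gen R (ws[i := v]) \<oplus>\<^bsub>?F\<^esub> free_gen R (ws[i := w])))"
      unfolding 1(5) by (intro XL.lin_minus XL.F.M.a_closed e t)
    also have "X.eqv m \<dots> (phi (ws[i := v \<oplus>\<^bsub>\<Omega>\<^esub> w]) - (phi (ws[i := v]) + phi (ws[i := w])))"
      by (intro X.eqv_diff XL.lin_gen X.eqv_trans[OF XL.lin_add] X.eqv_add e t)
    finally show ?thesis
      using phi_add[OF split(2,3)[OF 1(1,2)] 1(3,4) split(4)[OF 1(1,2)]]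
      unfolding split(1)[OF 1(1,2)] by (rule X.eqv_diff_mem)
  next
    case 2: (smult ws i a v)
    note t = Om.tuples_update[OF 2(1) 2(4), of i]
      Om.tuples_update[OF 2(1) Om.smult_closed[OF 2(3,4)], of i]
    have "X.eqv m (?L s) (?L (free_gen R (ws[i := a \<odot>\<^bsub>\<Omega>\<^esub> v])) -
        ?L (a \<odot>\<^bsub>?F\<^esub> free_gen R (ws[i := v])))"
      unfolding 2(5) by (intro XL.lin_minus XL.F.smult_closed e t 2)
    also have "X.eqv m \<dots> (phi (ws[i := a \<odot>\<^bsub>\<Omega>\<^esub> v]) - (\<lambda>J. rep a * phi (ws[i := v]) J))"
      by (intro X.eqv_diff XL.lin_gen X.eqv_trans[OF XL.lin_smult] X.eqv_scale rep_closed e t 2)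
    finally show ?thesis
      using phi_smult[OF split(2,3)[OF 2(1,2)] 2(4,3) split(4)[OF 2(1,2)]]
      unfolding split(1)[OF 2(1,2)] by (rule X.eqv_diff_mem)
  next
    case 3: (repeat ws i j)
    have "X.eqv m (?L s) (phi ws)" unfolding 3(5) by (rule XL.lin_gen[OF 3(1)])
    moreover have "phi ws = (\<lambda>_. 0)"
      by (rule phi_repeat[OF 3(2) _ 3(4)]) (use 3 in \<open>auto simp: tuples_def\<close>)
    ultimately show ?thesis using X.eqv_mem X.zero by metis
  qed
qed

interpretation XQ: quotient_lift n I "{w. extrel m w}" "tuples \<Omega> m" phi "exterior_relators R \<Omega> m" for m
  by unfold_locales
    (rule module.exterior_relators_closed[OF module_kaehler_module[OF cring_R k_closed]],
     rule exterior_relators_lin)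

abbreviation "E m \<equiv> exterior_power R \<Omega> m"

lemma E_eq: "E m = quotient_module (free_module R (tuples \<Omega> m))
    (LinearCombinations.module.span R (free_module R (tuples \<Omega> m)) (exterior_relators R \<Omega> m))"
  by (simp only: exterior_power_def exterior_relations_eq_span)

definition Phi :: "nat \<Rightarrow> (('k mpoly set \<Rightarrow> 'k mpoly set) set list \<Rightarrow> 'k mpoly set) set \<Rightarrow> nat set \<Rightarrow> 'k mpoly"
  where "Phi m = XQ.lift m"

lemma lam_sum: "(\<And>x. x \<in> A \<Longrightarrow> f x \<in> lam m) \<Longrightarrow> (\<lambda>J. \<Sum>x\<in>A. f x J) \<in> lam m"
proof (induction A rule: infinite_finite_induct)
  case (insert x A)
  then have "f x + (\<lambda>y. \<Sum>x\<in>A. f x y) \<in> lam m" by (intro lam_add) auto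
  with insert show ?case by (simp add: plus_fun_def)
qed (auto simp: lam_zero)

lemma Phi_lam: assumes "v \<in> carrier (E m)" shows "Phi m v \<in> lam m"
proof -
  obtain c where c: "c \<in> carrier (free_module R (tuples \<Omega> m))" "Phi m v = lin phi c"
    using XQ.lift_lin assms unfolding E_eq Phi_def by blast
  have "c x \<in> carrier R" for x by (rule R.free_module_carrier_closed[OF c(1)])
  moreover have "phi x \<in> lam m" if "c x \<noteq> \<zero>\<^bsub>R\<^esub>" for x
  proof -
    have "x \<in> tuples \<Omega> m" using c(1) that by (auto simp: free_module_simps)
    then show ?thesis using phi_lam[of x] by (simp add: tuples_def)
  qed
  ultimately have "(\<lambda>y. \<Sum>x\<in>{x. c x \<noteq> \<zero>\<^bsub>R\<^esub>}. rep (c x) * phi x y) \<in> lam m"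
    by (intro lam_sum lam_scale rep_closed) auto
  then show ?thesis unfolding c(2) lin_def[abs_def] .
qed

lemma Phi_add: "v \<in> carrier (E m) \<Longrightarrow> w \<in> carrier (E m) \<Longrightarrow>
    X.eqv m (Phi m (v \<oplus>\<^bsub>E m\<^esub> w)) (Phi m v + Phi m w)"
  using XQ.lift_add unfolding E_eq Phi_def by blast

lemma Phi_smult:
  assumes "f \<in> pcarrier n" "v \<in> carrier (E m)"
  shows "X.eqv m (Phi m (pr f \<odot>\<^bsub>E m\<^esub> v)) (\<lambda>J. f * Phi m v J)"
proof -
  have "X.eqv m (Phi m (pr f \<odot>\<^bsub>E m\<^esub> v)) (\<lambda>J. rep (pr f) * Phi m v J)"
    using XQ.lift_smult[OF pr_closed[OF assms(1)]] assms(2) unfolding E_eq Phi_def by blast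
  also have "X.eqv m \<dots> (\<lambda>J. f * Phi m v J)"
  proof -
    have "extrel m (\<lambda>J. (rep (pr f) - f) * Phi m v J)"
      by (intro extrel.ideal lam_scale[OF I_pcarrier] Phi_lam rep_pr assms I_mult_right
          lam_pcarrier[OF Phi_lam])
    then show ?thesis by (simp add: X.eqv_def fun_diff_def left_diff_distrib)
  qed
  finally show ?thesis .
qed

lemma Phi_zero: "extrel m (Phi m \<zero>\<^bsub>E m\<^esub>)"
  using XQ.lift_zero unfolding E_eq Phi_def by blast

definition dX :: "nat set \<Rightarrow> ('k mpoly set \<Rightarrow> 'k mpoly set) set list" where
  "dX J = map (\<lambda>j. d\<^sub>R (pr (var j))) (sorted_list_of_set J)"

lemma dx_closed: "j \<le> n \<Longrightarrow> d\<^sub>R (pr (var j)) \<in> carrier \<Omega>"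
  by (intro kaehler_d_closed[OF cring_R k_closed] pr_closed pcarrier_var)

lemma dX_tuples: assumes "J \<subseteq> {..n}" "card J = m" shows "dX J \<in> tuples \<Omega> m"
proof -
  have "finite J" using assms finite_subset by blast
  then show ?thesis using assms by (auto simp: tuples_def dX_def intro: dx_closed)
qed

text \<open>The gradient of a variable is a unit vector, and \<open>dX J\<close> lists the indices
  in increasing order, so no sign appears.\<close>

lemma Phi_basis: assumes J: "J \<subseteq> {..n}" "card J = m"
  shows "X.eqv m (Phi m (wedge R \<Omega> (dX J))) (ext_basis J)"
proof -
  have len: "length (dX J) = m" using dX_tuples[OF J] by (simp add: tuples_def)
  have fin: "finite J" using J finite_subset by blast
  have "X.eqv m (Phi m (wedge R \<Omega> (dX J))) (phi (dX J))"
    using XQ.lift_gen[OF dX_tuples[OF J]]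
    unfolding Phi_def wedge_def len exterior_relations_eq_span .
  also have "X.eqv m \<dots> (ext_basis J)"
  proof -
    have la: "list_all2 (\<lambda>w v. w \<in> carrier \<Omega> \<and> v \<in> vecs \<and> theta w - v \<in> jac) (dX J)
        (map unit_vec (sorted_list_of_set J))"
      unfolding dX_def list_all2_map1 list_all2_map2
      using J fin theta_d[OF pcarrier_var] dx_closed
      by (auto simp: list_all2_same grad_var unit_vec_vecs subset_iff)
    then have "extrel m (phi (dX J) - foldr ext (map unit_vec (sorted_list_of_set J)) (ext_basis {}))"
      using phi_vecs[OF la] by (simp only: len)
    moreover have "foldr ext (map unit_vec (sorted_list_of_set J)) (ext_basis {}) =
        (ext_basis J :: nat set \<Rightarrow> 'k mpoly)"
      using foldr_ext_unit[OF strict_sorted_list_of_set, of J] fin by simp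
    ultimately show ?thesis by (simp only: X.eqv_def mem_Collect_eq)
  qed
  finally show ?thesis .
qed

end

section \<open>From coefficient functions back to differential forms: the maps \<open>th\<close> and
  \<open>Psi\<close>\<close>

context module
begin

lemma wedge_zero:
  assumes "set as \<subseteq> carrier M" "set bs \<subseteq> carrier M" and m: "m = Suc (length as + length bs)"
  shows "wedge R M (as @ \<zero>\<^bsub>M\<^esub> # bs) = \<zero>\<^bsub>exterior_power R M m\<^esub>"
proof -
  interpret E: module R "exterior_power R M m" by (rule module_exterior_power)
  have "wedge R M (as @ (\<zero> \<odot>\<^bsub>M\<^esub> \<zero>\<^bsub>M\<^esub>) # bs) = \<zero> \<odot>\<^bsub>exterior_power R M m\<^esub> wedge R M (as @ \<zero>\<^bsub>M\<^esub> # bs)"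
    by (rule wedge_smult[OF assms(1,2) _ _ m]) auto
  moreover have "wedge R M (as @ \<zero>\<^bsub>M\<^esub> # bs) \<in> carrier (exterior_power R M m)"
    using wedge_closed[of "as @ \<zero>\<^bsub>M\<^esub> # bs"] assms by simp
  ultimately show ?thesis by simp
qed

lemma wedge_finsum:
  assumes "set as \<subseteq> carrier M" "set bs \<subseteq> carrier M" and m: "m = Suc (length as + length bs)"
    and "finite A" "\<And>x. x \<in> A \<Longrightarrow> f x \<in> carrier M"
  shows "wedge R M (as @ (\<Oplus>\<^bsub>M\<^esub>x\<in>A. f x) # bs) =
    (\<Oplus>\<^bsub>exterior_power R M m\<^esub>x\<in>A. wedge R M (as @ f x # bs))"
proof -
  interpret E: module R "exterior_power R M m" by (rule module_exterior_power)
  have cl: "wedge R M (as @ v # bs) \<in> carrier (exterior_power R M m)" if "v \<in> carrier M" for v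
    using wedge_closed[of "as @ v # bs"] assms that by simp
  show ?thesis using assms(4,5)
  proof (induction A rule: finite_induct)
    case empty then show ?case by (simp add: wedge_zero[OF assms(1-3)])
  next
    case (insert x A)
    then have f: "f \<in> A \<rightarrow> carrier M" "f x \<in> carrier M" by auto
    then have "(\<Oplus>\<^bsub>M\<^esub>x\<in>insert x A. f x) = f x \<oplus>\<^bsub>M\<^esub> (\<Oplus>\<^bsub>M\<^esub>x\<in>A. f x)"
      using insert by simp
    moreover have "(\<Oplus>\<^bsub>M\<^esub>x\<in>A. f x) \<in> carrier M" using f by simp
    moreover have "(\<lambda>x. wedge R M (as @ f x # bs)) \<in> A \<rightarrow> carrier (exterior_power R M m)"
      using f cl by auto
    ultimately show ?case using insert f cl
      by (simp add: wedge_add[OF assms(1,2) _ _ m])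
  qed
qed

end

text \<open>Tailored to derivations: these are determined by their values on constants and
  variables.\<close>

lemma pcarrier_induct [consumes 1, case_names const var add mult]:
  fixes f :: "'k::field mpoly"
  assumes f: "f \<in> pcarrier n"
    and const: "\<And>c. P (const c)" and var: "\<And>i. i \<le> n \<Longrightarrow> P (var i)"
    and add: "\<And>f g. f \<in> pcarrier n \<Longrightarrow> g \<in> pcarrier n \<Longrightarrow> P f \<Longrightarrow> P g \<Longrightarrow> P (f + g)"
    and mult: "\<And>f g. f \<in> pcarrier n \<Longrightarrow> g \<in> pcarrier n \<Longrightarrow> P f \<Longrightarrow> P g \<Longrightarrow> P (f * g)"
  shows "P f"
proof -
  have pow: "(var i ^ e :: 'k mpoly) \<in> pcarrier n \<and> P (var i ^ e)" if "i \<le> n" for i e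
    by (induction e) (use that const[of 1] in \<open>auto simp: const_1 intro: var mult\<close>)
  have prod: "(\<Prod>i\<in>A. var i ^ e i :: 'k mpoly) \<in> pcarrier n \<and> P (\<Prod>i\<in>A. var i ^ e i)" if "A \<subseteq> {..n}" for A e
    using that
  proof (induction A rule: infinite_finite_induct)
    case (insert i A)
    then show ?case using pow[of i "e i"] by (auto intro: mult)
  qed (use const[of 1] in \<open>auto simp: const_1\<close>)
  have single: "single t c \<in> pcarrier n \<and> P (single t c)" if "keys t \<subseteq> {..n}" for t c
    using prod[OF that] unfolding single_var by (auto intro: mult const)
  have "(\<Sum>t\<in>T. single t (lookup f t)) \<in> pcarrier n \<and> P (\<Sum>t\<in>T. single t (lookup f t))"
    if "T \<subseteq> keys f" for T
    using that
  proof (induction T rule: infinite_finite_induct)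
    case (insert t T)
    then have "keys t \<subseteq> {..n}" using f by (auto simp: carrier_poly_ring)
    with insert single show ?case by (auto intro: add)
  qed (use const[of 0] in \<open>auto simp: const_0\<close>)
  then show ?thesis using poly_mapping_sum_single[of f] by force
qed

context coord_ideal
begin

interpretation Om: module R \<Omega> by (rule module_kaehler_module[OF cring_R k_closed])
interpretation E: module R "E m" for m by (rule Om.module_exterior_power)

lemma d_closed: "f \<in> pcarrier n \<Longrightarrow> d\<^sub>R (pr f) \<in> carrier \<Omega>"
  by (intro kaehler_d_closed[OF cring_R k_closed] pr_closed)

text \<open>The map opposite to \<open>theta\<close>, sending unit vectors to the differentials of
  the variables.\<close>

definition th :: "(nat \<Rightarrow> 'k mpoly) \<Rightarrow> ('k mpoly set \<Rightarrow> 'k mpoly set) set" where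
  "th v = (\<Oplus>\<^bsub>\<Omega>\<^esub>j\<in>{..n}. pr (v j) \<odot>\<^bsub>\<Omega>\<^esub> d\<^sub>R (pr (var j)))"

lemma th_term_closed: "v \<in> vecs \<Longrightarrow> j \<le> n \<Longrightarrow> pr (v j) \<odot>\<^bsub>\<Omega>\<^esub> d\<^sub>R (pr (var j)) \<in> carrier \<Omega>"
  by (intro Om.smult_closed pr_closed vecs_pcarrier dx_closed)

lemma th_closed: "v \<in> vecs \<Longrightarrow> th v \<in> carrier \<Omega>"
  unfolding th_def by (intro Om.M.finsum_closed) (auto intro: th_term_closed)

lemma th_add:
  assumes "v \<in> vecs" "w \<in> vecs" shows "th (v + w) = th v \<oplus>\<^bsub>\<Omega>\<^esub> th w"
proof -
  have "th (v + w) = (\<Oplus>\<^bsub>\<Omega>\<^esub>j\<in>{..n}. pr (v j) \<odot>\<^bsub>\<Omega>\<^esub> d\<^sub>R (pr (var j)) \<oplus>\<^bsub>\<Omega>\<^esub> pr (w j) \<odot>\<^bsub>\<Omega>\<^esub> d\<^sub>R (pr (var j)))"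
    unfolding th_def using assms th_term_closed
    by (intro Om.M.finsum_cong')
      (auto simp: pr_add[symmetric] vecs_pcarrier dx_closed Om.smult_l_distr)
  also have "\<dots> = th v \<oplus>\<^bsub>\<Omega>\<^esub> th w"
    unfolding th_def using assms th_term_closed by (intro Om.M.finsum_addf) auto
  finally show ?thesis .
qed

lemma th_scale:
  assumes "p \<in> pcarrier n" "v \<in> vecs" shows "th (\<lambda>j. p * v j) = pr p \<odot>\<^bsub>\<Omega>\<^esub> th v"
proof -
  have "th (\<lambda>j. p * v j) = (\<Oplus>\<^bsub>\<Omega>\<^esub>j\<in>{..n}. pr p \<odot>\<^bsub>\<Omega>\<^esub> (pr (v j) \<odot>\<^bsub>\<Omega>\<^esub> d\<^sub>R (pr (var j))))"
    unfolding th_def using assms th_term_closed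
    by (intro Om.M.finsum_cong')
      (auto simp: pr_mult[symmetric] vecs_pcarrier dx_closed Om.smult_assoc1)
  also have "\<dots> = pr p \<odot>\<^bsub>\<Omega>\<^esub> th v"
    unfolding th_def using assms th_term_closed by (intro Om.finsum_smult_ldistr[symmetric]) auto
  finally show ?thesis .
qed

lemma th_zero: "th (\<lambda>_. 0) = \<zero>\<^bsub>\<Omega>\<^esub>"
  unfolding th_def R_zero[symmetric] using dx_closed by (intro Om.M.add.finprod_one_eqI) auto

lemma th_unit: assumes "i \<le> n" shows "th (unit_vec i) = d\<^sub>R (pr (var i))"
proof -
  have "th (unit_vec i) = (\<Oplus>\<^bsub>\<Omega>\<^esub>j\<in>{..n}. if i = j then d\<^sub>R (pr (var j)) else \<zero>\<^bsub>\<Omega>\<^esub>)"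
    unfolding th_def using dx_closed
    by (intro Om.M.finsum_cong') (auto simp: unit_vec_def R_zero[symmetric] R_one[symmetric])
  also have "\<dots> = d\<^sub>R (pr (var i))"
    using assms dx_closed by (intro Om.M.finsum_singleton) auto
  finally show ?thesis .
qed

text \<open>Both sides are additive, obey the Leibniz rule, vanish on constants and agree on the
  variables.\<close>

lemma d_pr: assumes "f \<in> pcarrier n" shows "d\<^sub>R (pr f) = th (grad f)"
  using assms
proof (induction rule: pcarrier_induct)
  case (const c)
  have "pr (const c) \<in> k" by (auto simp: coord_base_def)
  moreover have "grad (const c) = (\<lambda>_. 0)" by (auto simp: grad_def)
  ultimately show ?case by (simp add: kaehler_d_base[OF cring_R k_closed] th_zero)
next
  case (var i) then show ?case by (simp add: grad_var th_unit)
next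
  case (add f g)
  then show ?case
    by (simp only: pr_add[symmetric] kaehler_d_add[OF cring_R k_closed] pr_closed grad_add th_add grad_vecs)
next
  case (mult f g)
  have "grad (f * g) = (\<lambda>j. f * grad g j) + (\<lambda>j. g * grad f j)"
    by (auto simp: grad_def pd_mult)
  with mult show ?case
    by (simp only: pr_mult[symmetric] kaehler_d_mult[OF cring_R k_closed] pr_closed th_scale
        th_add vecs_scale grad_vecs)
qed

lemma d_ideal: "f \<in> I \<Longrightarrow> th (grad f) = \<zero>\<^bsub>\<Omega>\<^esub>"
proof -
  assume f: "f \<in> I"
  then have "pr f = pr 0" using pr_zero_iff I_pcarrier R_zero by metis
  then have "th (grad f) = th (grad 0)"
    using d_pr f I_pcarrier by (metis pcarrier_0)
  moreover have "grad 0 = (\<lambda>_. 0)" by (auto simp: grad_def)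
  ultimately show ?thesis by (simp add: th_zero)
qed

abbreviation dx where "dx j \<equiv> d\<^sub>R (pr (var j))"

lemma pr_minus_one: "pr (- p) \<odot>\<^bsub>E m\<^esub> v = \<ominus>\<^bsub>E m\<^esub> (pr p \<odot>\<^bsub>E m\<^esub> v)"
  if "p \<in> pcarrier n" "v \<in> carrier (E m)"
  using that by (simp add: pr_minus[symmetric] E.smult_l_minus)

text \<open>Each smaller index that \<open>dx j\<close> passes costs one sign by
  \<open>wedge_swap\<close>. The prefix \<open>ws\<close> is arbitrary because in the induction the
  entry passed over joins it.\<close>

lemma wedge_insort:
  assumes "set ws \<subseteq> carrier \<Omega>" "set (j # js) \<subseteq> {..n}" "sorted_wrt (<) js" "j \<notin> set js"
    and m: "m = length ws + Suc (length js)"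
  shows "wedge R \<Omega> (ws @ map dx (j # js)) =
    pr ((- 1) ^ card {i \<in> set js. i < j}) \<odot>\<^bsub>E m\<^esub> wedge R \<Omega> (ws @ map dx (insort j js))"
  using assms
proof (induction js arbitrary: ws)
  case Nil
  then have "wedge R \<Omega> (ws @ [dx j]) \<in> carrier (E m)"
    using Om.wedge_closed[of "ws @ [dx j]"] dx_closed by auto
  then show ?case by (simp add: R_one[symmetric])
next
  case (Cons a js)
  have cl: "wedge R \<Omega> (ws @ map dx is) \<in> carrier (E m)"
    if "set is \<subseteq> {..n}" "length is = Suc (Suc (length js))" for "is"
  proof -
    have "set (ws @ map dx is) \<subseteq> carrier \<Omega>" using Cons.prems(1) that dx_closed by auto
    from Om.wedge_closed[OF this] show ?thesis using that Cons.prems(5) by simp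
  qed
  show ?case
  proof (cases "j < a")
    case True
    have e: "{i \<in> set (a # js). i < j} = {}" using Cons.prems(3) True by auto
    have "wedge R \<Omega> (ws @ map dx (j # a # js)) \<in> carrier (E m)"
      by (rule cl) (use Cons.prems in auto)
    with True show ?thesis unfolding e by (simp add: R_one[symmetric])
  next
    case False
    then have ja: "a < j" using Cons.prems(4) by auto
    have e: "{i \<in> set (a # js). i < j} = insert a {i \<in> set js. i < j}" using ja by auto
    have c: "card {i \<in> set (a # js). i < j} = Suc (card {i \<in> set js. i < j})"
      unfolding e using Cons.prems(3) by (subst card_insert_disjoint) auto
    let ?s = "(- 1) ^ card {i \<in> set js. i < j} :: 'k mpoly"
    have s: "?s \<in> pcarrier n" by (intro pcarrier_power pcarrier_minus pcarrier_1)
    have "wedge R \<Omega> (ws @ map dx (j # a # js)) = \<ominus>\<^bsub>E m\<^esub> wedge R \<Omega> (ws @ dx a # dx j # map dx js)"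
      using Om.wedge_swap[of ws "map dx js" "dx j" "dx a" m] Cons.prems dx_closed by auto
    also have "wedge R \<Omega> (ws @ dx a # dx j # map dx js) = wedge R \<Omega> ((ws @ [dx a]) @ map dx (j # js))"
      by simp
    also have "\<dots> = pr ?s \<odot>\<^bsub>E m\<^esub> wedge R \<Omega> ((ws @ [dx a]) @ map dx (insort j js))"
      by (rule Cons.IH) (use Cons.prems dx_closed in auto)
    also have "(ws @ [dx a]) @ map dx (insort j js) = ws @ map dx (insort j (a # js))"
      using ja by simp
    also have "\<ominus>\<^bsub>E m\<^esub> (pr ?s \<odot>\<^bsub>E m\<^esub> wedge R \<Omega> (ws @ map dx (insort j (a # js)))) =
        pr (- ?s) \<odot>\<^bsub>E m\<^esub> wedge R \<Omega> (ws @ map dx (insort j (a # js)))"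
      by (rule pr_minus_one[symmetric, OF s], rule cl) (use Cons.prems in \<open>auto simp: set_insort_key\<close>)
    finally show ?thesis unfolding c by simp
  qed
qed

definition subs :: "nat \<Rightarrow> nat set set" where
  "subs l = {J. J \<subseteq> {..n} \<and> card J = l}"

lemma finite_subs [simp]: "finite (subs l)"
  by (rule finite_subset[of _ "Pow {..n}"]) (auto simp: subs_def)

lemma subs_finite: "J \<in> subs l \<Longrightarrow> finite J"
  using finite_subset by (auto simp: subs_def)

text \<open>The counterpart of \<open>ext_unit_basis\<close> in the exterior power. Agreement of the
  two signs makes \<open>psi\<close> compatible with wedge products.\<close>

lemma wedge_dx_dX:
  assumes "set ws \<subseteq> carrier \<Omega>" "j \<le> n" "J \<in> subs l" and m: "m = length ws + Suc l"
  shows "wedge R \<Omega> (ws @ dx j # dX J) = (if j \<in> J then \<zero>\<^bsub>E m\<^esub>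
    else pr (ext_sign j (insert j J)) \<odot>\<^bsub>E m\<^esub> wedge R \<Omega> (ws @ dX (insert j J)))"
proof -
  have fin: "finite J" and J: "J \<subseteq> {..n}" "card J = l"
    using assms(3) subs_finite[OF assms(3)] by (auto simp: subs_def)
  let ?js = "sorted_list_of_set J"
  show ?thesis
  proof (cases "j \<in> J")
    case True
    then obtain as bs where js: "?js = as @ j # bs" using fin by (metis set_sorted_list_of_set split_list)
    have s: "set as \<subseteq> {..n}" "set bs \<subseteq> {..n}"
      using arg_cong[OF js, of set] J(1) fin by auto
    have "wedge R \<Omega> (ws @ dx j # map dx as @ dx j # map dx bs) = \<zero>\<^bsub>E m\<^esub>"
    proof (rule Om.wedge_repeat)
      have "length ?js = l" using J by simp
      then show "m = length ws + length (map dx as) + length (map dx bs) + 2"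
        using m unfolding js by simp
    qed (use assms s dx_closed in auto)
    with True show ?thesis by (simp add: dX_def js)
  next
    case False
    have "{i \<in> set ?js. i < j} = {i \<in> insert j J. i < j}" using fin by auto
    moreover have "insort j ?js = sorted_list_of_set (insert j J)" using fin False by simp
    moreover have "set (j # ?js) \<subseteq> {..n}" "sorted_wrt (<) ?js" "j \<notin> set ?js" "m = length ws + Suc (length ?js)"
      using J fin assms False by auto
    ultimately show ?thesis using wedge_insort[OF assms(1), of j ?js m] False
      by (simp add: dX_def ext_sign_def)
  qed
qed

text \<open>The linear map with values \<open>W J\<close> on basis forms. \<open>W\<close> is a
  parameter because \<open>wedge_map_th\<close> needs it with a varying prefix in front of
  \<open>dX J\<close>.\<close>

definition psi :: "('k mpoly set, 'e, 'f) module_scheme \<Rightarrow> (nat set \<Rightarrow> 'e) \<Rightarrow> nat \<Rightarrow> (nat set \<Rightarrow> 'k mpoly) \<Rightarrow> 'e" where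
  "psi M W l w = (\<Oplus>\<^bsub>M\<^esub>J\<in>subs l. pr (w J) \<odot>\<^bsub>M\<^esub> W J)"

context
  fixes M :: "('k mpoly set, 'e, 'f) module_scheme" and W :: "nat set \<Rightarrow> 'e" and l :: nat
  assumes M: "module R M" and W: "\<And>J. J \<in> subs l \<Longrightarrow> W J \<in> carrier M"
begin

interpretation M: module R M by (rule M)

lemma psi_closed: "(\<And>J. w J \<in> pcarrier n) \<Longrightarrow> psi M W l w \<in> carrier M"
  unfolding psi_def using W by (intro M.M.finsum_closed) auto

lemma psi_add:
  assumes "\<And>J. v J \<in> pcarrier n" "\<And>J. w J \<in> pcarrier n"
  shows "psi M W l (\<lambda>J. v J + w J) = psi M W l v \<oplus>\<^bsub>M\<^esub> psi M W l w"
proof -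
  have "psi M W l (\<lambda>J. v J + w J) = (\<Oplus>\<^bsub>M\<^esub>J\<in>subs l. pr (v J) \<odot>\<^bsub>M\<^esub> W J \<oplus>\<^bsub>M\<^esub> pr (w J) \<odot>\<^bsub>M\<^esub> W J)"
    unfolding psi_def using assms W
    by (intro M.M.finsum_cong') (auto simp: pr_add[symmetric] M.smult_l_distr)
  also have "\<dots> = psi M W l v \<oplus>\<^bsub>M\<^esub> psi M W l w"
    unfolding psi_def using assms W by (intro M.M.finsum_addf) auto
  finally show ?thesis .
qed

lemma psi_scale:
  assumes "p \<in> pcarrier n" "\<And>J. w J \<in> pcarrier n"
  shows "psi M W l (\<lambda>J. p * w J) = pr p \<odot>\<^bsub>M\<^esub> psi M W l w"
proof -
  have "psi M W l (\<lambda>J. p * w J) = (\<Oplus>\<^bsub>M\<^esub>J\<in>subs l. pr p \<odot>\<^bsub>M\<^esub> (pr (w J) \<odot>\<^bsub>M\<^esub> W J))"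
    unfolding psi_def using assms W
    by (intro M.M.finsum_cong') (auto simp: pr_mult[symmetric] M.smult_assoc1)
  also have "\<dots> = pr p \<odot>\<^bsub>M\<^esub> psi M W l w"
    unfolding psi_def using assms W by (intro M.finsum_smult_ldistr[symmetric]) auto
  finally show ?thesis .
qed

lemma psi_ideal: "(\<And>J. w J \<in> I) \<Longrightarrow> psi M W l w = \<zero>\<^bsub>M\<^esub>"
proof -
  assume w: "\<And>J. w J \<in> I"
  have "pr (w J) \<odot>\<^bsub>M\<^esub> W J = \<zero>\<^bsub>M\<^esub>" if "J \<in> subs l" for J
  proof -
    have "pr (w J) = \<zero>\<^bsub>R\<^esub>" using w pr_zero_iff I_pcarrier by blast
    then show ?thesis using W[OF that] by (simp only: M.smult_l_null)
  qed
  then show ?thesis unfolding psi_def by (intro M.M.add.finprod_one_eqI) auto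
qed

lemma psi_sum:
  assumes "finite A" "\<And>x J. x \<in> A \<Longrightarrow> f x J \<in> pcarrier n"
  shows "psi M W l (\<lambda>J. \<Sum>x\<in>A. f x J) = (\<Oplus>\<^bsub>M\<^esub>x\<in>A. psi M W l (f x))"
  using assms
proof (induction A rule: finite_induct)
  case empty
  then show ?case using psi_ideal[of "\<lambda>_. 0"] I_0 by simp
next
  case (insert x A)
  have "psi M W l (\<lambda>J. \<Sum>x\<in>insert x A. f x J) = psi M W l (\<lambda>J. f x J + (\<Sum>x\<in>A. f x J))"
    using insert by simp
  also have "\<dots> = psi M W l (f x) \<oplus>\<^bsub>M\<^esub> psi M W l (\<lambda>J. \<Sum>x\<in>A. f x J)"
    using insert by (intro psi_add pcarrier_sum) auto
  also have "\<dots> = (\<Oplus>\<^bsub>M\<^esub>x\<in>insert x A. psi M W l (f x))"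
    using insert by (subst M.M.finsum_insert) (auto intro: psi_closed)
  finally show ?case .
qed

lemma psi_basis: assumes "J \<in> subs l" shows "psi M W l (ext_basis J) = W J"
proof -
  have "psi M W l (ext_basis J) = (\<Oplus>\<^bsub>M\<^esub>J'\<in>subs l. if J = J' then W J' else \<zero>\<^bsub>M\<^esub>)"
    unfolding psi_def using W
    by (intro M.M.finsum_cong') (auto simp: ext_basis_def R_zero[symmetric] R_one[symmetric])
  also have "\<dots> = W J" using assms W by (intro M.M.finsum_singleton) auto
  finally show ?thesis .
qed

end

lemma lam_expand:
  assumes "w \<in> lam l" shows "w = (\<lambda>J. \<Sum>J'\<in>subs l. w J' * ext_basis J' J)"
proof
  fix J
  have "(\<Sum>J'\<in>subs l. w J' * ext_basis J' J) = (\<Sum>J'\<in>subs l. if J' = J then w J else 0)"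
    by (intro sum.cong) (auto simp: ext_basis_def)
  also have "\<dots> = w J" using assms by (auto simp: lam_def subs_def)
  finally show "w J = (\<Sum>J'\<in>subs l. w J' * ext_basis J' J)" by simp
qed

lemma vecs_expand:
  assumes "v \<in> vecs" shows "v = (\<lambda>i. \<Sum>j\<in>{..n}. v j * unit_vec j i)"
proof
  fix i
  have "(\<Sum>j\<in>{..n}. v j * unit_vec j i) = (\<Sum>j\<in>{..n}. if j = i then v i else 0)"
    by (intro sum.cong) (auto simp: unit_vec_def)
  also have "\<dots> = v i" using assms by (auto simp: vecs_def)
  finally show "v i = (\<Sum>j\<in>{..n}. v j * unit_vec j i)" by simp
qed

end

lemma ext_sum_right: "ext v (\<lambda>J. \<Sum>x\<in>A. f x J) = (\<lambda>J. \<Sum>x\<in>A. ext v (f x) J)"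
  unfolding ext_def by (auto simp: sum_distrib_left fun_eq_iff intro: sum.swap)

lemma ext_sum_left: "ext (\<lambda>j. \<Sum>x\<in>A. f x j) w = (\<lambda>J. \<Sum>x\<in>A. ext (f x) w J)"
  unfolding ext_def by (auto simp: sum_distrib_left sum_distrib_right fun_eq_iff intro: sum.swap)

context coord_ideal
begin

interpretation Om: module R \<Omega> by (rule module_kaehler_module[OF cring_R k_closed])
interpretation E: module R "E m" for m by (rule Om.module_exterior_power)
interpretation X: pmodule n "{w. extrel m w}" for m by (rule pmodule_extrel)

lemma dX_subs: "J \<in> subs l \<Longrightarrow> dX J \<in> tuples \<Omega> l"
  using dX_tuples by (auto simp: subs_def)

lemma wedge_dX_closed:
  assumes "set ws \<subseteq> carrier \<Omega>" "J \<in> subs l" "m = length ws + l"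
  shows "wedge R \<Omega> (ws @ dX J) \<in> carrier (E m)"
  using Om.wedge_closed[of "ws @ dX J"] assms dX_subs[OF assms(2)] by (auto simp: tuples_def)

lemma foldr_ext_basis_lam: "set vs \<subseteq> vecs \<Longrightarrow> foldr ext vs (ext_basis {}) \<in> lam (length vs)"
  using foldr_ext_lam[OF _ lam_basis[of "{}" 0]] by simp

text \<open>Formal wedges computed by \<open>ext\<close> turn into wedges of the differentials
  \<open>th v\<close>. The induction moves the head into the prefix \<open>ws\<close>, which
  therefore has to be arbitrary.\<close>

lemma wedge_map_th:
  assumes "set ws \<subseteq> carrier \<Omega>" "set vs \<subseteq> vecs" and m: "m = length ws + length vs"
  shows "wedge R \<Omega> (ws @ map th vs) =
    psi (E m) (\<lambda>J. wedge R \<Omega> (ws @ dX J)) (length vs) (foldr ext vs (ext_basis {}))"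
  using assms
proof (induction vs arbitrary: ws)
  case Nil
  have "psi (E m) (\<lambda>J. wedge R \<Omega> (ws @ dX J)) 0 (ext_basis {}) = wedge R \<Omega> (ws @ dX {})"
  proof (rule psi_basis[OF E.module_axioms])
    show "wedge R \<Omega> (ws @ dX J) \<in> carrier (E m)" if "J \<in> subs 0" for J
      by (rule wedge_dX_closed[OF Nil(1) that]) (use Nil(3) in simp)
  qed (simp add: subs_def)
  then show ?case by (simp add: dX_def)
next
  case (Cons v vs)
  let ?l = "length vs" and ?\<eta> = "foldr ext vs (ext_basis {})"
  let ?W = "\<lambda>J. wedge R \<Omega> (ws @ dX J)"
  have v: "v \<in> vecs" "set vs \<subseteq> vecs" and m: "m = length ws + Suc ?l" using Cons.prems by auto
  have \<eta>: "?\<eta> \<in> lam ?l" by (rule foldr_ext_basis_lam[OF v(2)])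
  have W: "?W J \<in> carrier (E m)" if "J \<in> subs (Suc ?l)" for J
    by (rule wedge_dX_closed[OF Cons.prems(1) that m])
  note closed = psi_closed[OF E.module_axioms, where W = ?W and l = "Suc ?l", OF W]
  note scale = psi_scale[OF E.module_axioms, where W = ?W and l = "Suc ?l", OF W]
  have vj: "v j \<in> pcarrier n" for j by (rule vecs_pcarrier[OF v(1)])
  have \<eta>J: "?\<eta> J \<in> pcarrier n" for J by (rule lam_pcarrier[OF \<eta>])
  let ?b = "\<lambda>j J'. ext (unit_vec j) (ext_basis J') :: nat set \<Rightarrow> 'k mpoly"
  have b: "?b j J' \<in> lam (Suc ?l)" if "J' \<in> subs ?l" "j \<le> n" for j J'
    using that by (intro ext_lam unit_vec_vecs lam_basis) (auto simp: subs_def)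
  have bp: "?b j J' J \<in> pcarrier n" if "J' \<in> subs ?l" "j \<le> n" for j J' J
    by (rule lam_pcarrier[OF b[OF that]])
  \<comment> \<open>A unit vector against a basis form; here the two sign rules meet.\<close>
  have unit: "psi (E m) ?W (Suc ?l) (?b j J') = wedge R \<Omega> (ws @ dx j # dX J')"
    if J': "J' \<in> subs ?l" and j: "j \<le> n" for j J'
  proof (cases "j \<in> J'")
    case True
    then have "?b j J' = (\<lambda>_. 0)" using ext_unit_basis[OF subs_finite[OF J'], of j, where ?'a = "'k mpoly"] by simp
    moreover have "psi (E m) ?W (Suc ?l) (\<lambda>_. 0) = \<zero>\<^bsub>E m\<^esub>"
      by (rule psi_ideal[OF E.module_axioms W I_0])
    ultimately show ?thesis using wedge_dx_dX[OF Cons.prems(1) j J' m] True by simp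
  next
    case False
    let ?s = "ext_sign j (insert j J') :: 'k mpoly"
    have ins: "insert j J' \<in> subs (Suc ?l)" using J' j False subs_finite[OF J'] by (auto simp: subs_def)
    have "?b j J' = (\<lambda>J. ?s * ext_basis (insert j J') J)"
      using ext_unit_basis[OF subs_finite[OF J'], of j, where ?'a = "'k mpoly"] False by simp
    then have "psi (E m) ?W (Suc ?l) (?b j J') = psi (E m) ?W (Suc ?l) (\<lambda>J. ?s * ext_basis (insert j J') J)"
      by simp
    also have "\<dots> = pr ?s \<odot>\<^bsub>E m\<^esub> psi (E m) ?W (Suc ?l) (ext_basis (insert j J'))"
      by (rule psi_scale[OF E.module_axioms W pcarrier_ext_sign]) (simp_all add: ext_basis_def)
    also have "psi (E m) ?W (Suc ?l) (ext_basis (insert j J')) = ?W (insert j J')"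
      by (rule psi_basis[OF E.module_axioms W ins])
    also have "pr ?s \<odot>\<^bsub>E m\<^esub> ?W (insert j J') = wedge R \<Omega> (ws @ dx j # dX J')"
      using wedge_dx_dX[OF Cons.prems(1) j J' m] False by simp
    finally show ?thesis .
  qed
  have term_cl: "wedge R \<Omega> (ws @ dx j # dX J') \<in> carrier (E m)" if "J' \<in> subs ?l" "j \<le> n" for j J'
    using closed[of "?b j J'", OF _ bp[OF that]] unit[OF that] by simp
  \<comment> \<open>An arbitrary vector against a basis form, by linearity in the coordinates of
    \<open>v\<close>.\<close>
  have inner: "psi (E m) ?W (Suc ?l) (ext v (ext_basis J')) = wedge R \<Omega> (ws @ th v # dX J')"
    if J': "J' \<in> subs ?l" for J'
  proof -
    have "ext v (ext_basis J') = (\<lambda>J. \<Sum>j\<in>{..n}. v j * ?b j J' J)"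
      by (subst vecs_expand[OF v(1)]) (simp only: ext_sum_left ext_scale_left ext_scale_right)
    then have "psi (E m) ?W (Suc ?l) (ext v (ext_basis J')) =
        psi (E m) ?W (Suc ?l) (\<lambda>J. \<Sum>j\<in>{..n}. v j * ?b j J' J)" by simp
    also have "\<dots> = (\<Oplus>\<^bsub>E m\<^esub>j\<in>{..n}. psi (E m) ?W (Suc ?l) (\<lambda>J. v j * ?b j J' J))"
      by (rule psi_sum[OF E.module_axioms W]) (auto intro: vj bp J')
    also have "\<dots> = (\<Oplus>\<^bsub>E m\<^esub>j\<in>{..n}. pr (v j) \<odot>\<^bsub>E m\<^esub> wedge R \<Omega> (ws @ dx j # dX J'))"
    proof (rule E.M.finsum_cong')
      show "psi (E m) ?W (Suc ?l) (\<lambda>J. v j * ?b j J' J) = pr (v j) \<odot>\<^bsub>E m\<^esub> wedge R \<Omega> (ws @ dx j # dX J')"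
        if "j \<in> {..n}" for j
        using scale[of "v j" "?b j J'", OF _ vj bp[OF J']] that unit[OF J'] by simp
    qed (use term_cl[OF J'] vj in auto)
    also have "\<dots> = (\<Oplus>\<^bsub>E m\<^esub>j\<in>{..n}. wedge R \<Omega> (ws @ (pr (v j) \<odot>\<^bsub>\<Omega>\<^esub> dx j) # dX J'))"
    proof (rule E.M.finsum_cong')
      fix j assume "j \<in> {..n}"
      then show "pr (v j) \<odot>\<^bsub>E m\<^esub> wedge R \<Omega> (ws @ dx j # dX J') =
          wedge R \<Omega> (ws @ (pr (v j) \<odot>\<^bsub>\<Omega>\<^esub> dx j) # dX J')"
        using Om.wedge_smult[OF Cons.prems(1), of "dX J'" "pr (v j)" "dx j" m] dX_subs[OF J'] m vj dx_closed
        by (auto simp: tuples_def)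
    next
      show "(\<lambda>j. wedge R \<Omega> (ws @ (pr (v j) \<odot>\<^bsub>\<Omega>\<^esub> dx j) # dX J')) \<in> {..n} \<rightarrow> carrier (E m)"
      proof
        fix j assume j: "j \<in> {..n}"
        have "set (ws @ (pr (v j) \<odot>\<^bsub>\<Omega>\<^esub> dx j) # dX J') \<subseteq> carrier \<Omega>"
          using j Cons.prems(1) dX_subs[OF J'] th_term_closed[OF v(1)] by (auto simp: tuples_def)
        from Om.wedge_closed[OF this] show "wedge R \<Omega> (ws @ (pr (v j) \<odot>\<^bsub>\<Omega>\<^esub> dx j) # dX J') \<in> carrier (E m)"
          using dX_subs[OF J'] m by (simp add: tuples_def)
      qed
    qed simp
    also have "\<dots> = wedge R \<Omega> (ws @ th v # dX J')"
      unfolding th_def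
      by (rule Om.wedge_finsum[symmetric, OF Cons.prems(1)])
        (use dX_subs[OF J'] m th_term_closed[OF v(1)] in \<open>auto simp: tuples_def\<close>)
    finally show ?thesis .
  qed
  have inner_cl: "wedge R \<Omega> (ws @ th v # dX J') \<in> carrier (E m)" if "J' \<in> subs ?l" for J'
    using wedge_dX_closed[of "ws @ [th v]" J' ?l m] that Cons.prems(1) th_closed[OF v(1)] m by auto
  \<comment> \<open>An arbitrary tail: the induction hypothesis applies with the prefix prolonged by
    \<open>th v\<close>, and \<open>?\<eta>\<close> is then recombined from its basis forms.\<close>
  have "wedge R \<Omega> (ws @ map th (v # vs)) = wedge R \<Omega> ((ws @ [th v]) @ map th vs)" by simp
  also have "\<dots> = psi (E m) (\<lambda>J. wedge R \<Omega> ((ws @ [th v]) @ dX J)) ?l ?\<eta>"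
    by (rule Cons.IH) (use Cons.prems th_closed[OF v(1)] in auto)
  also have "\<dots> = (\<Oplus>\<^bsub>E m\<^esub>J'\<in>subs ?l. pr (?\<eta> J') \<odot>\<^bsub>E m\<^esub> wedge R \<Omega> (ws @ th v # dX J'))"
    by (simp add: psi_def)
  also have "\<dots> = (\<Oplus>\<^bsub>E m\<^esub>J'\<in>subs ?l. psi (E m) ?W (Suc ?l) (\<lambda>J. ?\<eta> J' * ext v (ext_basis J') J))"
  proof (rule E.M.finsum_cong')
    fix J' assume J': "J' \<in> subs ?l"
    have ep: "ext v (ext_basis J') J \<in> pcarrier n" for J
      by (rule lam_pcarrier[OF ext_lam[OF v(1) lam_basis]]) (use J' in \<open>auto simp: subs_def\<close>)
    show "pr (?\<eta> J') \<odot>\<^bsub>E m\<^esub> wedge R \<Omega> (ws @ th v # dX J') =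
        psi (E m) ?W (Suc ?l) (\<lambda>J. ?\<eta> J' * ext v (ext_basis J') J)"
      using scale[of "?\<eta> J'" "ext v (ext_basis J')", OF _ \<eta>J ep] inner[OF J'] by simp
  next
    show "(\<lambda>J'. psi (E m) ?W (Suc ?l) (\<lambda>J. ?\<eta> J' * ext v (ext_basis J') J)) \<in> subs ?l \<rightarrow> carrier (E m)"
    proof
      fix J' assume J': "J' \<in> subs ?l"
      have ep: "ext v (ext_basis J') J \<in> pcarrier n" for J
        by (rule lam_pcarrier[OF ext_lam[OF v(1) lam_basis]]) (use J' in \<open>auto simp: subs_def\<close>)
      show "psi (E m) ?W (Suc ?l) (\<lambda>J. ?\<eta> J' * ext v (ext_basis J') J) \<in> carrier (E m)"
        by (rule psi_closed[OF E.module_axioms W]) (auto intro: \<eta>J ep)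
    qed
  qed simp
  also have "\<dots> = psi (E m) ?W (Suc ?l) (\<lambda>J. \<Sum>J'\<in>subs ?l. ?\<eta> J' * ext v (ext_basis J') J)"
  proof (rule psi_sum[symmetric, OF E.module_axioms W finite_subs])
    fix J' J assume J': "J' \<in> subs ?l"
    have "ext v (ext_basis J') J \<in> pcarrier n"
      by (rule lam_pcarrier[OF ext_lam[OF v(1) lam_basis]]) (use J' in \<open>auto simp: subs_def\<close>)
    then show "?\<eta> J' * ext v (ext_basis J') J \<in> pcarrier n" by (intro pcarrier_mult \<eta>J)
  qed
  also have "(\<lambda>J. \<Sum>J'\<in>subs ?l. ?\<eta> J' * ext v (ext_basis J') J) = ext v ?\<eta>"
    by (subst (2) lam_expand[OF \<eta>]) (simp only: ext_sum_right ext_scale_right)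
  finally show ?case by simp
qed

definition Psi :: "nat \<Rightarrow> (nat set \<Rightarrow> 'k mpoly) \<Rightarrow> (('k mpoly set \<Rightarrow> 'k mpoly set) set list \<Rightarrow> 'k mpoly set) set"
  where "Psi m = psi (E m) (\<lambda>J. wedge R \<Omega> (dX J)) m"

lemma wedge_dX: "J \<in> subs m \<Longrightarrow> wedge R \<Omega> (dX J) \<in> carrier (E m)"
  using wedge_dX_closed[of "[]" J m m] by simp

lemma Psi_closed: "(\<And>J. w J \<in> pcarrier n) \<Longrightarrow> Psi m w \<in> carrier (E m)"
  unfolding Psi_def by (rule psi_closed[OF E.module_axioms wedge_dX])

lemma Psi_add: "(\<And>J. v J \<in> pcarrier n) \<Longrightarrow> (\<And>J. w J \<in> pcarrier n) \<Longrightarrow>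
    Psi m (\<lambda>J. v J + w J) = Psi m v \<oplus>\<^bsub>E m\<^esub> Psi m w"
  unfolding Psi_def by (rule psi_add[OF E.module_axioms wedge_dX])

lemma Psi_scale: "p \<in> pcarrier n \<Longrightarrow> (\<And>J. w J \<in> pcarrier n) \<Longrightarrow>
    Psi m (\<lambda>J. p * w J) = pr p \<odot>\<^bsub>E m\<^esub> Psi m w"
  unfolding Psi_def by (rule psi_scale[OF E.module_axioms wedge_dX])

lemma Psi_ideal: "(\<And>J. w J \<in> I) \<Longrightarrow> Psi m w = \<zero>\<^bsub>E m\<^esub>"
  unfolding Psi_def by (rule psi_ideal[OF E.module_axioms wedge_dX])

lemma Psi_sum: "finite A \<Longrightarrow> (\<And>x J. x \<in> A \<Longrightarrow> f x J \<in> pcarrier n) \<Longrightarrow>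
    Psi m (\<lambda>J. \<Sum>x\<in>A. f x J) = (\<Oplus>\<^bsub>E m\<^esub>x\<in>A. Psi m (f x))"
  unfolding Psi_def by (rule psi_sum[OF E.module_axioms wedge_dX])

lemma wedge_th: "set vs \<subseteq> vecs \<Longrightarrow> length vs = m \<Longrightarrow>
    wedge R \<Omega> (map th vs) = Psi m (foldr ext vs (ext_basis {}))"
  using wedge_map_th[of "[]" vs m] by (simp add: Psi_def)

text \<open>Expanding \<open>w\<close> in basis forms reduces this to a wedge whose first entry is
  \<open>th (grad f)\<close>, the differential of the class of \<open>f\<close>, which is
  zero.\<close>

lemma Psi_grad:
  assumes f: "f \<in> I" and w: "w \<in> lam l" shows "Psi (Suc l) (ext (grad f) w) = \<zero>\<^bsub>E (Suc l)\<^esub>"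
proof -
  have g: "grad f \<in> vecs" by (rule grad_vecs[OF I_pcarrier[OF f]])
  have wJ: "w J \<in> pcarrier n" for J by (rule lam_pcarrier[OF w])
  have ep: "ext (grad f) (ext_basis J') J \<in> pcarrier n" if "J' \<in> subs l" for J' J
    by (rule lam_pcarrier[OF ext_lam[OF g lam_basis]]) (use that in \<open>auto simp: subs_def\<close>)
  have z: "Psi (Suc l) (ext (grad f) (ext_basis J')) = \<zero>\<^bsub>E (Suc l)\<^esub>" if J': "J' \<in> subs l" for J'
  proof -
    let ?js = "sorted_list_of_set J'"
    have js: "set ?js = J'" "length ?js = l" using J' subs_finite[OF J'] by (auto simp: subs_def)
    have u: "set (map unit_vec ?js) \<subseteq> vecs" using J' js by (auto simp: subs_def intro!: unit_vec_vecs)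
    have "foldr ext (grad f # map unit_vec ?js) (ext_basis {}) = ext (grad f) (ext_basis J')"
      using foldr_ext_unit[OF strict_sorted_list_of_set, of J', where ?'a = "'k mpoly"] js by simp
    then have "Psi (Suc l) (ext (grad f) (ext_basis J')) = wedge R \<Omega> (map th (grad f # map unit_vec ?js))"
      using wedge_th[of "grad f # map unit_vec ?js" "Suc l"] g u js by simp
    also have "\<dots> = wedge R \<Omega> ([] @ \<zero>\<^bsub>\<Omega>\<^esub> # map th (map unit_vec ?js))" by (simp add: d_ideal[OF f])
    also have "\<dots> = \<zero>\<^bsub>E (Suc l)\<^esub>"
      by (rule Om.wedge_zero) (use u js th_closed in auto)
    finally show ?thesis .
  qed
  have "ext (grad f) w = (\<lambda>J. \<Sum>J'\<in>subs l. w J' * ext (grad f) (ext_basis J') J)"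
    by (subst lam_expand[OF w]) (simp only: ext_sum_right ext_scale_right)
  then have "Psi (Suc l) (ext (grad f) w) =
      Psi (Suc l) (\<lambda>J. \<Sum>J'\<in>subs l. w J' * ext (grad f) (ext_basis J') J)" by simp
  also have "\<dots> = (\<Oplus>\<^bsub>E (Suc l)\<^esub>J'\<in>subs l. Psi (Suc l) (\<lambda>J. w J' * ext (grad f) (ext_basis J') J))"
    by (rule Psi_sum) (auto intro: wJ ep)
  also have "\<dots> = \<zero>\<^bsub>E (Suc l)\<^esub>"
  proof (rule E.M.add.finprod_one_eqI)
    fix J' assume J': "J' \<in> subs l"
    have "Psi (Suc l) (\<lambda>J. w J' * ext (grad f) (ext_basis J') J) =
      pr (w J') \<odot>\<^bsub>E (Suc l)\<^esub> Psi (Suc l) (ext (grad f) (ext_basis J'))"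
      by (rule Psi_scale[OF wJ ep[OF J']])
    then show "Psi (Suc l) (\<lambda>J. w J' * ext (grad f) (ext_basis J') J) = \<zero>\<^bsub>E (Suc l)\<^esub>"
      using z[OF J'] wJ by simp
  qed
  finally show ?thesis .
qed

lemma Psi_extrel: "extrel m w \<Longrightarrow> Psi m w = \<zero>\<^bsub>E m\<^esub>"
proof (induction rule: extrel.induct)
  case (add m v w)
  have "Psi m (v + w) = Psi m v \<oplus>\<^bsub>E m\<^esub> Psi m w"
    unfolding plus_fun_def by (rule Psi_add) (auto intro: lam_pcarrier extrel_lam add)
  then show ?case by (simp only: add.IH E.M.l_zero E.M.zero_closed)
next
  case (zero m) show ?case by (rule Psi_ideal) (rule I_0)
next
  case (ideal w m) then show ?case by (intro Psi_ideal)
next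
  case (grad f w m) then show ?case by (rule Psi_grad)
qed

text \<open>Both maps match basis forms with the wedges of the \<open>dX J\<close>, and
  \<open>Phi\<close> is linear up to relations. This composite bounds the kernel of
  \<open>Psi\<close>; the image is determined later, degree by degree.\<close>

lemma Phi_Psi: assumes w: "w \<in> lam m" shows "X.eqv m (Phi m (Psi m w)) w"
proof -
  have wJ: "w J \<in> pcarrier n" for J by (rule lam_pcarrier[OF w])
  have cl: "pr (w J) \<odot>\<^bsub>E m\<^esub> wedge R \<Omega> (dX J) \<in> carrier (E m)" if "J \<in> subs m" for J
    by (intro E.smult_closed wedge_dX pr_closed wJ that)
  have "X.eqv m (Phi m (\<Oplus>\<^bsub>E m\<^esub>J\<in>A. pr (w J) \<odot>\<^bsub>E m\<^esub> wedge R \<Omega> (dX J)))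
      (\<lambda>J. \<Sum>J'\<in>A. w J' * ext_basis J' J)" if "A \<subseteq> subs m" for A
  proof -
    have "finite A" using that finite_subs finite_subset by blast
    then show ?thesis using that
    proof (induction A rule: finite_induct)
      case empty
      have "(\<lambda>J. \<Sum>J'\<in>{}. w J' * ext_basis J' J) = (\<lambda>_. 0)" by simp
      moreover have "Phi m \<zero>\<^bsub>E m\<^esub> - (\<lambda>_. 0) = Phi m \<zero>\<^bsub>E m\<^esub>" by auto
      ultimately show ?case using Phi_zero[of m] by (simp only: X.eqv_def mem_Collect_eq E.M.finsum_empty)
    next
      case (insert J A)
      let ?t = "\<lambda>J. pr (w J) \<odot>\<^bsub>E m\<^esub> wedge R \<Omega> (dX J)"
      have J: "J \<in> subs m" "J \<subseteq> {..n}" "card J = m" using insert by (auto simp: subs_def)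
      have tA: "?t \<in> A \<rightarrow> carrier (E m)" using cl insert by auto
      have "(\<Oplus>\<^bsub>E m\<^esub>J\<in>insert J A. ?t J) = ?t J \<oplus>\<^bsub>E m\<^esub> (\<Oplus>\<^bsub>E m\<^esub>J\<in>A. ?t J)"
        using insert(1,2) tA cl[OF J(1)] by (rule E.M.finsum_insert)
      then have "X.eqv m (Phi m (\<Oplus>\<^bsub>E m\<^esub>J\<in>insert J A. ?t J)) (Phi m (?t J) + Phi m (\<Oplus>\<^bsub>E m\<^esub>J\<in>A. ?t J))"
        using Phi_add[OF cl[OF J(1)] E.M.finsum_closed[OF tA]] by simp
      also have "X.eqv m \<dots> ((\<lambda>J'. w J * ext_basis J J') + (\<lambda>J'. \<Sum>J''\<in>A. w J'' * ext_basis J'' J'))"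
      proof (rule X.eqv_add)
        show "X.eqv m (Phi m (?t J)) (\<lambda>J'. w J * ext_basis J J')"
          by (rule X.eqv_trans[OF Phi_smult[OF wJ wedge_dX[OF J(1)]] X.eqv_scale[OF wJ Phi_basis[OF J(2,3)]]])
        show "X.eqv m (Phi m (\<Oplus>\<^bsub>E m\<^esub>J\<in>A. ?t J)) (\<lambda>J'. \<Sum>J''\<in>A. w J'' * ext_basis J'' J')"
          by (rule insert.IH) (use insert in auto)
      qed
      also have "(\<lambda>J'. w J * ext_basis J J') + (\<lambda>J'. \<Sum>J''\<in>A. w J'' * ext_basis J'' J') =
          (\<lambda>J'. \<Sum>J''\<in>insert J A. w J'' * ext_basis J'' J')"
        using insert by (auto simp: fun_eq_iff)
      finally show ?case .
    qed
  qed
  from this[OF subset_refl] show ?thesis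
    unfolding Psi_def psi_def using lam_expand[OF w] by simp
qed

text \<open>For the direction not covered by \<open>Psi_extrel\<close>, \<open>Phi\<close> is
  applied: it sends zero to a relation, which is congruent to \<open>w\<close>.\<close>

theorem Psi_zero_iff: assumes "w \<in> lam m" shows "Psi m w = \<zero>\<^bsub>E m\<^esub> \<longleftrightarrow> extrel m w"
proof
  assume "Psi m w = \<zero>\<^bsub>E m\<^esub>"
  then have "X.eqv m (Phi m \<zero>\<^bsub>E m\<^esub>) w" using Phi_Psi[OF assms] by simp
  from X.eqv_mem[OF X.eqv_sym[OF this]] Phi_zero show "extrel m w" by simp
qed (rule Psi_extrel)

end

section \<open>Homogeneous ideals and the hyperplane at infinity\<close>

text \<open>Homogeneity as closure under components, a form that can be checked for colon ideals,
  sums and unions of chains without describing generators.\<close>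

definition hideal :: "nat \<Rightarrow> 'k::field mpoly set \<Rightarrow> bool" where
  "hideal n Q \<longleftrightarrow> Q \<subseteq> pcarrier n \<and> 0 \<in> Q \<and> (\<forall>f\<in>Q. \<forall>g\<in>Q. f + g \<in> Q) \<and>
     (\<forall>p\<in>pcarrier n. \<forall>f\<in>Q. p * f \<in> Q) \<and> (\<forall>f\<in>Q. \<forall>d. hc d f \<in> Q)"

lemma hideal_add: "hideal n Q \<Longrightarrow> f \<in> Q \<Longrightarrow> g \<in> Q \<Longrightarrow> f + g \<in> Q" by (simp add: hideal_def)
lemma hideal_mult: "hideal n Q \<Longrightarrow> p \<in> pcarrier n \<Longrightarrow> f \<in> Q \<Longrightarrow> p * f \<in> Q" by (simp add: hideal_def)
lemma hideal_hc: "hideal n Q \<Longrightarrow> f \<in> Q \<Longrightarrow> hc d f \<in> Q" by (simp add: hideal_def)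
lemma hideal_0: "hideal n Q \<Longrightarrow> 0 \<in> Q" by (simp add: hideal_def)
lemma hideal_pcarrier: "hideal n Q \<Longrightarrow> f \<in> Q \<Longrightarrow> f \<in> pcarrier n" by (auto simp: hideal_def)
lemma hideal_sum: "hideal n Q \<Longrightarrow> (\<And>x. x \<in> A \<Longrightarrow> f x \<in> Q) \<Longrightarrow> (\<Sum>x\<in>A. f x) \<in> Q"
  by (induction A rule: infinite_finite_induct) (auto intro: hideal_0 hideal_add)
lemma hideal_minus:
  fixes f :: "'k::field mpoly"
  assumes "hideal n Q" "f \<in> Q" shows "- f \<in> Q"
proof -
  have "(- 1 :: 'k mpoly) \<in> pcarrier n" by (intro pcarrier_minus pcarrier_1)
  from hideal_mult[OF assms(1) this assms(2)] show ?thesis by simp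
qed
lemma hideal_diff:
  assumes "hideal n Q" "f \<in> Q" "g \<in> Q" shows "f - g \<in> Q"
  using hideal_add[OF assms(1,2) hideal_minus[OF assms(1,3)]] by simp
lemma hideal_mult_right: "hideal n Q \<Longrightarrow> f \<in> Q \<Longrightarrow> p \<in> pcarrier n \<Longrightarrow> f * p \<in> Q"
  using hideal_mult[of n Q p f] by (simp only: mult.commute)

lemma ideal_poly_ringI:
  assumes "Q \<subseteq> pcarrier n" "0 \<in> Q" "\<And>f g. f \<in> Q \<Longrightarrow> g \<in> Q \<Longrightarrow> f + g \<in> Q"
    and mult: "\<And>p f. p \<in> pcarrier n \<Longrightarrow> f \<in> Q \<Longrightarrow> p * f \<in> Q"
  shows "ideal Q (poly_ring n :: 'k::field mpoly ring)"
proof -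
  interpret P: cring "poly_ring n :: 'k mpoly ring" by (rule cring_poly_ring)
  have m: "- f \<in> Q" if "f \<in> Q" for f
  proof -
    have "(- 1 :: 'k mpoly) \<in> pcarrier n" by (intro pcarrier_minus pcarrier_1)
    from mult[OF this that] show ?thesis by simp
  qed
  show ?thesis
  proof (rule idealI[OF P.ring_axioms])
    show "subgroup Q (add_monoid (poly_ring n))"
    proof (rule P.add.subgroupI)
      show "\<ominus>\<^bsub>poly_ring n\<^esub> f \<in> Q" if "f \<in> Q" for f
        using poly_ring_a_inv[of f n] m[OF that] that assms(1) by auto
    qed (use assms in auto)
    show "f \<otimes>\<^bsub>poly_ring n\<^esub> p \<in> Q" if "f \<in> Q" "p \<in> pcarrier n" for f p
      using mult[OF that(2,1)] by (simp add: mult.commute)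
  qed (use mult in auto)
qed

lemma hideal_ideal: "hideal n Q \<Longrightarrow> ideal Q (poly_ring n)"
  by (rule ideal_poly_ringI) (auto simp: hideal_def)

text \<open>In one direction, the elements all of whose components lie in \<open>Q\<close> form an
  ideal containing the homogeneous generators. In the other, an element is the sum of its
  components.\<close>

lemma hideal_iff: "hideal n Q \<longleftrightarrow> homogeneous_ideal n Q" for Q :: "'k::field_char_0 mpoly set"
proof
  interpret P: cring "poly_ring n :: 'k mpoly ring" by (rule cring_poly_ring)
  let ?H = "Q \<inter> (\<Union>s. forms n s)"
  {
    assume h: "homogeneous_ideal n Q"
    then interpret Q: coord_ideal n Q by (simp add: coord_ideal_def homogeneous_ideal_def)
    let ?J = "{f \<in> Q. \<forall>d. hc d f \<in> Q}"
    have "ideal ?J (poly_ring n)"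
      by (rule ideal_poly_ringI)
        (auto simp: hc_mult intro: Q.I_pcarrier Q.I_0 Q.I_add Q.I_mult intro!: Q.I_sum Q.I_mult pcarrier_hc)
    moreover have "?H \<subseteq> ?J" by (auto simp: hc_forms intro: Q.I_0)
    ultimately have "genideal (poly_ring n) ?H \<subseteq> ?J" by (rule P.genideal_minimal)
    then have QJ: "Q \<subseteq> ?J" using h by (simp add: homogeneous_ideal_def)
    show "hideal n Q" unfolding hideal_def
    proof (intro conjI ballI allI)
      show "hc d f \<in> Q" if "f \<in> Q" for f d using QJ that by auto
    qed (auto intro: Q.I_pcarrier Q.I_0 Q.I_add Q.I_mult)
  next
    assume h: "hideal n Q"
    have H: "?H \<subseteq> pcarrier n" using hideal_pcarrier[OF h] by auto
    interpret G: coord_ideal n "genideal (poly_ring n) ?H"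
      by (rule coord_ideal.intro[OF P.genideal_ideal[OF H]])
    have "f \<in> genideal (poly_ring n) ?H" if f: "f \<in> Q" for f
    proof -
      obtain D where "f = (\<Sum>d\<le>D. hc d f)" using sum_hc[of f] by auto
      moreover have "hc d f \<in> genideal (poly_ring n) ?H" for d
        using P.genideal_self[OF H] hideal_hc[OF h f] forms_hc[OF hideal_pcarrier[OF h f]] by blast
      ultimately show ?thesis using G.I_sum by metis
    qed
    moreover have "genideal (poly_ring n) ?H \<subseteq> Q" by (rule P.genideal_minimal[OF hideal_ideal[OF h]]) auto
    ultimately show "homogeneous_ideal n Q"
      unfolding homogeneous_ideal_def using hideal_ideal[OF h] by blast
  }
qed

lemma forms_sum_single: "f = (\<Sum>t\<in>keys f. single t (lookup f t))"
  by (rule poly_mapping_sum_single)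

lemma hc_var_mult: "hc (Suc d) (var i * f) = var i * hc d f" for f :: "'k::field mpoly"
proof -
  have "hc j (var i :: 'k mpoly) = (if j = 1 then var i else 0)" for j
    by (simp add: var_def hc_single)
  then have "hc (Suc d) (var i * f) = (\<Sum>j\<le>Suc d. if j = 1 then var i * hc (Suc d - j) f else 0)"
    unfolding hc_mult by (intro sum.cong) auto
  then show ?thesis by simp
qed

lemma hc_mult_forms:
  assumes "a \<in> forms n (int e)" shows "hc d (p * a) = (if e \<le> d then hc (d - e) p * a else 0)"
proof -
  have "hc d (p * a) = (\<Sum>i\<le>d. if i = d - e \<and> e \<le> d then hc (d - e) p * a else 0)"
    unfolding hc_mult using assms by (intro sum.cong) (auto simp: hc_forms)
  then show ?thesis by simp
qed

lemma hideal_insert: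
  assumes Q: "hideal n Q" and a: "a \<in> forms n (int e)"
  shows "hideal n {q + p * a | q p. q \<in> Q \<and> p \<in> pcarrier n}" (is "hideal n ?J")
  unfolding hideal_def
proof (intro conjI ballI allI)
  have ap: "a \<in> pcarrier n" using a by (rule forms_pcarrier)
  show "?J \<subseteq> pcarrier n" using ap hideal_pcarrier[OF Q] by auto
  show "0 \<in> ?J" using hideal_0[OF Q] by force
  fix f assume "f \<in> ?J"
  then obtain q p where f: "f = q + p * a" "q \<in> Q" "p \<in> pcarrier n" by auto
  show "f + g \<in> ?J" if "g \<in> ?J" for g
  proof -
    from that obtain q' p' where g: "g = q' + p' * a" "q' \<in> Q" "p' \<in> pcarrier n" by auto
    have "f + g = (q + q') + (p + p') * a" unfolding f g by (simp add: algebra_simps)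
    then show ?thesis using hideal_add[OF Q] f g by blast
  qed
  show "g * f \<in> ?J" if "g \<in> pcarrier n" for g
  proof -
    have "g * f = g * q + (g * p) * a" unfolding f by (simp add: algebra_simps)
    then show ?thesis using hideal_mult[OF Q that] f that by blast
  qed
  show "hc d f \<in> ?J" for d
  proof -
    have "hc d f = hc d q + (if e \<le> d then hc (d - e) p else 0) * a"
      unfolding f by (simp add: hc_mult_forms[OF a])
    moreover have "(if e \<le> d then hc (d - e) p else 0) \<in> pcarrier n" using f pcarrier_hc by auto
    ultimately show ?thesis using hideal_hc[OF Q f(2)] by blast
  qed
qed

lemma subset_ideal_insert: "Q \<subseteq> {q + p * a | q p. q \<in> Q \<and> p \<in> pcarrier n}"
proof
  fix q assume "q \<in> Q"
  moreover have "q = q + 0 * a" by simp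
  ultimately show "q \<in> {q + p * a | q p. q \<in> Q \<and> p \<in> pcarrier n}" using pcarrier_0 by blast
qed

lemma mem_ideal_insert: "0 \<in> Q \<Longrightarrow> a \<in> {q + p * a | q p. q \<in> Q \<and> p \<in> pcarrier n}"
proof -
  assume "0 \<in> Q"
  moreover have "a = 0 + 1 * a" by simp
  ultimately show ?thesis using pcarrier_1 by blast
qed

lemma monomial_divide:
  assumes "keys t \<subseteq> {..n}" "e \<le> lookup t i"
  shows "\<exists>p\<in>pcarrier n. single t (c :: 'k::field) = p * var i ^ e"
proof -
  have pw: "var i ^ e = single (single i e) (1 :: 'k)"
    by (induction e) (auto simp: var_def mult_single single_add[symmetric])
  have "t = (t - single i e) + single i e"
    using assms(2) by (intro poly_mapping_eqI) (auto simp: lookup_add lookup_minus lookup_single when_def)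
  then have "single t c = single (t - single i e) c * var i ^ e"
    by (metis pw mult_single mult.right_neutral)
  moreover have "keys (t - single i e) \<subseteq> keys t" by (auto simp: in_keys_iff lookup_minus)
  then have "single (t - single i e) c \<in> pcarrier n"
    using assms(1) by (intro pcarrier_single) auto
  ultimately show ?thesis by blast
qed

text \<open>Pigeonhole on exponents: a monomial whose degree exceeds the sum of the
  \<open>e i\<close> is divisible by \<open>var i ^ e i\<close> for some \<open>i\<close>.\<close>

lemma forms_subset_of_powers:
  assumes Q: "hideal n Q" and pow: "\<And>i. i \<le> n \<Longrightarrow> \<exists>N. var i ^ N \<in> Q"
  shows "\<exists>N. \<forall>d\<ge>N. forms n (int d) \<subseteq> Q"
proof -
  from pow obtain e where e: "\<And>i. i \<le> n \<Longrightarrow> var i ^ e i \<in> Q" by metis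
  have "f \<in> Q" if d: "d \<ge> Suc (\<Sum>i\<le>n. e i)" and f: "f \<in> forms n (int d)" for d f
  proof -
    have "single t (lookup f t) \<in> Q" if t: "t \<in> keys f" for t
    proof -
      have tn: "keys t \<subseteq> {..n}" and td: "mdeg t = d" using f t by (auto simp: forms_iff carrier_poly_ring)
      have "\<exists>i\<le>n. e i \<le> lookup t i"
      proof (rule ccontr)
        assume "\<not> ?thesis"
        then have "(\<Sum>i\<le>n. lookup t i) \<le> (\<Sum>i\<le>n. e i)" by (intro sum_mono) (meson atMost_iff le_cases)
        then show False using d td mdeg_superset[of "{..n}" t] tn by simp
      qed
      then obtain i where "i \<le> n" "e i \<le> lookup t i" by blast
      then show ?thesis using monomial_divide[OF tn] hideal_mult[OF Q _ e] by metis
    qed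
    then have "(\<Sum>t\<in>keys f. single t (lookup f t)) \<in> Q" by (intro hideal_sum[OF Q])
    then show ?thesis using forms_sum_single[of f] by simp
  qed
  then show ?thesis by blast
qed

text \<open>Zorn's lemma among the homogeneous ideals that contain no power of \<open>var i\<close>.
  A maximal one is shown to be prime first for forms and then in general, because only adjoining a
  form is known to keep the ideal homogeneous.\<close>

lemma exists_homogeneous_prime:
  fixes J :: "'k::field_char_0 mpoly set"
  assumes J: "hideal n J" and i: "i \<le> n" and pow: "\<And>N. var i ^ N \<notin> J"
  shows "\<exists>Q. homogeneous_ideal n Q \<and> primeideal Q (poly_ring n) \<and> J \<subseteq> Q \<and> var i \<notin> Q"
proof -
  let ?A = "{Q. hideal n Q \<and> J \<subseteq> Q \<and> (\<forall>N. var i ^ N \<notin> Q)}"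
  have "\<exists>M\<in>?A. \<forall>X\<in>?A. M \<subseteq> X \<longrightarrow> X = M"
  proof (rule subset_Zorn_nonempty)
    show "?A \<noteq> {}" using J pow by blast
    fix C assume C: "C \<noteq> {}" "subset.chain ?A C"
    have CA: "C \<subseteq> ?A" using C(2) by (auto simp: subset.chain_def)
    have "hideal n (\<Union>C)" unfolding hideal_def
    proof (intro conjI ballI allI)
      show "\<Union>C \<subseteq> pcarrier n" using CA hideal_pcarrier by blast
      show "0 \<in> \<Union>C" using C(1) CA hideal_0 by blast
      fix f assume f: "f \<in> \<Union>C"
      then obtain X where X: "X \<in> C" "f \<in> X" "hideal n X" using CA by auto
      show "f + g \<in> \<Union>C" if "g \<in> \<Union>C" for g
      proof -
        obtain Y where Y: "Y \<in> C" "g \<in> Y" "hideal n Y" using CA \<open>g \<in> \<Union>C\<close> by auto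
        have "X \<subseteq> Y \<or> Y \<subseteq> X" using C(2) X Y by (auto simp: subset.chain_def)
        then show ?thesis using hideal_add X Y by blast
      qed
      show "p * f \<in> \<Union>C" if "p \<in> pcarrier n" for p using hideal_mult that X by blast
      show "hc d f \<in> \<Union>C" for d using hideal_hc X by blast
    qed
    then show "\<Union>C \<in> ?A" using C(1) CA by blast
  qed
  then obtain M where MA: "M \<in> ?A" and mx: "\<forall>X\<in>?A. M \<subseteq> X \<longrightarrow> X = M" by (rule bexE)
  have M: "hideal n M" "J \<subseteq> M" and MN: "\<And>N. var i ^ N \<notin> M" using MA by auto
  have max: "X = M" if "hideal n X" "\<And>N. var i ^ N \<notin> X" "M \<subseteq> X" for X
    using mx that M(2) by auto
  \<comment> \<open>If both forms were outside \<open>M\<close>, each enlarged ideal would contain a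
    power of \<open>var i\<close>; the product of these two powers would lie in
    \<open>M\<close>.\<close>
  have homog: False if ab: "a \<in> forms n (int d)" "b \<in> forms n (int e)" "a * b \<in> M" "a \<notin> M" "b \<notin> M" for a b d e
  proof -
    have pw: "\<exists>N q p. var i ^ N = q + p * a \<and> q \<in> M \<and> p \<in> pcarrier n"
      if a: "a \<in> forms n (int d)" "a \<notin> M" for a d
    proof (rule ccontr)
      assume no: "\<not> ?thesis"
      let ?X = "{q + p * a | q p. q \<in> M \<and> p \<in> pcarrier n}"
      have MX: "M \<subseteq> ?X" by (rule subset_ideal_insert)
      have "?X = M"
      proof (rule max[OF hideal_insert[OF M(1) a(1)] _ MX])
        show "var i ^ N \<notin> ?X" for N using no by blast
      qed
      moreover have "a \<in> ?X" by (rule mem_ideal_insert[OF hideal_0[OF M(1)]])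
      ultimately show False using a(2) by blast
    qed
    obtain N q p where 1: "var i ^ N = q + p * a" "q \<in> M" "p \<in> pcarrier n" using pw[OF ab(1,4)] by blast
    obtain N' q' p' where 2: "var i ^ N' = q' + p' * b" "q' \<in> M" "p' \<in> pcarrier n" using pw[OF ab(2,5)] by blast
    have "var i ^ (N + N') = (var i ^ N') * q + (p * a) * q' + (p * p') * (a * b)"
      by (simp add: power_add 1(1) 2(1) algebra_simps)
    also have "\<dots> \<in> M"
      by (intro hideal_add[OF M(1)] hideal_mult[OF M(1)] pcarrier_mult pcarrier_power pcarrier_var i 1 2 ab
          forms_pcarrier[OF ab(1)])
    finally show False using MN by blast
  qed
  have prime: "a \<in> M \<or> b \<in> M" if ab: "a \<in> pcarrier n" "b \<in> pcarrier n" "a * b \<in> M" for a b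
  proof (rule ccontr)
    assume neg: "\<not> ?thesis"
    have ex: "\<exists>d. hc d f \<notin> M" if "f \<notin> M" for f
      using sum_hc[of f] hideal_sum[OF M(1)] that by (metis order_refl)
    \<comment> \<open>The lowest components outside \<open>M\<close> are taken: in degree
      \<open>d + e\<close> of the product every other summand has a factor in
      \<open>M\<close>.\<close>
    obtain d where d: "hc d a \<notin> M" "\<And>l. l < d \<Longrightarrow> hc l a \<in> M"
      using ex[of a] neg exists_least_iff[of "\<lambda>d. hc d a \<notin> M"] by auto
    obtain e where e: "hc e b \<notin> M" "\<And>l. l < e \<Longrightarrow> hc l b \<in> M"
      using ex[of b] neg exists_least_iff[of "\<lambda>d. hc d b \<notin> M"] by auto
    have "hc (d + e) (a * b) = hc d a * hc e b + (\<Sum>l\<in>{..d + e} - {d}. hc l a * hc (d + e - l) b)"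
      unfolding hc_mult by (subst sum.remove[of _ d]) auto
    moreover have "(\<Sum>l\<in>{..d + e} - {d}. hc l a * hc (d + e - l) b) \<in> M"
    proof (rule hideal_sum[OF M(1)])
      fix l assume l: "l \<in> {..d + e} - {d}"
      show "hc l a * hc (d + e - l) b \<in> M"
      proof (cases "l < d")
        case True then show ?thesis
          by (intro hideal_mult_right[OF M(1)] d pcarrier_hc ab)
      next
        case False
        then have "d + e - l < e" using l by auto
        then show ?thesis by (intro hideal_mult[OF M(1)] e pcarrier_hc ab)
      qed
    qed
    moreover have "hc (d + e) (a * b) \<in> M" by (rule hideal_hc[OF M(1) ab(3)])
    ultimately have "hc d a * hc e b \<in> M"
      using hideal_diff[OF M(1), of "hc (d + e) (a * b)" "\<Sum>l\<in>{..d + e} - {d}. hc l a * hc (d + e - l) b"]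
      by simp
    then show False using homog[OF forms_hc[OF ab(1)] forms_hc[OF ab(2)]] d(1) e(1) by blast
  qed
  have "primeideal M (poly_ring n)"
  proof (rule primeidealI[OF hideal_ideal[OF M(1)] cring_poly_ring])
    show "carrier (poly_ring n) \<noteq> M" using MN[of 0] pcarrier_1[of n, where 'a = 'k] by auto
  qed (use prime in auto)
  then show ?thesis using M hideal_iff[of n M] MN[of 1] by auto
qed

lemma forms_Suc_decompose:
  assumes f: "f \<in> forms n s" and s: "s \<ge> 1"
  shows "\<exists>t. (\<forall>i. t i \<in> forms n (s - 1)) \<and> f = (\<Sum>i\<le>n. var i * t i)"
proof -
  have mono: "\<exists>t. (\<forall>i. t i \<in> forms n (s - 1)) \<and> single u c = (\<Sum>i\<le>n. var i * t i)"
    if u: "keys u \<subseteq> {..n}" "int (mdeg u) = s" for u and c :: 'a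
  proof -
    have "u \<noteq> 0" using u s by auto
    then obtain k where k: "k \<in> keys u" by (metis keys_eq_empty ex_in_conv)
    have uk: "u = (u - single k 1) + single k 1"
      using k by (intro poly_mapping_eqI) (auto simp: lookup_add lookup_minus lookup_single when_def in_keys_iff)
    have "keys (u - single k 1) \<subseteq> keys u" by (auto simp: in_keys_iff lookup_minus)
    moreover have "mdeg u = Suc (mdeg (u - single k 1))" by (metis uk mdeg_add mdeg_single Suc_eq_plus1)
    ultimately have "single (u - single k 1) c \<in> forms n (s - 1)"
      using forms_single[of "u - single k 1" n c] u by auto
    moreover have "single u c = var k * single (u - single k 1) c"
      unfolding var_def mult_single using uk by (simp add: add.commute)
    moreover have "(\<Sum>i\<le>n. var i * (if i = k then single (u - single k 1) c else 0)) =
        var k * single (u - single k 1) c"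
    proof -
      have "(\<Sum>i\<le>n. var i * (if i = k then single (u - single k 1) c else 0)) =
          (\<Sum>i\<le>n. if i = k then var k * single (u - single k 1) c else 0)"
        by (intro sum.cong) auto
      then show ?thesis using k u by auto
    qed
    ultimately show ?thesis by (intro exI[of _ "\<lambda>i. if i = k then single (u - single k 1) c else 0"]) auto
  qed
  have "\<exists>t. (\<forall>i. t i \<in> forms n (s - 1)) \<and> (\<Sum>u\<in>T. single u (lookup f u)) = (\<Sum>i\<le>n. var i * t i)"
    if "T \<subseteq> keys f" for T
    using that
  proof (induction T rule: infinite_finite_induct)
    case (insert u T)
    then obtain t where t: "\<And>i. t i \<in> forms n (s - 1)" "(\<Sum>u\<in>T. single u (lookup f u)) = (\<Sum>i\<le>n. var i * t i)" by auto
    obtain t' where t': "\<And>i. t' i \<in> forms n (s - 1)" "single u (lookup f u) = (\<Sum>i\<le>n. var i * t' i)"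
      using mono[of u "lookup f u"] f insert by (auto simp: forms_iff carrier_poly_ring)
    show ?case using insert t t'
      by (intro exI[of _ "\<lambda>i. t' i + t i"]) (auto simp: distrib_left sum.distrib)
  qed (auto intro!: exI[of _ "\<lambda>_. 0"])
  from this[of "keys f"] show ?thesis using poly_mapping_sum_single[of f] by simp
qed

text \<open>The bound in \<open>stable\<close> is not explicit; \<open>regularity_coord\<close>
  later sharpens it to the regularity index.\<close>

locale coord_scheme = coord_ideal n I for n :: nat and I :: "'k::field_char_0 mpoly set" +
  assumes hom: "\<And>f d. f \<in> I \<Longrightarrow> hc d f \<in> I"
    and proper: "1 \<notin> I"
    and nzd: "\<And>f. f \<in> pcarrier n \<Longrightarrow> var 0 * f \<in> I \<Longrightarrow> f \<in> I"
    and stable: "\<exists>N. \<forall>d\<ge>N. \<forall>f\<in>forms n (int d + 1). \<exists>h\<in>forms n (int d). f - var 0 * h \<in> I"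

text \<open>A homogeneous prime over \<open>I\<close> that contains \<open>var 0\<close> but misses
  some variable would be a point on the hyperplane. So a homogeneous ideal containing
  \<open>I\<close> and \<open>var 0\<close> contains all forms of large degree; this is applied to a
  colon ideal and to the sum of \<open>I\<close> and the ideal of \<open>var 0\<close>.\<close>

theorem zero_dim_coord_scheme:
  fixes I :: "'k::field_char_0 mpoly set"
  assumes Z: "zero_dim_scheme n I" and pts: "\<forall>P\<in>scheme_points n I. var 0 \<notin> P"
  shows "coord_scheme n I"
proof -
  have hI: "hideal n I" and sat: "saturated_ideal n I" and ne: "scheme_points n I \<noteq> {}"
    using Z by (auto simp: zero_dim_scheme_def hideal_iff)
  interpret coord_ideal n I by (rule coord_ideal.intro[OF hideal_ideal[OF hI]])
  have v0: "var 0 \<in> pcarrier n" "var 0 \<in> forms n (int 1)" using forms_var[of 0 n] by auto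
  \<comment> \<open>no point of the scheme lies on the hyperplane, so an ideal containing \<open>I\<close> and
    \<open>var 0\<close> contains a power of every variable\<close>
  have pow: "\<exists>N. var i ^ N \<in> J" if J: "hideal n J" "I \<subseteq> J" "var 0 \<in> J" and i: "i \<le> n" for J i
  proof (rule ccontr)
    assume "\<not> ?thesis"
    then obtain Q where "homogeneous_ideal n Q" "primeideal Q (poly_ring n)" "J \<subseteq> Q" "var i \<notin> Q"
      using exists_homogeneous_prime[OF J(1) i] by blast
    then have "Q \<in> scheme_points n I" "var 0 \<in> Q"
      using J i by (auto simp: scheme_points_def)
    then show False using pts by blast
  qed
  show ?thesis
  proof
    show "hc d f \<in> I" if "f \<in> I" for f d using hideal_hc[OF hI that] .
    \<comment> \<open>The scheme is not empty, and any of its points is a proper ideal containing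
      \<open>I\<close>.\<close>
    show "1 \<notin> I"
    proof
      assume one: "1 \<in> I"
      obtain P where P: "primeideal P (poly_ring n)" "I \<subseteq> P" using ne by (auto simp: scheme_points_def)
      interpret P: primeideal P "poly_ring n" by fact
      have "pcarrier n \<subseteq> P" using P.I_l_closed[of 1] one P(2) by auto
      then show False using P.I_notcarr P.a_subset by blast
    qed
    have nzd_form: "f \<in> I" if f: "f \<in> forms n (int e)" "var 0 * f \<in> I" for f e
    proof (rule ccontr)
      assume nf: "f \<notin> I"
      have fp: "f \<in> pcarrier n" using f(1) by (rule forms_pcarrier)
      \<comment> \<open>The colon ideal of \<open>f\<close> contains \<open>I\<close> and, by
        assumption, \<open>var 0\<close>. Hence all forms of some degree multiply \<open>f\<close>
        into \<open>I\<close>, and saturation puts \<open>f\<close> into \<open>I\<close>.\<close>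
      let ?J = "{g \<in> pcarrier n. g * f \<in> I}"
      have J: "hideal n ?J" unfolding hideal_def
      proof (intro conjI ballI allI)
        show "hc d g \<in> ?J" if "g \<in> ?J" for g d
          using that hideal_hc[OF hI, of "g * f" "d + e"] pcarrier_hc
          by (auto simp: hc_mult_forms[OF f(1)])
      qed (auto simp: distrib_right mult.assoc intro: I_0 I_add I_mult)
      have "I \<subseteq> ?J" using fp by (auto intro: I_pcarrier I_mult_right)
      then obtain N where "forms n (int N) \<subseteq> ?J"
        using forms_subset_of_powers[OF J] pow[OF J] v0 f by blast
      then show False using sat fp nf unfolding saturated_ideal_def by blast
    qed
    show "f \<in> I" if f: "f \<in> pcarrier n" "var 0 * f \<in> I" for f
    proof -
      have "hc d f \<in> I" for d
        using nzd_form[OF forms_hc[OF f(1), of d]] hideal_hc[OF hI f(2), of "Suc d"]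
        by (simp add: hc_var_mult)
      moreover obtain D where "f = (\<Sum>d\<le>D. hc d f)" using sum_hc[of f] by auto
      ultimately show ?thesis using I_sum by metis
    qed
    \<comment> \<open>All forms of large degree lie in this sum; comparing components makes the
      cofactor of \<open>var 0\<close> a form of degree one less.\<close>
    let ?J = "{q + p * var 0 | q p. q \<in> I \<and> p \<in> pcarrier n}"
    have J: "hideal n ?J" by (rule hideal_insert[OF hI v0(2)])
    have "I \<subseteq> ?J" by (rule subset_ideal_insert)
    moreover have "var 0 \<in> ?J" by (rule mem_ideal_insert[OF I_0])
    ultimately obtain N where N: "\<And>d. d \<ge> N \<Longrightarrow> forms n (int d) \<subseteq> ?J"
      using forms_subset_of_powers[OF J] pow[OF J] by blast
    show "\<exists>N. \<forall>d\<ge>N. \<forall>f\<in>forms n (int d + 1). \<exists>h\<in>forms n (int d). f - var 0 * h \<in> I"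
    proof (intro exI[of _ N] allI impI ballI)
      fix d and f :: "'k mpoly" assume d: "d \<ge> N" and f: "f \<in> forms n (int d + 1)"
      then have f': "f \<in> forms n (int (Suc d))" by (simp add: add.commute)
      then obtain q p where qp: "f = q + p * var 0" "q \<in> I" "p \<in> pcarrier n"
        using N[of "Suc d"] d by auto
      have "f = hc (Suc d) f" using f' by (simp add: hc_forms)
      also have "\<dots> = hc (Suc d) q + var 0 * hc d p"
        unfolding qp by (simp add: mult.commute[of p] hc_var_mult)
      finally have "f - var 0 * hc d p = hc (Suc d) q" by simp
      then show "\<exists>h\<in>forms n (int d). f - var 0 * h \<in> I"
        using hideal_hc[OF hI qp(2)] forms_hc[OF qp(3)] by metis
    qed
  qed
qed

section \<open>Dimensions and Hilbert functions\<close>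

context vectorspace
begin

text \<open>Independence in \<open>W\<close> agrees with independence in \<open>V\<close>, so the
  sizes of independent sets are bounded and a maximal one is a basis of \<open>W\<close>. If it has
  \<open>dim\<close> elements it is also a basis of \<open>V\<close>.\<close>

lemma subspace_fin_dim_dim:
  assumes fd: "fin_dim" and W: "subspace K W V"
  shows "vectorspace.fin_dim K (vs W)" "vectorspace.dim K (vs W) \<le> dim"
    "vectorspace.dim K (vs W) = dim \<Longrightarrow> W = carrier V"
proof -
  have sub: "LinearCombinations.submodule K W V" using W by simp
  interpret W: vectorspace K "vs W" by (rule subspace_is_vs[OF W])
  have WV: "W \<subseteq> carrier V" using sub by (simp add: LinearCombinations.submodule_def)
  have li: "finite S \<and> card S \<le> dim" if "S \<subseteq> W" "W.lin_indpt S" for S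
    using li_le_dim[OF fd, of S] that WV span_li_not_depend(2)[OF that(1) sub] by auto
  have "W.lin_indpt {}" by (rule W.finite_lin_indpt2) auto
  then obtain A where A: "finite A" "maximal A (\<lambda>S. S \<subseteq> carrier (vs W) \<and> W.lin_indpt S)"
    using maximal_exists[of "\<lambda>S. S \<subseteq> carrier (vs W) \<and> W.lin_indpt S" dim "{}"] li by auto
  then have b: "W.basis A" by (intro W.max_li_is_basis)
  then have AW: "A \<subseteq> W" "W.lin_indpt A" "W.span A = W" by (auto simp: W.basis_def)
  then show "W.fin_dim" using A(1) by (auto simp: W.fin_dim_def)
  have d: "W.dim = card A" by (rule W.dim_basis[OF A(1) b])
  then show "W.dim \<le> dim" using li[OF AW(1,2)] by simp
  show "W = carrier V" if "W.dim = dim"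
  proof -
    have "lin_indpt A" using AW span_li_not_depend(2)[OF AW(1) sub] by simp
    then have "basis A" using dim_li_is_basis[OF fd A(1)] AW(1) WV that d by simp
    then have "carrier V = span A" by (simp add: basis_def)
    also have "span A = W" using AW(3) span_li_not_depend(1)[OF AW(1) sub] by simp
    finally show ?thesis by simp
  qed
qed

lemma dim_zero_carrier:
  assumes "fin_dim" "dim = 0" shows "carrier V = {\<zero>\<^bsub>V\<^esub>}"
proof -
  obtain A where A: "finite A" "basis A" using finite_basis_exists[OF assms(1)] by auto
  then have "A = {}" using dim_basis assms(2) by auto
  then have "span {} = carrier V" using A by (simp add: basis_def)
  then show ?thesis by (simp add: span_empty)
qed

lemma dim_carrier_zero: assumes "carrier V = {\<zero>\<^bsub>V\<^esub>}" shows "dim = 0"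
proof -
  have "lin_indpt {}" by (rule finite_lin_indpt2) auto
  then have "basis {}" using assms by (simp add: basis_def span_empty)
  then show ?thesis using dim_basis[of "{}"] by simp
qed

text \<open>Stated for an indexed family, since distinct indices may give the same vector.\<close>

lemma finsum_in_span:
  assumes "finite B" "\<And>x. x \<in> B \<Longrightarrow> b x \<in> carrier V" "\<And>x. x \<in> B \<Longrightarrow> c x \<in> carrier K"
  shows "(\<Oplus>\<^bsub>V\<^esub>x\<in>B. c x \<odot>\<^bsub>V\<^esub> b x) \<in> span (b ` B)"
proof -
  have bB: "b ` B \<subseteq> carrier V" using assms by auto
  interpret S: LinearCombinations.submodule K "span (b ` B)" V by (rule span_is_submodule[OF bB])
  have b: "b x \<in> span (b ` B)" if "x \<in> B" for x using in_own_span[OF bB] that by auto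
  show ?thesis
  proof -
    have "(\<Oplus>\<^bsub>V\<^esub>x\<in>A. c x \<odot>\<^bsub>V\<^esub> b x) \<in> span (b ` B)" if "A \<subseteq> B" for A
    proof -
      have "finite A" using that assms(1) finite_subset by blast
      then show ?thesis using that
      proof (induction A rule: finite_induct)
        case (insert x A)
        then show ?case using assms b
          by (subst finsum_insert) (auto intro!: S.m_closed S.smult_closed)
      qed simp
    qed
    then show ?thesis by blast
  qed
qed

context
  fixes W :: "'c set" and B :: "'i set" and b :: "'i \<Rightarrow> 'c"
  assumes W: "subspace K W V" and B: "finite B" and b: "\<And>x. x \<in> B \<Longrightarrow> b x \<in> W"
    and gen: "\<And>v. v \<in> W \<Longrightarrow> \<exists>c. (\<forall>x\<in>B. c x \<in> carrier K) \<and> v = (\<Oplus>\<^bsub>V\<^esub>x\<in>B. c x \<odot>\<^bsub>V\<^esub> b x)"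
begin

lemma subspace_family_span: "b ` B \<subseteq> carrier V" "LinearCombinations.module.span K (vs W) (b ` B) = W"
proof -
  have sub: "LinearCombinations.submodule K W V" using W by simp
  interpret sub: LinearCombinations.submodule K W V by (rule sub)
  have bW: "b ` B \<subseteq> W" using b by auto
  show bB: "b ` B \<subseteq> carrier V" using bW sub.subset by auto
  have "W \<subseteq> span (b ` B)"
  proof
    fix v assume "v \<in> W"
    then obtain c where "\<forall>x\<in>B. c x \<in> carrier K" "v = (\<Oplus>\<^bsub>V\<^esub>x\<in>B. c x \<odot>\<^bsub>V\<^esub> b x)" using gen by blast
    then show "v \<in> span (b ` B)" using finsum_in_span[OF B, of b c] bB by auto
  qed
  moreover have "span (b ` B) \<subseteq> W" by (rule span_is_subset[OF bW sub])
  ultimately have "span (b ` B) = W" by blast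
  then show "LinearCombinations.module.span K (vs W) (b ` B) = W" using span_li_not_depend(1)[OF bW sub] by simp
qed

lemma subspace_family_fin_dim: "vectorspace.fin_dim K (vs W)"
proof -
  interpret W: vectorspace K "vs W" by (rule subspace_is_vs[OF W])
  have "b ` B \<subseteq> carrier (vs W)" using b by auto
  then show ?thesis unfolding W.fin_dim_def using subspace_family_span(2) B
    by (intro exI[of _ "b ` B"]) simp
qed

lemma subspace_family_dim:
  assumes inj: "inj_on b B"
    and ind: "\<And>c x. (\<And>x. x \<in> B \<Longrightarrow> c x \<in> carrier K) \<Longrightarrow> (\<Oplus>\<^bsub>V\<^esub>x\<in>B. c x \<odot>\<^bsub>V\<^esub> b x) = \<zero>\<^bsub>V\<^esub> \<Longrightarrow>
      x \<in> B \<Longrightarrow> c x = \<zero>\<^bsub>K\<^esub>"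
  shows "vectorspace.dim K (vs W) = card B"
proof -
  interpret W: vectorspace K "vs W" by (rule subspace_is_vs[OF W])
  have sub: "LinearCombinations.submodule K W V" using W by simp
  note bB = subspace_family_span(1)
  have bW: "b ` B \<subseteq> W" using b by auto
  have "lin_indpt (b ` B)"
  proof (rule finite_lin_indpt2)
    fix a assume a: "a \<in> b ` B \<rightarrow> carrier K" and l: "lincomb a (b ` B) = \<zero>\<^bsub>V\<^esub>"
    have "lincomb a (b ` B) = (\<Oplus>\<^bsub>V\<^esub>x\<in>B. a (b x) \<odot>\<^bsub>V\<^esub> b x)"
      unfolding lincomb_def by (rule finsum_reindex) (use a bB inj in auto)
    then have "a (b x) = \<zero>\<^bsub>K\<^esub>" if "x \<in> B" for x
      using ind[of "\<lambda>x. a (b x)" x] l a that by auto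
    then show "\<forall>v\<in>b ` B. a v = \<zero>\<^bsub>K\<^esub>" by auto
  qed (use B bB in auto)
  then have "W.lin_indpt (b ` B)" using span_li_not_depend(2)[OF bW sub] by simp
  then have "W.basis (b ` B)" using subspace_family_span(2) bW by (simp add: W.basis_def)
  then show ?thesis using W.dim_basis[of "b ` B"] B card_image[OF inj] by simp
qed

end

end

context linear_map
begin

lemma inj_dim_le:
  assumes "V.fin_dim" "W.fin_dim" "inj_on T (carrier V)"
  shows "V.dim \<le> W.dim" "V.dim = W.dim \<Longrightarrow> T ` carrier V = carrier W"
proof -
  have "vectorspace.dim K (W.vs imT) = V.dim"
    using rank_nullity[OF assms(1)] inj_imp_dim_ker0[OF assms(3)] by simp
  then show "V.dim \<le> W.dim" "V.dim = W.dim \<Longrightarrow> T ` carrier V = carrier W"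
    using W.subspace_fin_dim_dim[OF assms(2) imT_is_subspace] by (auto simp: im_def)
qed

text \<open>Rank-nullity; when the dimensions agree the kernel has dimension zero, hence is
  trivial.\<close>

lemma surj_dim_le:
  assumes "V.fin_dim" "T ` carrier V = carrier W"
  shows "W.dim \<le> V.dim" "V.dim = W.dim \<Longrightarrow> inj_on T (carrier V)"
proof -
  have d: "W.dim + vectorspace.dim K (V.vs kerT) = V.dim"
    using rank_nullity[OF assms(1)] surj_imp_imT_carrier[OF assms(2)] by simp
  then show "W.dim \<le> V.dim" by simp
  assume "V.dim = W.dim"
  then have "vectorspace.dim K (V.vs kerT) = 0" using d by simp
  then have "carrier (V.vs kerT) = {\<zero>\<^bsub>V\<^esub>}"
    using vectorspace.dim_zero_carrier[OF V.subspace_is_vs[OF kerT_is_subspace]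
        V.subspace_fin_dim_dim(1)[OF assms(1) kerT_is_subspace]] by simp
  then show "inj_on T (carrier V)" by (rule Ke0_imp_inj)
qed

end

section \<open>Eventually constant functions on the integers: Hilbert polynomial and regularity
  index\<close>

lemma int_Least:
  fixes P :: "int \<Rightarrow> bool"
  assumes "P i" "\<And>j. j < b \<Longrightarrow> \<not> P j"
  shows "P (LEAST i. P i)" "P j \<Longrightarrow> (LEAST i. P i) \<le> j"
proof -
  have b: "j \<ge> b" if "P j" for j using assms(2)[of j] that by linarith
  \<comment> \<open>A least integer exists only thanks to the lower bound \<open>b\<close>; the
    search is shifted to the natural numbers.\<close>
  define l where "l = (LEAST l. P (b + int l))"
  have "P (b + int (nat (i - b)))" using assms(1) b[OF assms(1)] by simp
  then have l: "P (b + int l)" unfolding l_def by (rule LeastI)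
  have le: "b + int l \<le> j" if "P j" for j
  proof -
    have "P (b + int (nat (j - b)))" using that b[OF that] by simp
    then have "l \<le> nat (j - b)" unfolding l_def by (rule Least_le)
    then show ?thesis using b[OF that] by linarith
  qed
  have "(LEAST i. P i) = b + int l" by (rule Least_equality) (use l le in auto)
  then show "P (LEAST i. P i)" "P j \<Longrightarrow> (LEAST i. P i) \<le> j" using l le by auto
qed

text \<open>Uniqueness, needed for the definite description, holds because the difference of two
  candidates would have infinitely many roots.\<close>

lemma hilbert_polynomial_const:
  fixes H :: "int \<Rightarrow> nat"
  assumes "\<And>i. i \<ge> N \<Longrightarrow> H i = c"
  shows "is_hilbert_polynomial H [:of_nat c:]" "hilbert_polynomial H = [:of_nat c:]"
proof -
  show hp: "is_hilbert_polynomial H [:of_nat c:]"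
    unfolding is_hilbert_polynomial_def using assms by (intro exI[of _ N]) auto
  have uniq: "p = [:of_nat c:]" if p: "is_hilbert_polynomial H p" for p
  proof (rule ccontr)
    assume "p \<noteq> [:of_nat c:]"
    then have fin: "finite {x. poly (p - [:of_nat c:]) x = 0}" by (intro poly_roots_finite) simp
    obtain N' where N': "\<And>i. i \<ge> N' \<Longrightarrow> of_nat (H i) = poly p (of_int i)"
      using p unfolding is_hilbert_polynomial_def by auto
    have "of_int ` {max N N'..} \<subseteq> {x. poly (p - [:of_nat c:]) x = 0}"
    proof
      fix x :: rat assume "x \<in> of_int ` {max N N'..}"
      then obtain i where i: "x = of_int i" "i \<ge> N" "i \<ge> N'" by auto
      then show "x \<in> {x. poly (p - [:of_nat c:]) x = 0}" using N'[of i] assms[of i] by simp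
    qed
    then have "finite (of_int ` {max N N'..} :: rat set)" using fin finite_subset by blast
    then have "finite {max N N'..}" by (rule finite_imageD) (simp add: inj_on_def)
    then show False by (simp add: infinite_Ici)
  qed
  show "hilbert_polynomial H = [:of_nat c:]"
    unfolding hilbert_polynomial_def by (rule the_equality, rule hp, rule uniq)
qed

lemma regularity_index_const:
  fixes H :: "int \<Rightarrow> nat"
  assumes "\<And>i. i \<ge> N \<Longrightarrow> H i = c"
  shows "regularity_index H = (if \<forall>j. H j = c then Minf else Fin (LEAST i. \<forall>j\<ge>i. H j = c))"
  using hilbert_polynomial_const(2)[of N H c] assms
  by (simp add: regularity_index_def Let_def)

text \<open>The degree \<open>b\<close>, where the eventual value is missed, rules out
  \<open>Minf\<close> and bounds the regularity index from below.\<close>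

lemma regularity_index_Fin:
  fixes H :: "int \<Rightarrow> nat"
  assumes N: "\<And>i. i \<ge> N \<Longrightarrow> H i = c" and b: "H b \<noteq> c"
  obtains r where "regularity_index H = Fin r" "\<And>i. i \<ge> r \<Longrightarrow> H i = c" "b < r"
proof -
  let ?P = "\<lambda>i. \<forall>j\<ge>i. H j = c"
  have P: "?P N" using N by simp
  have nP: "\<not> ?P j" if "j < b" for j using b that by (auto intro: exI[of _ b])
  have "?P (LEAST i. ?P i)" by (rule int_Least(1)[of ?P N b, OF P nP])
  moreover from this have "b < (LEAST i. ?P i)" using b by (meson not_le)
  moreover have "regularity_index H = Fin (LEAST i. ?P i)"
    using regularity_index_const[of N H c] N b by auto
  ultimately show ?thesis using that by blast
qed

lemma regularity_index_le:
  fixes H :: "int \<Rightarrow> nat"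
  assumes N: "\<And>i. i \<ge> N \<Longrightarrow> H i = c"
  shows "regularity_index H \<le> Fin N"
proof (cases "\<forall>j. H j = c")
  case True
  then show ?thesis using regularity_index_const[of N H c] N by simp
next
  case False
  then obtain b where b: "H b \<noteq> c" by blast
  let ?P = "\<lambda>i. \<forall>j\<ge>i. H j = c"
  have P: "?P N" using N by simp
  have nP: "\<not> ?P j" if "j < b" for j using b that by (auto intro: exI[of _ b])
  have "(LEAST i. ?P i) \<le> N" by (rule int_Least(2)[of ?P N b, OF P nP P])
  then show ?thesis using regularity_index_const[of N H c] N False by simp
qed

text \<open>The least value attained from \<open>N\<close> on cannot be left again once it is
  reached.\<close>

lemma antimono_eventually_const:
  fixes H :: "int \<Rightarrow> nat"
  assumes dec: "\<And>i. i \<ge> N \<Longrightarrow> H (i + 1) \<le> H i"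
  shows "\<exists>N' c. \<forall>i\<ge>N'. H i = c"
proof -
  define c where "c = (LEAST c. \<exists>i\<ge>N. H i = c)"
  have "\<exists>i\<ge>N. H i = c" unfolding c_def by (rule LeastI[of _ "H N"]) auto
  then obtain i0 where i0: "i0 \<ge> N" "H i0 = c" by blast
  have min: "c \<le> H i" if "i \<ge> N" for i
    unfolding c_def by (rule Least_le) (use that in auto)
  have "H i \<le> c" if "i \<ge> i0" for i
    using that
  proof (induction i rule: int_ge_induct)
    case base then show ?case using i0 by simp
  next
    case (step i) then show ?case using dec[of i] i0 by simp
  qed
  then have "\<forall>i\<ge>i0. H i = c" using min i0 by (meson le_antisym order_trans)
  then show ?thesis by blast
qed

section \<open>Counting the monomials of a given degree\<close>

definition monomials :: "nat \<Rightarrow> nat \<Rightarrow> (nat \<Rightarrow>\<^sub>0 nat) set" where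
  "monomials n d = {t. Poly_Mapping.keys t \<subseteq> {..n} \<and> mdeg t = d}"

lemma bij_betw_monomials:
  "bij_betw (\<lambda>t. map (Poly_Mapping.lookup t) [0..<Suc n]) (monomials n d)
    {l. length l = Suc n \<and> sum_list l = d}"
proof (rule bij_betwI')
  have mdeg: "mdeg t = sum_list (map (Poly_Mapping.lookup t) [0..<Suc n])" if "Poly_Mapping.keys t \<subseteq> {..n}" for t
  proof -
    have "sum_list (map (Poly_Mapping.lookup t) [0..<Suc n]) = (\<Sum>i\<in>{..n}. Poly_Mapping.lookup t i)"
      unfolding sum_list_distinct_conv_sum_set[OF distinct_upt] by (intro sum.cong) auto
    then show ?thesis unfolding mdeg_def using that
      by (simp add: sum.mono_neutral_left in_keys_iff)
  qed
  show "(map (Poly_Mapping.lookup s) [0..<Suc n] = map (Poly_Mapping.lookup t) [0..<Suc n]) = (s = t)"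
    if "s \<in> monomials n d" "t \<in> monomials n d" for s t
  proof
    assume eq: "map (Poly_Mapping.lookup s) [0..<Suc n] = map (Poly_Mapping.lookup t) [0..<Suc n]"
    show "s = t"
    proof (rule poly_mapping_eqI)
      fix i
      show "Poly_Mapping.lookup s i = Poly_Mapping.lookup t i"
      proof (cases "i \<le> n")
        case True
        then show ?thesis using eq unfolding map_eq_conv by auto
      next
        case False
        then have "i \<notin> Poly_Mapping.keys s" "i \<notin> Poly_Mapping.keys t"
          using that by (auto simp: monomials_def)
        then show ?thesis by (simp add: in_keys_iff)
      qed
    qed
  qed simp
  show "map (Poly_Mapping.lookup t) [0..<Suc n] \<in> {l. length l = Suc n \<and> sum_list l = d}"
    if "t \<in> monomials n d" for t
    using mdeg[of t] that by (auto simp: monomials_def)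
  show "\<exists>t\<in>monomials n d. l = map (Poly_Mapping.lookup t) [0..<Suc n]"
    if l: "l \<in> {l. length l = Suc n \<and> sum_list l = d}" for l
  proof -
    define t where "t = (\<Sum>i\<in>{..n}. Poly_Mapping.single i (l ! i))"
    have t: "Poly_Mapping.lookup t i = (if i \<le> n then l ! i else 0)" for i
      unfolding t_def by (simp add: lookup_sum lookup_single when_def)
    then have k: "Poly_Mapping.keys t \<subseteq> {..n}" by (auto simp: in_keys_iff split: if_splits)
    have "map (Poly_Mapping.lookup t) [0..<Suc n] = l"
      using l by (intro nth_equalityI) (auto simp: t nth_append simp del: upt_Suc)
    then show ?thesis using k mdeg[OF k] l unfolding monomials_def by (intro bexI[of _ t]) auto
  qed
qed

text \<open>Stars and bars, counting exponent vectors as lists of length \<open>Suc n\<close> with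
  sum \<open>d\<close>.\<close>

lemma card_monomials: "card (monomials n d) = (n + d) choose n"
proof -
  have "card (monomials n d) = (d + Suc n - 1) choose d"
    using bij_betw_same_card[OF bij_betw_monomials] card_length_sum_list[of "Suc n" d] by simp
  also have "\<dots> = (n + d) choose n" using binomial_symmetric[of d "n + d"] by (simp add: add.commute)
  finally show ?thesis .
qed

lemma finite_monomials: "finite (monomials n d)"
proof -
  have "finite {l :: nat list. set l \<subseteq> {..d} \<and> length l = Suc n}" by (rule finite_lists_length_eq) simp
  then have "finite {l :: nat list. length l = Suc n \<and> sum_list l = d}"
    by (rule rev_finite_subset) (auto dest: member_le_sum_list)
  then show ?thesis using bij_betw_finite[OF bij_betw_monomials] by blast
qed

lemma const_minus: "const (- c) = - const c"
  by (simp add: const_def single_uminus)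

lemma const_mult: "const (a * b) = const a * const b"
  by (simp add: const_def mult_single)

lemma const_add: "const (a + b) = const a + const b"
  by (simp add: const_def single_add)

section \<open>Homogeneous relations and the persistence of injectivity\<close>

context coord_scheme
begin

lemma var0: "var 0 \<in> pcarrier n" "var 0 \<in> forms n 1"
  by auto

text \<open>Used for all \<open>d\<close> from the regularity index on, it says that
  \<open>I\<close> needs no new generators in degree \<open>d + 2\<close>.\<close>

lemma ideal_generated:
  assumes r: "\<And>f. f \<in> forms n (int d + 1) \<Longrightarrow> \<exists>h\<in>forms n (int d). f - var 0 * h \<in> I"
    and f: "f \<in> I" "f \<in> forms n (int d + 2)"
  shows "\<exists>u. (\<forall>i. u i \<in> I \<inter> forms n (int d + 1)) \<and> f = (\<Sum>i\<le>n. var i * u i)"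
proof -
  \<comment> \<open>if \<open>f = \<Sum> X\<^sub>i t\<^sub>i\<close> and \<open>t\<^sub>i = x\<^sub>0 q\<^sub>i\<close> modulo \<open>I\<close>, then \<open>g = \<Sum> X\<^sub>i q\<^sub>i\<close> is in \<open>I\<close> since \<open>x\<^sub>0 g\<close> is\<close>
  have s: "int d + 2 - 1 = int d + 1" by simp
  obtain t where t: "\<And>i. t i \<in> forms n (int d + 1)" "f = (\<Sum>i\<le>n. var i * t i)"
    using forms_Suc_decompose[OF f(2), unfolded s] by force
  have "\<exists>q. q \<in> forms n (int d) \<and> t i - var 0 * q \<in> I" for i using r[OF t(1)[of i]] by blast
  then obtain q where q: "\<And>i. q i \<in> forms n (int d)" "\<And>i. t i - var 0 * q i \<in> I" by metis
  define g where "g = (\<Sum>i\<le>n. var i * q i)"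
  have vq: "var i * q i \<in> forms n (int d + 1)" if "i \<le> n" for i
    using forms_mult[OF forms_var[OF that] q(1)[of i]] by (simp add: add.commute)
  have gf: "g \<in> forms n (int d + 1)" unfolding g_def by (intro forms_sum vq) simp
  have v0q: "var 0 * q i \<in> forms n (int d + 1)" for i
    using forms_mult[OF var0(2) q(1)] by (simp add: add.commute)
  have eq: "f - (\<Sum>i\<le>n. var i * (t i - var 0 * q i)) = var 0 * g"
    unfolding g_def t(2) by (simp add: sum_distrib_left sum_subtractf algebra_simps)
  have "(\<Sum>i\<le>n. var i * (t i - var 0 * q i)) \<in> I"
    by (intro I_sum I_mult q pcarrier_var) auto
  from I_diff[OF f(1) this] have "var 0 * g \<in> I" unfolding eq .
  then have g: "g \<in> I" by (rule nzd[OF forms_pcarrier[OF gf]])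
  \<comment> \<open>The leftover \<open>var 0 * g\<close> is absorbed into the coefficient of
    \<open>var 0\<close>.\<close>
  let ?u = "\<lambda>i. t i - var 0 * q i + (if i = 0 then g else 0)"
  have "(\<Sum>i\<le>n. var i * (if i = 0 then g else 0)) = var 0 * g"
    by (simp add: if_distrib[of "\<lambda>x. _ * x"] cong: if_cong)
  then have "(\<Sum>i\<le>n. var i * ?u i) = (\<Sum>i\<le>n. var i * (t i - var 0 * q i)) + var 0 * g"
    by (simp only: distrib_left sum.distrib)
  also have "\<dots> = f" unfolding eq[symmetric] by simp
  finally have "f = (\<Sum>i\<le>n. var i * ?u i)" ..
  moreover have "?u i \<in> I \<inter> forms n (int d + 1)" for i
    using I_add[OF q(2)[of i]] g gf I_0 forms_diff[OF t(1)[of i] v0q[of i]]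
    by (auto intro: forms_add simp: q(2))
  ultimately show ?thesis by (intro exI[of _ ?u] conjI allI)
qed

text \<open>\<open>s\<close> is the degree of the coefficients; as the basis forms have degree
  \<open>m\<close>, the form itself has degree \<open>s + m\<close>.\<close>

definition lamh :: "nat \<Rightarrow> int \<Rightarrow> (nat set \<Rightarrow> 'k mpoly) set" where
  "lamh m s = {w \<in> lam m. \<forall>J. w J \<in> forms n s}"

lemma lamh_lam: "w \<in> lamh m s \<Longrightarrow> w \<in> lam m" by (simp add: lamh_def)
lemma lamh_forms: "w \<in> lamh m s \<Longrightarrow> w J \<in> forms n s" by (simp add: lamh_def)
lemma lamh_zero: "(\<lambda>_. 0) \<in> lamh m s" by (simp add: lamh_def lam_zero)
lemma lamh_add: "v \<in> lamh m s \<Longrightarrow> w \<in> lamh m s \<Longrightarrow> v + w \<in> lamh m s"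
  unfolding lamh_def using lam_add by auto
lemma lamh_sum: "(\<And>x. x \<in> A \<Longrightarrow> f x \<in> lamh m s) \<Longrightarrow> (\<lambda>J. \<Sum>x\<in>A. f x J) \<in> lamh m s"
  unfolding lamh_def using lam_sum[of A f m] by auto
lemma lamh_mult: "p \<in> forms n a \<Longrightarrow> w \<in> lamh m s \<Longrightarrow> (\<lambda>J. p * w J) \<in> lamh m (a + s)"
  unfolding lamh_def using lam_scale[OF forms_pcarrier] forms_mult by blast

lemma ext_lamh:
  assumes "v \<in> vecs" "\<And>j. v j \<in> forms n a" "w \<in> lamh m s"
  shows "ext v w \<in> lamh (Suc m) (a + s)"
proof -
  have "ext_sign j J * v j * w J' \<in> forms n (a + s)" for j J J'
  proof -
    have "ext_sign j J = (const ((- 1) ^ card {i \<in> J. i < j}) :: 'k mpoly)"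
    proof -
      have "const ((- 1) ^ e) = ((- 1) ^ e :: 'k mpoly)" for e
        by (induction e) (auto simp: const_1 const_minus)
      then show ?thesis by (simp add: ext_sign_def)
    qed
    then show ?thesis
      using forms_mult[OF forms_scale[OF assms(2)[of j]] lamh_forms[OF assms(3)]] by simp
  qed
  then have "ext v w J \<in> forms n (a + s)" for J unfolding ext_def by (intro forms_sum)
  with ext_lam[OF assms(1) lamh_lam[OF assms(3)]] show ?thesis by (simp add: lamh_def)
qed

lemma lam_hc: "w \<in> lam m \<Longrightarrow> (\<lambda>J. hc d (w J)) \<in> lamh m (int d)"
proof -
  assume w: "w \<in> lam m"
  have "hc d (w J) \<noteq> 0 \<Longrightarrow> w J \<noteq> 0" for J by auto
  with w show ?thesis unfolding lam_def lamh_def by (blast intro: pcarrier_hc forms_hc)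
qed

text \<open>The relations of coefficient degree \<open>s\<close>, generated by homogeneous data only.\<close>

inductive hrel :: "nat \<Rightarrow> int \<Rightarrow> (nat set \<Rightarrow> 'k mpoly) \<Rightarrow> bool" where
  zero: "hrel m s (\<lambda>_. 0)"
| add: "hrel m s v \<Longrightarrow> hrel m s w \<Longrightarrow> hrel m s (v + w)"
| ideal: "w \<in> lamh m s \<Longrightarrow> (\<And>J. w J \<in> I) \<Longrightarrow> hrel m s w"
| grad: "f \<in> I \<Longrightarrow> f \<in> forms n e \<Longrightarrow> w \<in> lamh m (s + 1 - e) \<Longrightarrow> hrel (Suc m) s (ext (grad f) w)"

lemma hrel_sum: "(\<And>x. x \<in> A \<Longrightarrow> hrel m s (f x)) \<Longrightarrow> hrel m s (\<lambda>J. \<Sum>x\<in>A. f x J)"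
proof (induction A rule: infinite_finite_induct)
  case (insert x A)
  then have "hrel m s (f x + (\<lambda>y. \<Sum>x\<in>A. f x y))" by (intro hrel.add) auto
  with insert show ?case by (simp add: plus_fun_def)
qed (auto intro: hrel.zero)

text \<open>A gradient has degree one less than its polynomial, whence \<open>Suc i\<close>; the
  constant term of \<open>f\<close> has zero gradient and does not occur.\<close>

lemma hc_ext_grad:
  "hc d (ext (grad f) w J) = (\<Sum>i\<le>d. ext (grad (hc (Suc i) f)) (\<lambda>J. hc (d - i) (w J)) J)"
proof -
  have sgn: "hc i (ext_sign j J) = (if i = 0 then ext_sign j J else 0 :: 'k mpoly)" for i j
  proof -
    have "hc i ((- 1) ^ e) = (if i = 0 then (- 1) ^ e else 0 :: 'k mpoly)" for e
    proof (induction e)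
      case 0
      show ?case using hc_single[of i 0 "1::'k"] by simp
    next
      case (Suc e) then show ?case by simp
    qed
    then show ?thesis by (simp add: ext_sign_def)
  qed
  have sp: "hc i (ext_sign j J * p) = ext_sign j J * hc i p" for i j and p :: "'k mpoly"
  proof -
    have "hc i (ext_sign j J * p) = (\<Sum>l\<le>i. if l = 0 then ext_sign j J * hc i p else 0)"
      unfolding hc_mult by (intro sum.cong) (auto simp: sgn)
    then show ?thesis by simp
  qed
  have "hc d (ext (grad f) w J) =
      (\<Sum>j\<in>J. \<Sum>i\<le>d. ext_sign j J * pd j (hc (Suc i) f) * hc (d - i) (w (J - {j})))"
    unfolding ext_def hc_sum
  proof (intro sum.cong refl)
    fix j
    have "hc d (ext_sign j J * grad f j * w (J - {j})) = ext_sign j J * hc d (grad f j * w (J - {j}))"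
      by (simp only: mult.assoc sp)
    also have "\<dots> = (\<Sum>i\<le>d. ext_sign j J * pd j (hc (Suc i) f) * hc (d - i) (w (J - {j})))"
      by (simp add: hc_mult grad_def hc_pd sum_distrib_left mult.assoc)
    finally show "hc d (ext_sign j J * grad f j * w (J - {j})) =
        (\<Sum>i\<le>d. ext_sign j J * pd j (hc (Suc i) f) * hc (d - i) (w (J - {j})))" .
  qed
  then show ?thesis unfolding ext_def grad_def by (simp add: sum.swap[of _ "{..d}"])
qed

text \<open>Components of elements of \<open>I\<close> stay in \<open>I\<close> by
  \<open>hom\<close>, so the components of a generator are sums of homogeneous generators.\<close>

lemma extrel_hrel: "extrel m w \<Longrightarrow> hrel m (int d) (\<lambda>J. hc d (w J))"
proof (induction rule: extrel.induct)
  case (zero m) then show ?case by (simp add: hrel.zero)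
next
  case (add m v w)
  have "(\<lambda>J. hc d ((v + w) J)) = (\<lambda>J. hc d (v J)) + (\<lambda>J. hc d (w J))" by auto
  with add show ?case by (simp only: hrel.add)
next
  case (ideal w m)
  then show ?case by (intro hrel.ideal lam_hc hom)
next
  case (grad f w m)
  have "hrel (Suc m) (int d) (\<lambda>J. \<Sum>i\<le>d. ext (grad (hc (Suc i) f)) (\<lambda>J. hc (d - i) (w J)) J)"
  proof (intro hrel_sum hrel.grad[where e = "int (Suc _)"])
    fix i assume "i \<in> {..d}"
    then have "int d + 1 - int (Suc i) = int (d - i)" by auto
    then show "(\<lambda>J. hc (d - i) (w J)) \<in> lamh m (int d + 1 - int (Suc i))"
      using lam_hc[OF grad(2)] by metis
  next
    show "hc (Suc i) f \<in> I" for i by (rule hom[OF grad(1)])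
    show "hc (Suc i) f \<in> forms n (int (Suc i))" for i by (rule forms_hc[OF I_pcarrier[OF grad(1)]])
  qed
  then show ?case unfolding hc_ext_grad .
qed

lemma hrel_extrel: "hrel m s w \<Longrightarrow> extrel m w"
proof (induction rule: hrel.induct)
  case (add m s v w) then show ?case by (intro extrel.add)
qed (auto intro: extrel.zero extrel.ideal extrel.grad lamh_lam)

lemma hrel_iff_extrel: assumes "w \<in> lamh m (int d)" shows "hrel m (int d) w \<longleftrightarrow> extrel m w"
proof
  assume "extrel m w"
  from extrel_hrel[OF this, of d] show "hrel m (int d) w"
    using hc_forms[OF lamh_forms[OF assms], of d] by simp
qed (rule hrel_extrel)

lemma lamh_Suc_decompose:
  assumes w: "w \<in> lamh m s" and s: "s \<ge> 1"
  shows "\<exists>t. (\<forall>i. t i \<in> lamh m (s - 1)) \<and> w = (\<lambda>J. \<Sum>i\<le>n. var i * t i J)"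
proof -
  \<comment> \<open>Zero coefficients are decomposed by zeros, which keeps the supports inside the
    index sets allowed by \<open>lam\<close>.\<close>
  have "\<exists>t. (\<forall>i. t i \<in> forms n (s - 1)) \<and> w J = (\<Sum>i\<le>n. var i * t i) \<and> (w J = 0 \<longrightarrow> (\<forall>i. t i = 0))" for J
  proof (cases "w J = 0")
    case True then show ?thesis by (intro exI[of _ "\<lambda>_. 0"]) auto
  next
    case False
    with forms_Suc_decompose[OF lamh_forms[OF w, of J] s] show ?thesis by blast
  qed
  then obtain t where t: "\<And>J i. t J i \<in> forms n (s - 1)" "\<And>J. w J = (\<Sum>i\<le>n. var i * t J i)"
    "\<And>J i. w J = 0 \<Longrightarrow> t J i = 0" by metis
  have "(\<lambda>J. t J i) \<in> lamh m (s - 1)" for i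
  proof -
    have "t J i \<noteq> 0 \<Longrightarrow> w J \<noteq> 0" for J using t(3) by blast
    with w t(1) forms_pcarrier[OF t(1)] show ?thesis unfolding lamh_def lam_def by blast
  qed
  then show ?thesis using t(2) by (intro exI[of _ "\<lambda>i J. t J i"]) auto
qed

text \<open>A generator of degree \<open>d + 2\<close> is divided by the variables either in its
  factor \<open>w\<close> or, if \<open>w\<close> is constant, in its element \<open>f\<close> of
  \<open>I\<close>. The second case needs \<open>ideal_generated\<close> one degree higher, which
  explains the degrees in \<open>r\<close>.\<close>

lemma hrel_decompose:
  assumes r: "\<And>f. f \<in> forms n (int d + 2) \<Longrightarrow> \<exists>h\<in>forms n (int d + 1). f - var 0 * h \<in> I"
    and v: "hrel m s v" and s: "s = int d + 2"
  shows "\<exists>u. (\<forall>i\<le>n. u i \<in> lamh m (int d + 1) \<and> extrel m (u i)) \<and> (\<forall>J. v J - (\<Sum>i\<le>n. var i * u i J) \<in> I)"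
  using v s
proof (induction rule: hrel.induct)
  case (zero m s)
  then show ?case by (intro exI[of _ "\<lambda>_ _. 0"]) (auto intro: lamh_zero extrel.zero I_0)
next
  case (add m s v w)
  obtain u where u: "\<And>i. i \<le> n \<Longrightarrow> u i \<in> lamh m (int d + 1) \<and> extrel m (u i)"
    "\<And>J. v J - (\<Sum>i\<le>n. var i * u i J) \<in> I" using add by blast
  obtain u' where u': "\<And>i. i \<le> n \<Longrightarrow> u' i \<in> lamh m (int d + 1) \<and> extrel m (u' i)"
    "\<And>J. w J - (\<Sum>i\<le>n. var i * u' i J) \<in> I" using add by blast
  have "(v + w) J - (\<Sum>i\<le>n. var i * (u i + u' i) J) \<in> I" for J
    using I_add[OF u(2) u'(2), of J J] by (simp add: distrib_left sum.distrib algebra_simps)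
  with u(1) u'(1) show ?case
    by (intro exI[of _ "\<lambda>i. u i + u' i"]) (blast intro: lamh_add extrel.add)
next
  case (ideal w m s)
  then show ?case by (intro exI[of _ "\<lambda>_ _. 0"]) (auto intro: lamh_zero extrel.zero)
next
  case (grad f e w m s)
  have fp: "grad f \<in> vecs" by (rule grad_vecs[OF I_pcarrier[OF grad(1)]])
  consider "s + 1 - e < 0" | "s + 1 - e = 0" | "s + 1 - e \<ge> 1" by linarith
  then show ?case
  \<comment> \<open>The cases concern the coefficient degree of \<open>w\<close>, which must be
    zero, constant or divisible by variables according to its sign.\<close>
  proof cases
    case 1
    have "w J = 0" for J using lamh_forms[OF grad(3), of J] forms_neg[OF 1] by auto
    then have "ext (grad f) w J = 0" for J by (simp add: ext_def)
    then show ?thesis by (intro exI[of _ "\<lambda>_ _. 0"]) (auto intro: lamh_zero extrel.zero I_0)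
  next
    case 2
    \<comment> \<open>With \<open>w\<close> of degree zero the whole degree sits in the gradient:
      \<open>f\<close> has degree \<open>d + 3\<close>.\<close>
    then have e: "e = int (Suc d) + 2" using grad(4) by simp
    obtain u where u: "\<And>i. u i \<in> I" "\<And>i. u i \<in> forms n (int d + 2)" "f = (\<Sum>i\<le>n. var i * u i)"
    proof -
      have n: "int (Suc d) = int d + 1" "int d + 1 + 1 = int d + 2" "int d + 1 + 2 = int d + 3" by auto
      have fm: "f \<in> forms n (int d + 3)" using grad(2) e by (simp add: algebra_simps)
      have "\<exists>u. (\<forall>i. u i \<in> I \<inter> forms n (int d + 2)) \<and> f = (\<Sum>i\<le>n. var i * u i)"
        by (rule ideal_generated[of "Suc d" f, unfolded n, OF r grad(1) fm])
      then obtain v where v: "\<forall>i. v i \<in> I \<inter> forms n (int d + 2)" "f = (\<Sum>i\<le>n. var i * v i)" by blast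
      show ?thesis by (rule that[of v]) (use v in auto)
    qed
    \<comment> \<open>Product rule: besides the \<open>var i * grad (u i)\<close> there are the
      terms \<open>u i * unit_vec i\<close>, which have coefficients in \<open>I\<close>.\<close>
    have gf: "grad f = (\<lambda>j. \<Sum>i\<le>n. (\<lambda>j. var i * grad (u i) j) j + (\<lambda>j. u i * unit_vec i j) j)"
      unfolding u(3) grad_def unit_vec_def
      by (auto simp: fun_eq_iff pd_sum pd_mult pd_var intro!: sum.cong)
    have up: "u i \<in> pcarrier n" for i by (rule I_pcarrier[OF u(1)])
    have "ext (grad f) w = (\<lambda>J. \<Sum>i\<le>n. ext ((\<lambda>j. var i * grad (u i) j) + (\<lambda>j. u i * unit_vec i j)) w J)"
      unfolding gf ext_sum_left[symmetric] plus_fun_def ..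
    then have "ext (grad f) w J - (\<Sum>i\<le>n. var i * ext (grad (u i)) w J) =
        (\<Sum>i\<le>n. u i * ext (unit_vec i) w J)" for J
      unfolding ext_add_left ext_scale_left ext_scale_right by (simp add: sum.distrib)
    moreover have "(\<Sum>i\<le>n. u i * ext (unit_vec i) w J) \<in> I" for J
      by (intro I_sum I_mult_right u lam_pcarrier[OF ext_lam[OF unit_vec_vecs lamh_lam[OF grad(3)]]]) auto
    moreover have "ext (grad (u i)) w \<in> lamh (Suc m) (int d + 1)" for i
    proof -
      have "ext (grad (u i)) w \<in> lamh (Suc m) ((int d + 2 - 1) + (s + 1 - e))"
      proof (rule ext_lamh[OF grad_vecs[OF up] _ grad(3)])
        show "grad (u i) j \<in> forms n (int d + 2 - 1)" for j
          unfolding grad_def by (rule forms_pd[OF u(2)])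
      qed
      moreover have "int d + 2 - 1 + (s + 1 - e) = int d + 1" using 2 by simp
      ultimately show ?thesis by (simp only:)
    qed
    moreover have "extrel (Suc m) (ext (grad (u i)) w)" for i
      by (rule extrel.grad[OF u(1) lamh_lam[OF grad(3)]])
    ultimately show ?thesis by (intro exI[of _ "\<lambda>i. ext (grad (u i)) w"]) auto
  next
    case 3
    \<comment> \<open>Here the variables are taken out of \<open>w\<close>, and the decomposition is
      exact.\<close>
    obtain t where t: "\<And>i. t i \<in> lamh m (s + 1 - e - 1)" "w = (\<lambda>J. \<Sum>i\<le>n. var i * t i J)"
      using lamh_Suc_decompose[OF grad(3) 3] by blast
    have "ext (grad f) (t i) \<in> lamh (Suc m) (int d + 1)" for i
    proof -
      have "ext (grad f) (t i) \<in> lamh (Suc m) ((e - 1) + (s + 1 - e - 1))"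
        by (rule ext_lamh[OF fp _ t(1)]) (auto simp: grad_def intro: forms_pd grad)
      moreover have "(e - 1) + (s + 1 - e - 1) = int d + 1" using grad(4) by simp
      ultimately show ?thesis by (simp only:)
    qed
    moreover have "extrel (Suc m) (ext (grad f) (t i))" for i
      by (rule extrel.grad[OF grad(1) lamh_lam[OF t(1)]])
    moreover have "ext (grad f) w J - (\<Sum>i\<le>n. var i * ext (grad f) (t i) J) = 0" for J
      unfolding t(2) by (simp add: ext_sum_right ext_scale_right)
    ultimately show ?thesis by (intro exI[of _ "\<lambda>i. ext (grad f) (t i)"]) (auto intro: I_0)
  qed
qed

text \<open>Modulo \<open>I\<close> we have \<open>x\<^sub>0 w = \<Sum>\<^sub>i X\<^sub>i u\<^sub>i\<close> with relations \<open>u\<^sub>i = x\<^sub>0 z\<^sub>i\<close>. The \<open>z\<^sub>i\<close> are relations by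
  hypothesis, and \<open>w = \<Sum>\<^sub>i X\<^sub>i z\<^sub>i\<close> because \<open>x\<^sub>0\<close> is a nonzerodivisor.\<close>

lemma injective_step:
  assumes r: "\<And>d f. d \<ge> d0 \<Longrightarrow> f \<in> forms n (int d + 1) \<Longrightarrow> \<exists>h\<in>forms n (int d). f - var 0 * h \<in> I"
    and d: "d \<ge> d0"
    and inj: "\<And>w. w \<in> lamh m (int d) \<Longrightarrow> extrel m (\<lambda>J. var 0 * w J) \<Longrightarrow> extrel m w"
    and w: "w \<in> lamh m (int d + 1)" "extrel m (\<lambda>J. var 0 * w J)"
  shows "extrel m w"
proof -
  have r1: "\<exists>h\<in>forms n (int d + 1). f - var 0 * h \<in> I" if "f \<in> forms n (int d + 2)" for f
    using r[of "Suc d" f] d that by (simp add: algebra_simps)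
  have xw: "(\<lambda>J. var 0 * w J) \<in> lamh m (int d + 2)"
    using lamh_mult[OF var0(2) w(1)] by (simp add: algebra_simps)
  moreover have d2: "int d + 2 = int (d + 2)" by simp
  ultimately have "hrel m (int (d + 2)) (\<lambda>J. var 0 * w J)"
    using w(2) hrel_iff_extrel[of "\<lambda>J. var 0 * w J" m "d + 2"] by (simp only:)
  then obtain u where u: "\<And>i. i \<le> n \<Longrightarrow> u i \<in> lamh m (int d + 1)" "\<And>i. i \<le> n \<Longrightarrow> extrel m (u i)"
    "\<And>J. var 0 * w J - (\<Sum>i\<le>n. var i * u i J) \<in> I"
    using hrel_decompose[OF r1, of m "int (d + 2)" "\<lambda>J. var 0 * w J"] by auto
  have "\<exists>z\<in>lamh m (int d). (\<forall>J. u i J - var 0 * z J \<in> I) \<and> extrel m z" if i: "i \<le> n" for i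
  proof -
    \<comment> \<open>The coefficients of \<open>u i\<close> are divided by \<open>x_0\<close> one
      at a time; keeping zeros makes the result an element of \<open>lam\<close>.\<close>
    have "\<exists>h. h \<in> forms n (int d) \<and> u i J - var 0 * h \<in> I \<and> (u i J = 0 \<longrightarrow> h = 0)" for J
    proof (cases "u i J = 0")
      case True then show ?thesis by (intro exI[of _ 0]) (auto intro: I_0)
    next
      case False
      with r[OF d lamh_forms[OF u(1)[OF i], of J]] show ?thesis by blast
    qed
    then obtain z where z: "\<And>J. z J \<in> forms n (int d)" "\<And>J. u i J - var 0 * z J \<in> I"
      "\<And>J. u i J = 0 \<Longrightarrow> z J = 0" by metis
    have zl: "z \<in> lamh m (int d)"
    proof -
      have "z J \<noteq> 0 \<Longrightarrow> u i J \<noteq> 0" for J using z(3) by blast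
      with u(1)[OF i] z(1) forms_pcarrier[OF z(1)] show ?thesis unfolding lamh_def lam_def by blast
    qed
    have xz: "(\<lambda>J. var 0 * z J) \<in> lam m" by (rule lam_scale[OF var0(1) lamh_lam[OF zl]])
    have neg: "(\<lambda>J. - 1 * (u i J - var 0 * z J)) \<in> lam m"
    proof -
      have "(- 1 :: 'k mpoly) \<in> pcarrier n" by (intro pcarrier_minus pcarrier_1)
      then have "(\<lambda>J. - 1 * u i J) \<in> lam m" by (intro lam_scale lamh_lam[OF u(1)[OF i]])
      from lam_add[OF this xz] show ?thesis by (simp add: plus_fun_def)
    qed
    have "extrel m (\<lambda>J. - 1 * (u i J - var 0 * z J))"
      by (rule extrel.ideal[OF neg]) (use I_minus[OF z(2)] in simp)
    from extrel.add[OF u(2)[OF i] this] have "extrel m (\<lambda>J. var 0 * z J)"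
      by (simp add: plus_fun_def)
    then have "extrel m z" by (rule inj[OF zl])
    with zl z(2) show ?thesis by blast
  qed
  then obtain z where z: "\<And>i. i \<le> n \<Longrightarrow> z i \<in> lamh m (int d)"
    "\<And>i J. i \<le> n \<Longrightarrow> u i J - var 0 * z i J \<in> I" "\<And>i. i \<le> n \<Longrightarrow> extrel m (z i)" by metis
  define y where "y = (\<lambda>J. \<Sum>i\<le>n. var i * z i J)"
  have y: "extrel m y"
  proof -
    interpret X: pmodule n "{w. extrel m w}" by (rule pmodule_extrel)
    have "(\<lambda>J. var i * z i J) \<in> {w. extrel m w}" if "i \<in> {..n}" for i
      using extrel_scale[OF z(3) pcarrier_var, of i i] that by simp
    from X.sum_mem[of "{..n}" "\<lambda>i J. var i * z i J", OF this] show ?thesis unfolding y_def by simp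
  qed
  have yp: "y J \<in> pcarrier n" for J by (rule lam_pcarrier[OF extrel_lam[OF y]])
  have wy: "w J - y J \<in> I" for J
  proof (rule nzd)
    show "w J - y J \<in> pcarrier n" by (intro pcarrier_diff yp forms_pcarrier[OF lamh_forms[OF w(1)]])
    have "var 0 * (w J - y J) = (var 0 * w J - (\<Sum>i\<le>n. var i * u i J)) +
        (\<Sum>i\<le>n. var i * (u i J - var 0 * z i J))"
      unfolding y_def by (simp add: sum_distrib_left sum_subtractf algebra_simps)
    also have "\<dots> \<in> I" by (intro I_add u I_sum I_mult z pcarrier_var) auto
    finally show "var 0 * (w J - y J) \<in> I" .
  qed
  have "(\<lambda>J. w J - y J) \<in> lam m"
  proof -
    have "(- 1 :: 'k mpoly) \<in> pcarrier n" by (intro pcarrier_minus pcarrier_1)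
    then have "(\<lambda>J. - 1 * y J) \<in> lam m" by (intro lam_scale extrel_lam[OF y])
    from lam_add[OF lamh_lam[OF w(1)] this] show ?thesis by (simp add: plus_fun_def)
  qed
  from extrel.add[OF extrel.ideal[OF this wy] y] show ?thesis by (simp add: plus_fun_def)
qed

section \<open>The base field inside the coordinate ring, and the graded pieces over it\<close>

interpretation Om: module R \<Omega> by (rule module_kaehler_module[OF cring_R k_closed])
interpretation E: module R "E m" for m by (rule Om.module_exterior_power)

abbreviation "KR \<equiv> R\<lparr>carrier := k\<rparr>"

lemma k_iff: "a \<in> k \<longleftrightarrow> (\<exists>c. a = pr (const c))"
  by (auto simp: coord_base_def)

lemma k_const [intro]: "pr (const c) \<in> k" by (auto simp: k_iff)

text \<open>The class of \<open>c\<close> is inverted by the class of \<open>inverse c\<close>;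
  since \<open>I\<close> is proper, zero and one remain distinct.\<close>

lemma field_KR: "field KR"
proof -
  have add: "pr (const a) \<oplus>\<^bsub>R\<^esub> pr (const b) = pr (const (a + b))" for a b
    by (simp add: pr_add const_add)
  have mult: "pr (const a) \<otimes>\<^bsub>R\<^esub> pr (const b) = pr (const (a * b))" for a b
    by (simp add: pr_mult const_mult)
  have z: "\<zero>\<^bsub>R\<^esub> = pr (const 0)" and o: "\<one>\<^bsub>R\<^esub> = pr (const 1)" by (simp_all add: R_zero R_one const_0 const_1)
  have c: "cring KR"
  proof (rule cringI)
    show "abelian_group KR"
    proof (rule abelian_groupI)
      fix x assume "x \<in> carrier KR"
      then obtain a where x: "x = pr (const a)" by (auto simp: k_iff)
      have "pr (const (- a)) \<oplus>\<^bsub>R\<^esub> pr (const a) = \<zero>\<^bsub>R\<^esub>" by (simp add: add z)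
      then show "\<exists>y\<in>carrier KR. y \<oplus>\<^bsub>KR\<^esub> x = \<zero>\<^bsub>KR\<^esub>"
        by (intro bexI[of _ "pr (const (- a))"]) (auto simp: x)
    qed (auto simp: k_iff add z ac_simps intro: exI)
    show "comm_monoid KR"
      by (rule comm_monoidI) (auto simp: k_iff mult o ac_simps)
  qed (auto simp: k_iff add mult algebra_simps)
  show ?thesis
  proof (rule cring.cring_fieldI2[OF c])
    show "\<zero>\<^bsub>KR\<^esub> \<noteq> \<one>\<^bsub>KR\<^esub>" using proper pr_zero_iff[of 1] by (auto simp: R_one)
    fix a assume a: "a \<in> carrier KR" "a \<noteq> \<zero>\<^bsub>KR\<^esub>"
    then obtain c where "a = pr (const c)" "c \<noteq> 0" by (auto simp: k_iff z)
    then have "a \<otimes>\<^bsub>KR\<^esub> pr (const (inverse c)) = \<one>\<^bsub>KR\<^esub>" by (simp add: mult o)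
    then show "\<exists>b\<in>carrier KR. a \<otimes>\<^bsub>KR\<^esub> b = \<one>\<^bsub>KR\<^esub>" by (intro bexI[of _ "pr (const (inverse c))"]) auto
  qed
qed

lemma vectorspace_KR:
  assumes "module R M" shows "vectorspace KR M"
proof -
  interpret M: module R M by fact
  interpret KR: field KR by (rule field_KR)
  have kR: "a \<in> carrier R" if "a \<in> k" for a using k_closed that by blast
  have "module KR M"
    by (rule moduleI[OF KR.is_cring M.M.abelian_group_axioms])
      (auto simp: kR M.smult_l_distr M.smult_r_distr M.smult_assoc1)
  then show ?thesis by (simp add: vectorspace_def field_KR)
qed

abbreviation "kpiece \<equiv> kaehler_piece R k (coord_piece n I)"
abbreviation "epiece m \<equiv> exterior_piece R k \<Omega> kpiece m"

text \<open>For \<open>a\<close> of degree \<open>i\<close> and \<open>b\<close> of degree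
  \<open>j\<close>, the coordinates of \<open>a d b\<close> have degree \<open>i + (j - 1)\<close>:
  the unit vectors carry degree one.\<close>

lemma kaehler_piece_th:
  assumes "x \<in> kpiece s"
  shows "\<exists>v\<in>vecs. (\<forall>j. v j \<in> forms n (s - 1)) \<and> x = th v"
proof -
  interpret V: vectorspace KR \<Omega> by (rule vectorspace_KR[OF Om.module_axioms])
  let ?S = "{a \<odot>\<^bsub>\<Omega>\<^esub> d\<^sub>R b | a b i j. a \<in> coord_piece n I i \<and> b \<in> coord_piece n I j \<and> i + j = s}"
  have cp: "\<exists>f\<in>forms n i. a = pr f" if "a \<in> coord_piece n I i" for a i
    using that by (auto simp: coord_piece_def)
  have base: "\<exists>v\<in>vecs. (\<forall>j. v j \<in> forms n (s - 1)) \<and> x = th v" if xS: "x \<in> ?S" for x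
  proof -
    obtain a b i j where ab: "x = a \<odot>\<^bsub>\<Omega>\<^esub> d\<^sub>R b" "a \<in> coord_piece n I i" "b \<in> coord_piece n I j" "i + j = s"
      using xS by blast
    obtain f g where fg: "f \<in> forms n i" "a = pr f" "g \<in> forms n j" "b = pr g" using cp ab by metis
    have p: "f \<in> pcarrier n" "g \<in> pcarrier n" using fg forms_pcarrier by auto
    have "x = th (\<lambda>l. f * grad g l)"
      unfolding ab fg d_pr[OF p(2)] by (rule th_scale[symmetric, OF p(1) grad_vecs[OF p(2)]])
    moreover have "f * grad g l \<in> forms n (s - 1)" for l
    proof -
      have "i + (j - 1) = s - 1" using ab(4) by simp
      with forms_mult[OF fg(1) forms_pd[OF fg(3), of l]] show ?thesis by (simp only: grad_def)
    qed
    ultimately show ?thesis using vecs_scale[OF p(1) grad_vecs[OF p(2)]] by (intro bexI conjI allI)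
  qed
  have S: "?S \<subseteq> carrier \<Omega>"
  proof
    fix x assume "x \<in> ?S"
    from base[OF this] show "x \<in> carrier \<Omega>" using th_closed by auto
  qed
  show ?thesis
  proof (rule V.span_induct[OF S])
    show "x \<in> LinearCombinations.module.span KR \<Omega> ?S" using assms by (simp add: kaehler_piece_def)
    show "\<exists>v\<in>vecs. (\<forall>j. v j \<in> forms n (s - 1)) \<and> \<zero>\<^bsub>\<Omega>\<^esub> = th v"
      using vecs_zero th_zero by (intro bexI[of _ "\<lambda>_. 0"]) auto
    show "\<exists>v\<in>vecs. (\<forall>j. v j \<in> forms n (s - 1)) \<and> x \<oplus>\<^bsub>\<Omega>\<^esub> y = th v"
      if "\<exists>v\<in>vecs. (\<forall>j. v j \<in> forms n (s - 1)) \<and> x = th v"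
         "\<exists>v\<in>vecs. (\<forall>j. v j \<in> forms n (s - 1)) \<and> y = th v" for x y
    proof -
      obtain v w where v: "v \<in> vecs" "\<And>j. v j \<in> forms n (s - 1)" "x = th v"
        and w: "w \<in> vecs" "\<And>j. w j \<in> forms n (s - 1)" "y = th w" using \<open>\<exists>v\<in>vecs. _ \<and> x = _\<close> \<open>\<exists>v\<in>vecs. _ \<and> y = _\<close> by auto
      have "x \<oplus>\<^bsub>\<Omega>\<^esub> y = th (v + w)" using th_add[OF v(1) w(1)] v w by simp
      moreover have "(v + w) j \<in> forms n (s - 1)" for j using v w by auto
      ultimately show ?thesis using vecs_add[OF v(1) w(1)] by (intro bexI[of _ "v + w"] conjI allI)
    qed
    show "\<exists>v\<in>vecs. (\<forall>j. v j \<in> forms n (s - 1)) \<and> a \<odot>\<^bsub>\<Omega>\<^esub> x = th v"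
      if a: "a \<in> carrier KR" and x: "\<exists>v\<in>vecs. (\<forall>j. v j \<in> forms n (s - 1)) \<and> x = th v" for a x
    proof -
      obtain c where c: "a = pr (const c)" using a by (auto simp: k_iff)
      obtain v where v: "v \<in> vecs" "\<And>j. v j \<in> forms n (s - 1)" "x = th v" using x by auto
      have "a \<odot>\<^bsub>\<Omega>\<^esub> x = th (\<lambda>j. const c * v j)" unfolding c v(3) by (rule th_scale[symmetric, OF pcarrier_const v(1)])
      then show ?thesis using vecs_scale[OF pcarrier_const v(1)] forms_scale[OF v(2)]
        by (intro bexI[of _ "\<lambda>j. const c * v j"] conjI allI)
    qed
  qed (use base in auto)
qed

lemma foldr_ext_forms:
  assumes "list_all2 (\<lambda>v d. v \<in> vecs \<and> (\<forall>j. v j \<in> forms n (d - 1))) vs ds"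
  shows "foldr ext vs (ext_basis {}) \<in> lamh (length vs) (sum_list ds - int (length ds))"
  using assms
proof (induction rule: list_all2_induct)
  case Nil
  have "(ext_basis {} J :: 'k mpoly) \<in> forms n 0" for J
    using forms_const[of 1 n] by (auto simp: ext_basis_def const_1)
  then show ?case using lam_basis[of "{}" 0] by (simp add: lamh_def)
next
  case (Cons v vs d ds)
  have "ext v (foldr ext vs (ext_basis {})) \<in>
      lamh (Suc (length vs)) ((d - 1) + (sum_list ds - int (length ds)))"
    by (rule ext_lamh) (use Cons in auto)
  then show ?case by (simp add: algebra_simps)
qed

lemma lamh_pcarrier: "w \<in> lamh m d \<Longrightarrow> w J \<in> pcarrier n"
  by (rule forms_pcarrier[OF lamh_forms])

text \<open>One inclusion writes each factor of a homogeneous wedge as \<open>th\<close> of a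
  homogeneous vector and adds degrees. The other lets the coefficient of a basis form be absorbed by
  one of its factors.\<close>

lemma exterior_piece_eq:
  assumes m: "m \<ge> 1"
  shows exterior_piece_Psi: "epiece m s = Psi m ` lamh m (s - int m)"
    and exterior_piece_submodule: "LinearCombinations.submodule KR (epiece m s) (E m)"
proof -
  interpret V: vectorspace KR "E m" by (rule vectorspace_KR[OF E.module_axioms])
  let ?S = "{wedge R \<Omega> ws | ws ds. length ws = m \<and> length ds = m \<and>
      (\<forall>j<m. ws ! j \<in> kpiece (ds ! j)) \<and> sum_list ds = s}"
  let ?d = "s - int m"
  have base: "x \<in> Psi m ` lamh m ?d" if xS: "x \<in> ?S" for x
  proof -
    obtain ws ds where ws: "x = wedge R \<Omega> ws" "length ws = m" "length ds = m" "sum_list ds = s"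
      "\<And>j. j < m \<Longrightarrow> ws ! j \<in> kpiece (ds ! j)" using xS by blast
    have "\<forall>j<m. \<exists>v. v \<in> vecs \<and> (\<forall>i. v i \<in> forms n (ds ! j - 1)) \<and> ws ! j = th v"
      using kaehler_piece_th[OF ws(5)] by blast
    then obtain v where v: "\<And>j. j < m \<Longrightarrow> v j \<in> vecs \<and> (\<forall>i. v j i \<in> forms n (ds ! j - 1)) \<and> ws ! j = th (v j)"
      by metis
    let ?vs = "map v [0..<m]"
    have "ws = map th ?vs" using ws v by (intro nth_equalityI) auto
    then have "x = wedge R \<Omega> (map th ?vs)" using ws by simp
    also have "\<dots> = Psi m (foldr ext ?vs (ext_basis {}))"
      by (rule wedge_th) (use v in auto)
    finally have "x = Psi m (foldr ext ?vs (ext_basis {}))" .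
    moreover have "foldr ext ?vs (ext_basis {}) \<in> lamh (length ?vs) (sum_list ds - int (length ds))"
      by (rule foldr_ext_forms) (use v ws in \<open>auto simp: list_all2_conv_all_nth\<close>)
    ultimately show ?thesis using ws by auto
  qed
  have S: "?S \<subseteq> carrier (E m)"
  proof
    fix x assume "x \<in> ?S"
    from base[OF this] show "x \<in> carrier (E m)" using Psi_closed lamh_pcarrier by blast
  qed
  have ep: "epiece m s = LinearCombinations.module.span KR (E m) ?S"
    by (simp add: exterior_piece_def)
  show sm: "LinearCombinations.submodule KR (epiece m s) (E m)"
    unfolding ep by (rule V.span_is_submodule[OF S])
  have "epiece m s \<subseteq> Psi m ` lamh m ?d"
  proof
    fix x assume "x \<in> epiece m s"
    then have "x \<in> LinearCombinations.module.span KR (E m) ?S" by (simp only: ep)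
    then show "x \<in> Psi m ` lamh m ?d"
    proof (rule V.span_induct[OF S])
      show "\<zero>\<^bsub>E m\<^esub> \<in> Psi m ` lamh m ?d"
        using Psi_ideal[of "\<lambda>_. 0" m, OF I_0] lamh_zero by (intro image_eqI[of _ _ "\<lambda>_. 0"]) auto
      show "x \<oplus>\<^bsub>E m\<^esub> y \<in> Psi m ` lamh m ?d" if xy: "x \<in> Psi m ` lamh m ?d" "y \<in> Psi m ` lamh m ?d" for x y
      proof -
        obtain v w where vw: "v \<in> lamh m ?d" "x = Psi m v" "w \<in> lamh m ?d" "y = Psi m w" using xy by auto
        have "x \<oplus>\<^bsub>E m\<^esub> y = Psi m (v + w)"
          unfolding vw plus_fun_def by (rule Psi_add[symmetric]) (use vw lamh_pcarrier in auto)
        then show ?thesis using lamh_add[OF vw(1,3)] by (rule image_eqI)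
      qed
      show "a \<odot>\<^bsub>E m\<^esub> x \<in> Psi m ` lamh m ?d" if a: "a \<in> carrier KR" and x: "x \<in> Psi m ` lamh m ?d" for a x
      proof -
        obtain c where c: "a = pr (const c)" using a by (auto simp: k_iff)
        obtain v where v: "v \<in> lamh m ?d" "x = Psi m v" using x by auto
        have "a \<odot>\<^bsub>E m\<^esub> x = Psi m (\<lambda>J. const c * v J)"
          unfolding c v(2) by (rule Psi_scale[symmetric]) (use v lamh_pcarrier in auto)
        moreover have "(\<lambda>J. const c * v J) \<in> lamh m ?d"
          using lamh_mult[OF forms_const v(1), of c] by simp
        ultimately show ?thesis by (rule image_eqI)
      qed
    qed (rule base)
  qed
  moreover have "Psi m ` lamh m ?d \<subseteq> epiece m s"
  proof
    fix x assume "x \<in> Psi m ` lamh m ?d"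
    then obtain w where w: "w \<in> lamh m ?d" "x = Psi m w" by auto
    interpret sub: LinearCombinations.submodule KR "epiece m s" "E m" by (rule sm)
    have t: "pr (w J) \<odot>\<^bsub>E m\<^esub> wedge R \<Omega> (dX J) \<in> epiece m s" if J: "J \<in> subs m" for J
    proof -
      let ?js = "sorted_list_of_set J"
      have js: "set ?js = J" "length ?js = m" using J subs_finite[OF J] by (auto simp: subs_def)
      \<comment> \<open>As \<open>m\<close> is positive there is a first factor \<open>dx j\<close>,
        and it takes the coefficient.\<close>
      then obtain j ks where jis: "?js = j # ks" using m by (cases ?js) auto
      have jn: "j \<le> n" "set ks \<subseteq> {..n}" using js jis J by (auto simp: subs_def)
      have len: "m = Suc (length ks)" using js jis by simp
      \<comment> \<open>The first factor has degree \<open>?d + 1\<close> and each of the other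
        \<open>m - 1\<close> has degree 1, in total \<open>s\<close>.\<close>
      let ?ws = "(pr (w J) \<odot>\<^bsub>\<Omega>\<^esub> dx j) # map dx ks" and ?ds = "(?d + 1) # replicate (length ks) (1 :: int)"
      have "pr (w J) \<odot>\<^bsub>E m\<^esub> wedge R \<Omega> (dX J) = wedge R \<Omega> ?ws"
        using Om.wedge_smult[of "[]" "map dx ks" "pr (w J)" "dx j" m] jn dx_closed lamh_pcarrier[OF w(1)] len
        by (auto simp: dX_def jis)
      moreover have "wedge R \<Omega> ?ws \<in> ?S"
      proof (intro CollectI exI conjI allI impI)
        interpret VO: vectorspace KR \<Omega> by (rule vectorspace_KR[OF Om.module_axioms])
        have gen: "a \<odot>\<^bsub>\<Omega>\<^esub> d\<^sub>R b \<in> kpiece e"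
          if "a \<in> coord_piece n I i" "b \<in> coord_piece n I i'" "i + i' = e" for a b i i' e
        proof -
          let ?T = "{a \<odot>\<^bsub>\<Omega>\<^esub> d\<^sub>R b | a b i j. a \<in> coord_piece n I i \<and> b \<in> coord_piece n I j \<and> i + j = e}"
          have "?T \<subseteq> carrier \<Omega>"
            by (auto simp: coord_piece_def intro!: Om.smult_closed d_closed pr_closed dest: forms_pcarrier)
          from VO.in_own_span[OF this] show ?thesis unfolding kaehler_piece_def using that by blast
        qed
        have cx: "pr (var i) \<in> coord_piece n I 1" if "i \<le> n" for i
          using forms_var[OF that] by (auto simp: coord_piece_def)
        have c1: "pr 1 \<in> coord_piece n I 0"
          using forms_const[of 1 n] by (auto simp: coord_piece_def const_1)
        have dxp: "dx i \<in> kpiece 1" if "i \<le> n" for i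
          using gen[OF c1 cx[OF that], of 1] dx_closed[OF that] by (simp add: R_one[symmetric])
        have cw: "pr (w J) \<in> coord_piece n I ?d" using lamh_forms[OF w(1)] by (auto simp: coord_piece_def)
        show "?ws ! l \<in> kpiece (?ds ! l)" if "l < m" for l
        proof (cases l)
          case 0 then show ?thesis using gen[OF cw cx[OF jn(1)], of "?d + 1"] by simp
        next
          case (Suc l')
          then have l': "l' < length ks" using that len by simp
          then have "ks ! l' \<le> n" using jn(2) nth_mem by blast
          from dxp[OF this] show ?thesis using l' Suc by simp
        qed
      qed (use len in \<open>auto simp: sum_list_replicate\<close>)
      ultimately show ?thesis unfolding ep using V.in_own_span[OF S] by auto
    qed
    have "(\<Oplus>\<^bsub>E m\<^esub>J\<in>A. pr (w J) \<odot>\<^bsub>E m\<^esub> wedge R \<Omega> (dX J)) \<in> epiece m s" if "A \<subseteq> subs m" for A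
    proof -
      have "finite A" using that finite_subs finite_subset by blast
      then show ?thesis using that
      proof (induction A rule: finite_induct)
        case (insert J A)
        have cl: "pr (w J) \<odot>\<^bsub>E m\<^esub> wedge R \<Omega> (dX J) \<in> carrier (E m)" if "J \<in> subs m" for J
          using t[OF that] sub.subset by blast
        have "(\<Oplus>\<^bsub>E m\<^esub>J\<in>insert J A. pr (w J) \<odot>\<^bsub>E m\<^esub> wedge R \<Omega> (dX J)) =
            (pr (w J) \<odot>\<^bsub>E m\<^esub> wedge R \<Omega> (dX J)) \<oplus>\<^bsub>E m\<^esub>
            (\<Oplus>\<^bsub>E m\<^esub>J\<in>A. pr (w J) \<odot>\<^bsub>E m\<^esub> wedge R \<Omega> (dX J))"
          by (rule E.M.finsum_insert) (use insert cl in auto)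
        then show ?case using insert t sub.m_closed by auto
      qed (use sub.zero_closed in simp)
    qed
    then show "x \<in> epiece m s" unfolding w(2) Psi_def psi_def by blast
  qed
  ultimately show "epiece m s = Psi m ` lamh m ?d" by blast
qed

end

lemma forms_expand:
  assumes "f \<in> forms n (int d)"
  shows "f = (\<Sum>t\<in>monomials n d. const (lookup f t) * single t 1)"
proof -
  have "f = (\<Sum>t\<in>keys f. single t (lookup f t))" by (rule poly_mapping_sum_single)
  also have "\<dots> = (\<Sum>t\<in>monomials n d. single t (lookup f t))"
    using assms by (intro sum.mono_neutral_left finite_monomials)
      (auto simp: forms_iff carrier_poly_ring monomials_def in_keys_iff)
  finally show ?thesis by (simp add: const_def mult_single)
qed

lemma (in module) module_self: "module R (self_module R)"
  by (rule module_criteria) (auto simp: self_module_def R.a_ac R.m_ac R.l_distr R.r_distr is_cring intro: R.r_neg)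

text \<open>The multiplier \<open>a\<close> is any element of \<open>R\<close>, while linearity is
  over the smaller \<open>k\<close>; commutativity of \<open>R\<close> lets the two scalars be
  exchanged.\<close>

lemma linear_map_smult:
  fixes R :: "('a, 'c) ring_scheme" and M :: "('a, 'b, 'd) module_scheme"
  assumes M: "module R M" and a: "a \<in> carrier R" and k: "k \<subseteq> carrier R"
    and V: "vectorspace (R\<lparr>carrier := k\<rparr>) (M\<lparr>carrier := V\<rparr>)"
    and W: "vectorspace (R\<lparr>carrier := k\<rparr>) (M\<lparr>carrier := W\<rparr>)"
    and VM: "V \<subseteq> carrier M" and im: "\<And>v. v \<in> V \<Longrightarrow> a \<odot>\<^bsub>M\<^esub> v \<in> W"
  shows "linear_map (R\<lparr>carrier := k\<rparr>) (M\<lparr>carrier := V\<rparr>) (M\<lparr>carrier := W\<rparr>) (\<lambda>v. a \<odot>\<^bsub>M\<^esub> v)"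
proof -
  interpret module R M by fact
  have "a \<odot>\<^bsub>M\<^esub> (c \<odot>\<^bsub>M\<^esub> v) = c \<odot>\<^bsub>M\<^esub> (a \<odot>\<^bsub>M\<^esub> v)" if "c \<in> k" "v \<in> V" for c v
  proof -
    have cv: "c \<in> carrier R" "v \<in> carrier M" using that k VM by auto
    show ?thesis using smult_assoc1[OF a cv] smult_assoc1[OF cv(1) a cv(2)] R.m_comm[OF a cv(1)] by simp
  qed
  moreover have "a \<odot>\<^bsub>M\<^esub> (v \<oplus>\<^bsub>M\<^esub> w) = a \<odot>\<^bsub>M\<^esub> v \<oplus>\<^bsub>M\<^esub> a \<odot>\<^bsub>M\<^esub> w" if "v \<in> V" "w \<in> V" for v w
    using smult_r_distr[OF a] that VM by auto
  ultimately have "(\<lambda>v. a \<odot>\<^bsub>M\<^esub> v) \<in> module_hom (R\<lparr>carrier := k\<rparr>) (M\<lparr>carrier := V\<rparr>) (M\<lparr>carrier := W\<rparr>)"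
    using im by (auto simp: module_hom_def)
  then show ?thesis using V W
    by (auto simp: linear_map_def mod_hom_def mod_hom_axioms_def vectorspace_def)
qed

section \<open>The Hilbert function of the coordinate ring\<close>

context coord_scheme
begin

interpretation Om: module R \<Omega> by (rule module_kaehler_module[OF cring_R k_closed])
interpretation E: module R "E m" for m by (rule Om.module_exterior_power)

lemma pr_var0 [simp]: "pr (var 0) \<in> carrier R" by (rule pr_closed[OF var0(1)])

text \<open>Surjectivity of \<open>x_0\<close> from degree \<open>d\<close> to \<open>d + 1\<close>
  of \<open>R\<close>, phrased with representatives so that it applies to coefficients of exterior
  forms.\<close>

definition surj_at :: "nat \<Rightarrow> bool" where
  "surj_at d \<longleftrightarrow> (\<forall>f\<in>forms n (int d + 1). \<exists>h\<in>forms n (int d). f - var 0 * h \<in> I)"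

lemma surj_atD: "surj_at d \<Longrightarrow> f \<in> forms n (int d + 1) \<Longrightarrow> \<exists>h\<in>forms n (int d). f - var 0 * h \<in> I"
  by (simp add: surj_at_def)

abbreviation "SR \<equiv> self_module R"

lemma module_SR: "module R SR" by (rule Om.module_self)

lemma SR_simps: "carrier SR = carrier R" "a \<odot>\<^bsub>SR\<^esub> b = a \<otimes>\<^bsub>R\<^esub> b" "a \<oplus>\<^bsub>SR\<^esub> b = a \<oplus>\<^bsub>R\<^esub> b" "\<zero>\<^bsub>SR\<^esub> = \<zero>\<^bsub>R\<^esub>"
  by (simp_all add: self_module_def)

abbreviation "cpiece \<equiv> coord_piece n I"

lemma cpiece_iff: "a \<in> cpiece s \<longleftrightarrow> (\<exists>f\<in>forms n s. a = pr f)"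
  by (auto simp: coord_piece_def)

lemma cpiece_closed: "cpiece s \<subseteq> carrier SR"
proof
  fix a assume "a \<in> cpiece s"
  then obtain f where f: "f \<in> forms n s" "a = pr f" unfolding cpiece_iff by blast
  show "a \<in> carrier SR" unfolding SR_simps f(2) by (rule pr_closed[OF forms_pcarrier[OF f(1)]])
qed

interpretation SR: vectorspace KR SR by (rule vectorspace_KR[OF module_SR])

lemma subspace_cpiece: "subspace KR (cpiece s) SR"
proof -
  have "LinearCombinations.submodule KR (cpiece s) SR"
  proof (rule LinearCombinations.submodule.intro)
    show "module KR SR" by unfold_locales
    show "cpiece s \<subseteq> carrier SR" by (rule cpiece_closed)
    show "\<zero>\<^bsub>SR\<^esub> \<in> cpiece s" unfolding cpiece_iff SR_simps R_zero by (intro bexI[of _ 0]) auto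
    show "v \<oplus>\<^bsub>SR\<^esub> w \<in> cpiece s" if v: "v \<in> cpiece s" and w: "w \<in> cpiece s" for v w
    proof -
      obtain f g where "f \<in> forms n s" "v = pr f" "g \<in> forms n s" "w = pr g" using v w by (auto simp: cpiece_iff)
      then show ?thesis unfolding cpiece_iff SR_simps
        by (intro bexI[of _ "f + g"]) (auto simp: pr_add forms_pcarrier)
    qed
    show "c \<odot>\<^bsub>SR\<^esub> v \<in> cpiece s" if c: "c \<in> carrier KR" and v: "v \<in> cpiece s" for c v
    proof -
      obtain f a where "f \<in> forms n s" "v = pr f" "c = pr (const a)" using c v by (auto simp: cpiece_iff k_iff)
      then show ?thesis unfolding cpiece_iff SR_simps
        by (intro bexI[of _ "const a * f"]) (auto simp: pr_mult forms_pcarrier forms_scale)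
    qed
  qed
  then show ?thesis by (simp add: subspace_def SR.vectorspace_axioms)
qed

abbreviation "VC s \<equiv> SR\<lparr>carrier := cpiece s\<rparr>"

lemma vectorspace_VC: "vectorspace KR (VC s)"
  by (rule SR.subspace_is_vs[OF subspace_cpiece])

lemma HF_coord_eq: "HF_coord n I s = vectorspace.dim KR (VC s)"
  by (simp add: HF_coord_def hilbert_function_def)

lemma cpiece_neg: "s < 0 \<Longrightarrow> cpiece s = {\<zero>\<^bsub>R\<^esub>}"
  by (simp add: coord_piece_def forms_neg R_zero)

lemma HF_coord_neg: "s < 0 \<Longrightarrow> HF_coord n I s = 0"
  unfolding HF_coord_eq by (rule vectorspace.dim_carrier_zero[OF vectorspace_VC]) (simp add: cpiece_neg SR_simps)

lemma pr_sum:
  assumes "finite A" "\<And>x. x \<in> A \<Longrightarrow> f x \<in> pcarrier n"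
  shows "pr (\<Sum>x\<in>A. f x) = (\<Oplus>\<^bsub>SR\<^esub>x\<in>A. pr (f x))"
  using assms
proof (induction A rule: finite_induct)
  case empty then show ?case by (simp add: R_zero[symmetric] SR_simps)
next
  case (insert x A)
  then show ?case
    by (subst SR.finsum_insert) (auto simp: SR_simps pr_add[symmetric] pcarrier_sum)
qed

lemma fin_dim_VC: "vectorspace.fin_dim KR (VC s)"
proof (cases "s < 0")
  case True
  interpret V: vectorspace KR "VC s" by (rule vectorspace_VC)
  show ?thesis unfolding V.fin_dim_def using True
    by (intro exI[of _ "{}"] conjI) (use V.span_empty in \<open>simp_all add: cpiece_neg SR_simps\<close>)
next
  case False
  then obtain d where s: "s = int d" by (metis nonneg_int_cases not_less)
  show ?thesis
  proof (rule SR.subspace_family_fin_dim[OF subspace_cpiece finite_monomials[of n d], where b = "\<lambda>t. pr (single t 1)"])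
    show "pr (single t 1) \<in> cpiece s" if "t \<in> monomials n d" for t
      using forms_single[of t n 1] that s by (auto simp: cpiece_iff monomials_def)
    fix v assume "v \<in> cpiece s"
    then obtain f where f: "f \<in> forms n (int d)" "v = pr f" by (auto simp: cpiece_iff s)
    have sp: "single t 1 \<in> pcarrier n" if "t \<in> monomials n d" for t
      using that by (intro pcarrier_single) (auto simp: monomials_def)
    have "v = (\<Oplus>\<^bsub>SR\<^esub>t\<in>monomials n d. pr (const (lookup f t) * single t 1))"
      unfolding f(2) by (subst forms_expand[OF f(1)], rule pr_sum) (auto intro: finite_monomials sp)
    also have "\<dots> = (\<Oplus>\<^bsub>SR\<^esub>t\<in>monomials n d. pr (const (lookup f t)) \<odot>\<^bsub>SR\<^esub> pr (single t 1))"
      by (rule SR.finsum_cong') (auto simp: SR_simps pr_mult sp)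
    finally show "\<exists>c. (\<forall>t\<in>monomials n d. c t \<in> carrier KR) \<and>
        v = (\<Oplus>\<^bsub>SR\<^esub>t\<in>monomials n d. c t \<odot>\<^bsub>SR\<^esub> pr (single t 1))"
      by (intro exI[of _ "\<lambda>t. pr (const (lookup f t))"]) auto
  qed
qed

lemma linear_map_VC: "linear_map KR (VC s) (VC (s + 1)) (\<lambda>v. pr (var 0) \<odot>\<^bsub>SR\<^esub> v)"
proof (rule linear_map_smult[OF module_SR pr_var0 k_closed vectorspace_VC vectorspace_VC])
  show "cpiece s \<subseteq> carrier SR" by (rule cpiece_closed)
  fix v assume "v \<in> cpiece s"
  then obtain f where f: "f \<in> forms n s" "v = pr f" by (auto simp: cpiece_iff)
  have "var 0 * f \<in> forms n (s + 1)" using forms_mult[OF var0(2) f(1)] by (simp only: add.commute)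
  then show "pr (var 0) \<odot>\<^bsub>SR\<^esub> v \<in> cpiece (s + 1)"
    unfolding cpiece_iff SR_simps f(2) pr_mult[OF var0(1) forms_pcarrier[OF f(1)]] by blast
qed

lemma inj_VC: "inj_on (\<lambda>v. pr (var 0) \<odot>\<^bsub>SR\<^esub> v) (cpiece s)"
proof (rule inj_onI)
  fix v w assume vw: "v \<in> cpiece s" "w \<in> cpiece s" "pr (var 0) \<odot>\<^bsub>SR\<^esub> v = pr (var 0) \<odot>\<^bsub>SR\<^esub> w"
  then obtain f g where fg: "f \<in> forms n s" "v = pr f" "g \<in> forms n s" "w = pr g" by (auto simp: cpiece_iff)
  have p: "f \<in> pcarrier n" "g \<in> pcarrier n" using fg forms_pcarrier by auto
  have "pr (var 0 * f) = pr (var 0 * g)" using vw(3) unfolding fg SR_simps by (simp add: pr_mult var0(1) p)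
  then have "var 0 * f - var 0 * g \<in> I"
    using pr_eq_iff[OF pcarrier_mult[OF var0(1) p(1)] pcarrier_mult[OF var0(1) p(2)]] by simp
  then have "var 0 * (f - g) \<in> I" by (simp only: right_diff_distrib)
  then have "f - g \<in> I" by (rule nzd[OF pcarrier_diff[OF p]])
  then show "v = w" unfolding fg using pr_eq_iff[OF p] by simp
qed

lemma HF_coord_mono: "HF_coord n I s \<le> HF_coord n I (s + 1)"
  unfolding HF_coord_eq
  by (rule linear_map.inj_dim_le(1)[OF linear_map_VC fin_dim_VC fin_dim_VC]) (simp add: inj_VC)

lemma image_VC_iff: "(\<lambda>v. pr (var 0) \<odot>\<^bsub>SR\<^esub> v) ` cpiece (int d) = cpiece (int d + 1) \<longleftrightarrow> surj_at d"
proof -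
  let ?T = "\<lambda>v. pr (var 0) \<odot>\<^bsub>SR\<^esub> v"
  have sub: "?T ` cpiece (int d) \<subseteq> cpiece (int d + 1)"
    using mod_hom.f_im[OF linear_map.axioms(3)[OF linear_map_VC[of "int d"]]] by auto
  have T: "pr f \<in> ?T ` cpiece (int d) \<longleftrightarrow> (\<exists>h\<in>forms n (int d). f - var 0 * h \<in> I)"
    if f: "f \<in> forms n (int d + 1)" for f
  proof -
    have "pr f \<in> ?T ` cpiece (int d) \<longleftrightarrow> (\<exists>h\<in>forms n (int d). pr f = pr (var 0) \<otimes>\<^bsub>R\<^esub> pr h)"
      unfolding SR_simps by (auto simp: coord_piece_def)
    also have "\<dots> \<longleftrightarrow> (\<exists>h\<in>forms n (int d). f - var 0 * h \<in> I)"
    proof (rule bex_cong[OF refl])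
      fix h :: "'k mpoly" assume "h \<in> forms n (int d)"
      then have h: "h \<in> pcarrier n" by (rule forms_pcarrier)
      show "(pr f = pr (var 0) \<otimes>\<^bsub>R\<^esub> pr h) = (f - var 0 * h \<in> I)"
        unfolding pr_mult[OF var0(1) h] by (rule pr_eq_iff[OF forms_pcarrier[OF f] pcarrier_mult[OF var0(1) h]])
    qed
    finally show ?thesis .
  qed
  have "?T ` cpiece (int d) = cpiece (int d + 1) \<longleftrightarrow> (\<forall>f\<in>forms n (int d + 1). pr f \<in> ?T ` cpiece (int d))"
    using sub by (auto simp: coord_piece_def)
  then show ?thesis using T by (simp add: surj_at_def)
qed

text \<open>Multiplication by \<open>x_0\<close> is injective on \<open>R\<close>, so equal finite
  dimensions mean exactly that it is onto.\<close>

lemma HF_coord_eq_iff: "HF_coord n I (int d) = HF_coord n I (int d + 1) \<longleftrightarrow> surj_at d"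
proof
  assume "HF_coord n I (int d) = HF_coord n I (int d + 1)"
  then show "surj_at d"
    unfolding HF_coord_eq image_VC_iff[symmetric]
    using linear_map.inj_dim_le(2)[OF linear_map_VC[of "int d"] fin_dim_VC fin_dim_VC] inj_VC by simp
next
  assume "surj_at d"
  then show "HF_coord n I (int d) = HF_coord n I (int d + 1)"
    unfolding HF_coord_eq image_VC_iff[symmetric]
    using linear_map.dim_eq[OF linear_map_VC[of "int d"] fin_dim_VC] inj_VC by simp
qed

lemma HF_coord_0: "HF_coord n I 0 \<noteq> 0"
proof
  assume "HF_coord n I 0 = 0"
  then have "cpiece 0 = {\<zero>\<^bsub>SR\<^esub>}"
    unfolding HF_coord_eq using vectorspace.dim_zero_carrier[OF vectorspace_VC fin_dim_VC] by simp
  moreover have "pr 1 \<in> cpiece 0" using forms_const[of 1 n] by (auto simp: cpiece_iff const_1)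
  ultimately have "pr 1 = \<zero>\<^bsub>R\<^esub>" by (simp add: SR_simps)
  then show False using proper pr_zero_iff[OF pcarrier_1] by simp
qed

text \<open>By \<open>stable\<close> the Hilbert function is eventually constant, and from the
  regularity index on equal consecutive values give surjectivity.\<close>

lemma regularity_coord:
  obtains r where "regularity_index (HF_coord n I) = Fin (int r)" "\<And>d. d \<ge> r \<Longrightarrow> surj_at d"
proof -
  obtain N where N: "\<And>d. d \<ge> N \<Longrightarrow> surj_at d" using stable unfolding surj_at_def by auto
  define c where "c = HF_coord n I (int N)"
  have c: "HF_coord n I i = c" if "i \<ge> int N" for i
    using that
  proof (induction i rule: int_ge_induct)
    case base then show ?case by (simp add: c_def)
  next
    case (step i)
    then obtain d where d: "i = int d" "d \<ge> N" by (metis nonneg_int_cases of_nat_0_le_iff of_nat_le_iff order_trans)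
    then show ?case using step HF_coord_eq_iff[of d] N[of d] by simp
  qed
  have mono: "HF_coord n I 0 \<le> HF_coord n I (int d)" for d
  proof (induction d)
    case (Suc d)
    then show ?case using HF_coord_mono[of "int d"] by (simp add: add.commute)
  qed simp
  \<comment> \<open>The eventual value is at least the nonzero value in degree 0, so degree -1
    misses it; this makes the regularity index finite and nonnegative.\<close>
  have "HF_coord n I (- 1) \<noteq> c" using HF_coord_neg[of "- 1"] HF_coord_0 mono[of N] by (simp add: c_def)
  then obtain r where r: "regularity_index (HF_coord n I) = Fin r" "\<And>i. i \<ge> r \<Longrightarrow> HF_coord n I i = c" "- 1 < r"
    using regularity_index_Fin[of "int N" "HF_coord n I" c "- 1"] c by blast
  show ?thesis
  proof (rule that[of "nat r"])
    show "regularity_index (HF_coord n I) = Fin (int (nat r))" using r by simp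
    show "surj_at d" if "d \<ge> nat r" for d
      using r(2)[of "int d"] r(2)[of "int d + 1"] that HF_coord_eq_iff[of d] by simp
  qed
qed

lemma lamh_diff: "v \<in> lamh m s \<Longrightarrow> w \<in> lamh m s \<Longrightarrow> (\<lambda>J. v J - w J) \<in> lamh m s"
proof -
  assume vw: "v \<in> lamh m s" "w \<in> lamh m s"
  have "v J - w J \<noteq> 0 \<Longrightarrow> v J \<noteq> 0 \<or> w J \<noteq> 0" for J by auto
  moreover have "v J - w J \<in> forms n s" for J by (rule forms_diff[OF lamh_forms[OF vw(1)] lamh_forms[OF vw(2)]])
  ultimately show ?thesis using vw forms_pcarrier[OF \<open>\<And>J. v J - w J \<in> forms n s\<close>]
    unfolding lamh_def lam_def by blast
qed

lemma Psi_diff_zero_iff: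
  assumes v: "\<And>J. v J \<in> pcarrier n" and w: "\<And>J. w J \<in> pcarrier n"
  shows "Psi m (\<lambda>J. v J - w J) = \<zero>\<^bsub>E m\<^esub> \<longleftrightarrow> Psi m v = Psi m w"
proof -
  let ?d = "\<lambda>J. v J - w J"
  have d: "?d J \<in> pcarrier n" for J by (rule pcarrier_diff[OF v w])
  have "Psi m (\<lambda>J. ?d J + w J) = Psi m ?d \<oplus>\<^bsub>E m\<^esub> Psi m w" by (rule Psi_add[OF d w])
  then have e: "Psi m v = Psi m ?d \<oplus>\<^bsub>E m\<^esub> Psi m w" by (simp only: diff_add_cancel)
  have c: "Psi m ?d \<in> carrier (E m)" "Psi m w \<in> carrier (E m)" by (rule Psi_closed[OF d], rule Psi_closed[OF w])
  show ?thesis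
  proof
    assume "Psi m ?d = \<zero>\<^bsub>E m\<^esub>"
    then show "Psi m v = Psi m w" unfolding e using E.M.l_zero[OF c(2)] by (simp only:)
  next
    assume "Psi m v = Psi m w"
    then have "Psi m ?d \<oplus>\<^bsub>E m\<^esub> Psi m w = \<zero>\<^bsub>E m\<^esub> \<oplus>\<^bsub>E m\<^esub> Psi m w"
      unfolding e[symmetric] using E.M.l_zero[OF c(2)] by (simp only:)
    then show "Psi m ?d = \<zero>\<^bsub>E m\<^esub>" using E.M.add.right_cancel[OF c(2,1) E.M.zero_closed] by blast
  qed
qed

lemma ideal_low_degree:
  assumes f: "f \<in> I" and d: "d < initial_degree n I" shows "hc d f = 0"
proof -
  have "\<not> (\<exists>f\<in>I \<inter> forms n (int d). f \<noteq> 0)"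
    using not_less_Least[OF d[unfolded initial_degree_def]] .
  then show ?thesis using hom[OF f] forms_hc[OF I_pcarrier[OF f]] by blast
qed

text \<open>Coefficients in \<open>I\<close> start in the initial degree, but gradients of elements
  of \<open>I\<close> may start one degree lower; hence \<open>Suc d\<close>.\<close>

lemma extrel_low_degree:
  assumes "extrel m w" and d: "Suc d < initial_degree n I" shows "hc d (w J) = 0"
  using assms(1)
proof (induction arbitrary: J rule: extrel.induct)
  case (ideal w m)
  show ?case by (rule ideal_low_degree[OF ideal(2)]) (use d in simp)
next
  case (grad f w m)
  have "hc (Suc i) f = 0" if "i \<le> d" for i
    by (rule ideal_low_degree[OF grad(1)]) (use d that in simp)
  then show ?case unfolding hc_ext_grad by (intro sum.neutral ballI) (simp add: ext_def grad_def)
qed simp_all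

lemma Psi_inj_low_degree:
  assumes d: "Suc d < initial_degree n I" and vw: "v \<in> lamh m (int d)" "w \<in> lamh m (int d)"
    and eq: "Psi m v = Psi m w"
  shows "v = w"
proof
  fix J
  have l: "(\<lambda>J. v J - w J) \<in> lamh m (int d)" by (rule lamh_diff[OF vw])
  have "Psi m (\<lambda>J. v J - w J) = \<zero>\<^bsub>E m\<^esub>"
    using Psi_diff_zero_iff[of v w m, OF lamh_pcarrier[OF vw(1)] lamh_pcarrier[OF vw(2)]] eq by blast
  then have "extrel m (\<lambda>J. v J - w J)" using Psi_zero_iff[OF lamh_lam[OF l]] by blast
  from extrel_low_degree[OF this d, of J] have "hc d (v J - w J) = 0" .
  then have "v J - w J = 0" unfolding hc_forms[OF lamh_forms[OF l, of J]] by (simp only: if_True simp_thms)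
  then show "v J = w J" by (simp only: right_minus_eq)
qed

abbreviation VE :: "nat \<Rightarrow> int \<Rightarrow> _" where "VE m s \<equiv> E m\<lparr>carrier := epiece m s\<rparr>"

lemma HF_Omega_eq: "HF_Omega n I m s = vectorspace.dim KR (VE m s)"
  by (simp add: HF_Omega_def Let_def hilbert_function_def)

text \<open>Indices for the products of a monomial of degree \<open>d\<close> with a basis form,
  which span the homogeneous exterior forms over the base field.\<close>

definition gens :: "nat \<Rightarrow> nat \<Rightarrow> ((nat \<Rightarrow>\<^sub>0 nat) \<times> nat set) set" where
  "gens m d = monomials n d \<times> subs m"

definition gen :: "(nat \<Rightarrow>\<^sub>0 nat) \<times> nat set \<Rightarrow> nat set \<Rightarrow> 'k mpoly" where
  "gen x J = single (fst x) 1 * ext_basis (snd x) J"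

lemma finite_gens: "finite (gens m d)"
  unfolding gens_def by (intro finite_cartesian_product finite_monomials finite_subs)

lemma card_gens: "card (gens m d) = ((n + 1) choose m) * ((n + d) choose n)"
proof -
  have "subs m = {J. J \<subseteq> {..n} \<and> card J = m}" by (simp add: subs_def)
  then have "card (subs m) = (n + 1) choose m" using n_subsets[of "{..n}" m] by simp
  then show ?thesis by (simp add: gens_def card_cartesian_product card_monomials)
qed

lemma gen_lamh:
  assumes "x \<in> gens m d" shows "gen x \<in> lamh m (int d)"
proof -
  obtain t J where x: "x = (t, J)" "t \<in> monomials n d" "J \<in> subs m" using assms by (auto simp: gens_def)
  have t: "(single t 1 :: 'k mpoly) \<in> forms n (int d)"
    using forms_single[of t n "1::'k"] x(2) by (auto simp: monomials_def)
  have J: "(ext_basis J :: nat set \<Rightarrow> 'k mpoly) \<in> lamh m 0"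
  proof -
    have "(ext_basis J J' :: 'k mpoly) \<in> forms n 0" for J'
      using forms_const[of 1 n] by (auto simp: ext_basis_def const_1)
    then show ?thesis using lam_basis[of J m] x(3) by (simp add: lamh_def subs_def)
  qed
  show ?thesis using lamh_mult[OF t J] unfolding gen_def[abs_def] x by simp
qed

lemma lamh_expand:
  assumes w: "w \<in> lamh m (int d)"
  shows "w = (\<lambda>J. \<Sum>x\<in>gens m d. const (lookup (w (snd x)) (fst x)) * gen x J)"
proof
  fix J
  have "w J = (\<Sum>J'\<in>subs m. w J' * ext_basis J' J)"
    using fun_cong[OF lam_expand[OF lamh_lam[OF w]], of J] .
  also have "\<dots> = (\<Sum>J'\<in>subs m. \<Sum>t\<in>monomials n d. const (lookup (w J') t) * gen (t, J') J)"
  proof (rule sum.cong[OF refl])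
    fix J' assume "J' \<in> subs m"
    show "w J' * ext_basis J' J = (\<Sum>t\<in>monomials n d. const (lookup (w J') t) * gen (t, J') J)"
      by (subst forms_expand[OF lamh_forms[OF w, of J']])
        (simp only: sum_distrib_right gen_def fst_conv snd_conv mult.assoc)
  qed
  also have "\<dots> = (\<Sum>t\<in>monomials n d. \<Sum>J'\<in>subs m. const (lookup (w J') t) * gen (t, J') J)"
    by (rule sum.swap)
  also have "\<dots> = (\<Sum>x\<in>gens m d. const (lookup (w (snd x)) (fst x)) * gen x J)"
    unfolding gens_def sum.cartesian_product by (rule sum.cong[OF refl]) (simp only: case_prod_beta prod.collapse)
  finally show "w J = (\<Sum>x\<in>gens m d. const (lookup (w (snd x)) (fst x)) * gen x J)" .
qed

lemma Psi_combination:
  "Psi m (\<lambda>J. \<Sum>x\<in>gens m d. const (a x) * gen x J) =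
    (\<Oplus>\<^bsub>E m\<^esub>x\<in>gens m d. pr (const (a x)) \<odot>\<^bsub>E m\<^esub> Psi m (gen x))"
proof -
  have g: "gen x J \<in> pcarrier n" if "x \<in> gens m d" for x J by (rule lamh_pcarrier[OF gen_lamh[OF that]])
  have "Psi m (\<lambda>J. \<Sum>x\<in>gens m d. const (a x) * gen x J) =
      (\<Oplus>\<^bsub>E m\<^esub>x\<in>gens m d. Psi m (\<lambda>J. const (a x) * gen x J))"
    by (rule Psi_sum[OF finite_gens]) (intro pcarrier_mult pcarrier_const g)
  also have "\<dots> = (\<Oplus>\<^bsub>E m\<^esub>x\<in>gens m d. pr (const (a x)) \<odot>\<^bsub>E m\<^esub> Psi m (gen x))"
  proof (rule E.M.finsum_cong'[OF refl])
    show "(\<lambda>x. pr (const (a x)) \<odot>\<^bsub>E m\<^esub> Psi m (gen x)) \<in> gens m d \<rightarrow> carrier (E m)"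
      by (intro Pi_I E.smult_closed pr_closed pcarrier_const Psi_closed g)
  qed (rule Psi_scale[OF pcarrier_const g])
  finally show ?thesis .
qed

text \<open>The coefficients of a combination can be read off, which gives linear independence of
  the \<open>gen x\<close>.\<close>

lemma lookup_combination:
  assumes x: "x \<in> gens m d"
  shows "lookup (\<Sum>y\<in>gens m d. const (a y) * gen y (snd x)) (fst x) = a x"
proof -
  have "lookup (const (a y) * gen y (snd x)) (fst x) = (if x = y then a x else 0)" for y
    by (cases x; cases y) (auto simp: gen_def ext_basis_def const_def mult_single lookup_single when_def)
  then show ?thesis using x finite_gens[of m d] by (simp add: lookup_sum)
qed

section \<open>The Hilbert function of the exterior power of fixed positive degree
  \<open>m\<close>\<close>

context
  fixes m :: nat assumes m: "m \<ge> 1"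
begin

interpretation EV: vectorspace KR "E m" by (rule vectorspace_KR[OF E.module_axioms])

lemma subspace_epiece: "subspace KR (epiece m s) (E m)"
  using exterior_piece_submodule[OF m] EV.vectorspace_axioms by (simp add: subspace_def)

lemma vectorspace_VE: "vectorspace KR (VE m s)"
  by (rule EV.subspace_is_vs[OF subspace_epiece])

lemma epiece_shift: "epiece m (s + int m) = Psi m ` lamh m s"
  using exterior_piece_Psi[OF m, of "s + int m"] by simp

lemma HF_Omega_neg: assumes "s < int m" shows "HF_Omega n I m s = 0"
proof -
  have "w = (\<lambda>_. 0)" if "w \<in> lamh m (s - int m)" for w
  proof
    show "w J = 0" for J using lamh_forms[OF that, of J] forms_neg[of "s - int m" n] assms by auto
  qed
  then have "lamh m (s - int m) = {\<lambda>_. 0}" using lamh_zero by blast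
  moreover have "Psi m (\<lambda>_. 0) = \<zero>\<^bsub>E m\<^esub>" by (rule Psi_ideal[OF I_0])
  ultimately have "epiece m s = {\<zero>\<^bsub>E m\<^esub>}" using exterior_piece_Psi[OF m, of s] by simp
  then show ?thesis unfolding HF_Omega_eq
    by (intro vectorspace.dim_carrier_zero[OF vectorspace_VE]) simp
qed

lemma epiece_gens: "x \<in> gens m d \<Longrightarrow> Psi m (gen x) \<in> epiece m (int d + int m)"
  unfolding epiece_shift by (rule imageI[OF gen_lamh])

lemma epiece_combination:
  assumes v: "v \<in> epiece m (int d + int m)"
  shows "\<exists>c. (\<forall>x\<in>gens m d. c x \<in> carrier KR) \<and> v = (\<Oplus>\<^bsub>E m\<^esub>x\<in>gens m d. c x \<odot>\<^bsub>E m\<^esub> Psi m (gen x))"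
proof -
  obtain w where w: "w \<in> lamh m (int d)" "v = Psi m w" using v unfolding epiece_shift by blast
  have "v = (\<Oplus>\<^bsub>E m\<^esub>x\<in>gens m d. pr (const (lookup (w (snd x)) (fst x))) \<odot>\<^bsub>E m\<^esub> Psi m (gen x))"
    unfolding w(2) Psi_combination[symmetric] using arg_cong[OF lamh_expand[OF w(1)], of "Psi m"] .
  then show ?thesis
    by (intro exI[of _ "\<lambda>x. pr (const (lookup (w (snd x)) (fst x)))"]) (auto intro: k_const)
qed

lemma fin_dim_VE: "vectorspace.fin_dim KR (VE m (int d + int m))"
  by (rule EV.subspace_family_fin_dim[OF subspace_epiece finite_gens epiece_gens epiece_combination])

text \<open>No relation reaches coefficient degree \<open>d\<close>, so \<open>Psi\<close> is
  injective there and the images of the \<open>gen x\<close> form a basis; it remains to count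
  them.\<close>

lemma HF_Omega_low_degree:
  assumes d: "Suc d < initial_degree n I"
  shows "HF_Omega n I m (int d + int m) = ((n + 1) choose m) * ((n + d) choose n)"
proof -
  have "vectorspace.dim KR (VE m (int d + int m)) = card (gens m d)"
  proof (rule EV.subspace_family_dim[OF subspace_epiece finite_gens epiece_gens epiece_combination])
    show "inj_on (\<lambda>x. Psi m (gen x)) (gens m d)"
    proof (rule inj_onI)
      fix x y assume xy: "x \<in> gens m d" "y \<in> gens m d" "Psi m (gen x) = Psi m (gen y)"
      from Psi_inj_low_degree[OF d gen_lamh[OF xy(1)] gen_lamh[OF xy(2)] xy(3)]
      have "lookup (gen x (snd x)) (fst x) = lookup (gen y (snd x)) (fst x)" by (simp only:)
      then show "x = y"
        by (cases x; cases y) (auto simp: gen_def ext_basis_def lookup_single when_def split: if_splits)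
    qed
  next
    fix c x assume c: "\<And>x. x \<in> gens m d \<Longrightarrow> c x \<in> carrier KR"
      and z: "(\<Oplus>\<^bsub>E m\<^esub>x\<in>gens m d. c x \<odot>\<^bsub>E m\<^esub> Psi m (gen x)) = \<zero>\<^bsub>E m\<^esub>" and x: "x \<in> gens m d"
    have "\<forall>x\<in>gens m d. \<exists>a. c x = pr (const a)" using c by (simp add: k_iff)
    then obtain a where a: "\<And>x. x \<in> gens m d \<Longrightarrow> c x = pr (const (a x))" by metis
    let ?w = "\<lambda>J. \<Sum>x\<in>gens m d. const (a x) * gen x J"
    have l: "?w \<in> lamh m (int d)"
    proof (rule lamh_sum)
      fix x assume "x \<in> gens m d"
      then have "(\<lambda>J. const (a x) * gen x J) \<in> lamh m (0 + int d)"
        by (intro lamh_mult forms_const gen_lamh)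
      then show "(\<lambda>J. const (a x) * gen x J) \<in> lamh m (int d)" by (simp only: add_0)
    qed
    have "Psi m ?w = (\<Oplus>\<^bsub>E m\<^esub>x\<in>gens m d. c x \<odot>\<^bsub>E m\<^esub> Psi m (gen x))"
      unfolding Psi_combination
      by (rule E.M.finsum_cong'[OF refl])
        (use a in \<open>auto intro!: E.smult_closed pr_closed Psi_closed lamh_pcarrier[OF gen_lamh]\<close>)
    also have "\<dots> = Psi m (\<lambda>_. 0)" unfolding z by (rule Psi_ideal[OF I_0, symmetric])
    finally have "?w = (\<lambda>_. 0)" by (rule Psi_inj_low_degree[OF d l lamh_zero])
    from fun_cong[OF this, of "snd x"] have "a x = 0" using lookup_combination[OF x, of a] by simp
    then show "c x = \<zero>\<^bsub>KR\<^esub>" using a[OF x] by (simp add: const_0 R_zero)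
  qed
  then show ?thesis unfolding HF_Omega_eq card_gens .
qed

lemma linear_map_VE: "linear_map KR (VE m s) (VE m (s + 1)) (\<lambda>v. pr (var 0) \<odot>\<^bsub>E m\<^esub> v)"
proof (rule linear_map_smult[OF E.module_axioms pr_var0 k_closed vectorspace_VE vectorspace_VE])
  show "epiece m s \<subseteq> carrier (E m)"
    using exterior_piece_submodule[OF m, of s] by (simp add: LinearCombinations.submodule_def)
  fix v assume "v \<in> epiece m s"
  then obtain w where w: "w \<in> lamh m (s - int m)" "v = Psi m w" unfolding exterior_piece_Psi[OF m] by blast
  have "pr (var 0) \<odot>\<^bsub>E m\<^esub> v = Psi m (\<lambda>J. var 0 * w J)"
    unfolding w(2) by (rule Psi_scale[symmetric, OF var0(1) lamh_pcarrier[OF w(1)]])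
  moreover have "(\<lambda>J. var 0 * w J) \<in> lamh m (1 + (s - int m))" by (rule lamh_mult[OF var0(2) w(1)])
  moreover have "1 + (s - int m) = s + 1 - int m" by simp
  ultimately show "pr (var 0) \<odot>\<^bsub>E m\<^esub> v \<in> epiece m (s + 1)"
    unfolding exterior_piece_Psi[OF m] by (simp only: imageI)
qed

text \<open>Surjectivity on \<open>R\<close> is used for each coefficient separately; the errors
  have coefficients in \<open>I\<close> and vanish under \<open>Psi\<close>.\<close>

lemma image_VE:
  assumes d: "surj_at d"
  shows "(\<lambda>v. pr (var 0) \<odot>\<^bsub>E m\<^esub> v) ` epiece m (int d + int m) = epiece m (int d + int m + 1)"
proof
  show "(\<lambda>v. pr (var 0) \<odot>\<^bsub>E m\<^esub> v) ` epiece m (int d + int m) \<subseteq> epiece m (int d + int m + 1)"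
    using mod_hom.f_im[OF linear_map.axioms(3)[OF linear_map_VE[of "int d + int m"]]] by auto
  show "epiece m (int d + int m + 1) \<subseteq> (\<lambda>v. pr (var 0) \<odot>\<^bsub>E m\<^esub> v) ` epiece m (int d + int m)"
  proof
    fix v assume v: "v \<in> epiece m (int d + int m + 1)"
    have "int d + int m + 1 = (int d + 1) + int m" by simp
    with v have "v \<in> Psi m ` lamh m (int d + 1)" by (simp only: epiece_shift)
    then obtain w where w: "w \<in> lamh m (int d + 1)" "v = Psi m w" by (rule imageE)
    have "\<exists>h. h \<in> forms n (int d) \<and> w J - var 0 * h \<in> I \<and> (w J = 0 \<longrightarrow> h = 0)" for J
    proof (cases "w J = 0")
      case True then show ?thesis by (intro exI[of _ 0]) (auto intro: I_0)
    next
      case False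
      with surj_atD[OF d lamh_forms[OF w(1), of J]] show ?thesis by blast
    qed
    then obtain z where z: "\<And>J. z J \<in> forms n (int d)" "\<And>J. w J - var 0 * z J \<in> I"
      "\<And>J. w J = 0 \<Longrightarrow> z J = 0" by metis
    have zl: "z \<in> lamh m (int d)"
    proof -
      have "z J \<noteq> 0 \<Longrightarrow> w J \<noteq> 0" for J using z(3) by blast
      with w(1) z(1) forms_pcarrier[OF z(1)] show ?thesis unfolding lamh_def lam_def by blast
    qed
    have "Psi m (\<lambda>J. w J - var 0 * z J) = \<zero>\<^bsub>E m\<^esub>" by (rule Psi_ideal[OF z(2)])
    then have "v = Psi m (\<lambda>J. var 0 * z J)"
      using Psi_diff_zero_iff[of w "\<lambda>J. var 0 * z J" m,
          OF lamh_pcarrier[OF w(1)] pcarrier_mult[OF var0(1) forms_pcarrier[OF z(1)]]] w(2) by blast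
    also have "\<dots> = pr (var 0) \<odot>\<^bsub>E m\<^esub> Psi m z"
      by (rule Psi_scale[OF var0(1) lamh_pcarrier[OF zl]])
    finally show "v \<in> (\<lambda>v. pr (var 0) \<odot>\<^bsub>E m\<^esub> v) ` epiece m (int d + int m)"
      unfolding epiece_shift by (rule image_eqI[OF _ imageI[OF zl]])
  qed
qed

lemma HF_Omega_antimono:
  assumes "surj_at d" shows "HF_Omega n I m (int d + int m + 1) \<le> HF_Omega n I m (int d + int m)"
  unfolding HF_Omega_eq
  by (rule linear_map.surj_dim_le(1)[OF linear_map_VE fin_dim_VE]) (simp add: image_VE[OF assms])

text \<open>Injectivity of \<open>x_0\<close> in coefficient degree \<open>d\<close>, stated for
  relations because \<open>injective_step\<close> works on that level.\<close>

definition inj_at :: "nat \<Rightarrow> bool" where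
  "inj_at d \<longleftrightarrow> (\<forall>w\<in>lamh m (int d). extrel m (\<lambda>J. var 0 * w J) \<longrightarrow> extrel m w)"

lemma inj_at_iff: "inj_at d \<longleftrightarrow> inj_on (\<lambda>v. pr (var 0) \<odot>\<^bsub>E m\<^esub> v) (epiece m (int d + int m))"
proof
  assume i: "inj_at d"
  show "inj_on (\<lambda>v. pr (var 0) \<odot>\<^bsub>E m\<^esub> v) (epiece m (int d + int m))"
  proof (rule inj_onI)
    fix x y assume xy: "x \<in> epiece m (int d + int m)" "y \<in> epiece m (int d + int m)"
      "pr (var 0) \<odot>\<^bsub>E m\<^esub> x = pr (var 0) \<odot>\<^bsub>E m\<^esub> y"
    obtain v where v: "v \<in> lamh m (int d)" "x = Psi m v" using xy(1) unfolding epiece_shift by blast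
    obtain w where w: "w \<in> lamh m (int d)" "y = Psi m w" using xy(2) unfolding epiece_shift by blast
    let ?d = "\<lambda>J. v J - w J"
    have d: "?d \<in> lamh m (int d)" by (rule lamh_diff[OF v(1) w(1)])
    have "Psi m (\<lambda>J. var 0 * v J) = Psi m (\<lambda>J. var 0 * w J)"
      unfolding Psi_scale[of "var 0" v m, OF var0(1) lamh_pcarrier[OF v(1)]]
        Psi_scale[of "var 0" w m, OF var0(1) lamh_pcarrier[OF w(1)]] using xy(3) unfolding v(2) w(2) .
    then have "Psi m (\<lambda>J. var 0 * v J - var 0 * w J) = \<zero>\<^bsub>E m\<^esub>"
      using Psi_diff_zero_iff[of "\<lambda>J. var 0 * v J" "\<lambda>J. var 0 * w J" m,
          OF pcarrier_mult[OF var0(1) lamh_pcarrier[OF v(1)]] pcarrier_mult[OF var0(1) lamh_pcarrier[OF w(1)]]]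
      by blast
    then have "Psi m (\<lambda>J. var 0 * ?d J) = \<zero>\<^bsub>E m\<^esub>" by (simp only: right_diff_distrib)
    then have "extrel m (\<lambda>J. var 0 * ?d J)"
      using Psi_zero_iff[OF lam_scale[OF var0(1) lamh_lam[OF d]]] by blast
    then have "extrel m ?d" by (rule i[unfolded inj_at_def, rule_format, OF d])
    then have "Psi m ?d = \<zero>\<^bsub>E m\<^esub>" using Psi_zero_iff[OF lamh_lam[OF d]] by blast
    then show "x = y" unfolding v(2) w(2)
      using Psi_diff_zero_iff[of v w m, OF lamh_pcarrier[OF v(1)] lamh_pcarrier[OF w(1)]] by blast
  qed
next
  assume i: "inj_on (\<lambda>v. pr (var 0) \<odot>\<^bsub>E m\<^esub> v) (epiece m (int d + int m))"
  show "inj_at d" unfolding inj_at_def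
  proof (intro ballI impI)
    fix w assume w: "w \<in> lamh m (int d)" and e: "extrel m (\<lambda>J. var 0 * w J)"
    have z: "Psi m (\<lambda>_. 0) = \<zero>\<^bsub>E m\<^esub>" by (rule Psi_ideal[OF I_0])
    have "pr (var 0) \<odot>\<^bsub>E m\<^esub> Psi m w = \<zero>\<^bsub>E m\<^esub>"
      using Psi_extrel[OF e] Psi_scale[of "var 0" w m, OF var0(1) lamh_pcarrier[OF w]] by (simp only:)
    also have "\<dots> = pr (var 0) \<odot>\<^bsub>E m\<^esub> \<zero>\<^bsub>E m\<^esub>" by (rule E.smult_r_null[OF pr_var0, symmetric])
    finally have "Psi m w = \<zero>\<^bsub>E m\<^esub>"
      by (rule inj_onD[OF i]) (unfold epiece_shift z[symmetric], rule imageI[OF w], rule imageI[OF lamh_zero])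
    then show "extrel m w" using Psi_zero_iff[OF lamh_lam[OF w]] by blast
  qed
qed

text \<open>Here \<open>x_0\<close> is onto, so equality of dimensions means injectivity; in
  \<open>HF_coord_eq_iff\<close> the two roles are exchanged.\<close>

lemma HF_Omega_eq_iff:
  assumes "surj_at d"
  shows "HF_Omega n I m (int d + int m + 1) = HF_Omega n I m (int d + int m) \<longleftrightarrow> inj_at d"
proof
  assume "HF_Omega n I m (int d + int m + 1) = HF_Omega n I m (int d + int m)"
  then show "inj_at d" unfolding inj_at_iff HF_Omega_eq
    using linear_map.surj_dim_le(2)[OF linear_map_VE fin_dim_VE, of d] image_VE[OF assms] by simp
next
  assume "inj_at d"
  then show "HF_Omega n I m (int d + int m + 1) = HF_Omega n I m (int d + int m)"
    unfolding inj_at_iff HF_Omega_eq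
    using linear_map.dim_eq[OF linear_map_VE fin_dim_VE, of d] image_VE[OF assms] by simp
qed

text \<open>One equality gives injectivity in degree \<open>d\<close>, \<open>injective_step\<close>
  carries it upwards, and injectivity in each later degree gives equality there.\<close>

lemma HF_Omega_constant:
  assumes r: "\<And>d. d \<ge> r \<Longrightarrow> surj_at d" and d: "d \<ge> r"
    and eq: "HF_Omega n I m (int d + int m + 1) = HF_Omega n I m (int d + int m)"
    and i: "i \<ge> int d + int m"
  shows "HF_Omega n I m i = HF_Omega n I m (int d + int m)"
proof -
  have inj: "inj_at (d + l)" for l
  proof (induction l)
    case 0
    then show ?case using HF_Omega_eq_iff[OF r[OF d]] eq by simp
  next
    case (Suc l)
    have dl: "d + l \<ge> r" using d by simp
    show ?case unfolding inj_at_def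
    proof (intro ballI impI)
      fix w assume w: "w \<in> lamh m (int (d + Suc l))" "extrel m (\<lambda>J. var 0 * w J)"
      have "int (d + Suc l) = int (d + l) + 1" by simp
      then have w': "w \<in> lamh m (int (d + l) + 1)" using w(1) by (simp only:)
      show "extrel m w"
      proof (rule injective_step[OF _ dl _ w' w(2)])
        show "\<exists>h\<in>forms n (int e). f - var 0 * h \<in> I" if "e \<ge> r" "f \<in> forms n (int e + 1)" for e f
          by (rule surj_atD[OF r[OF that(1)] that(2)])
        show "extrel m w" if "w \<in> lamh m (int (d + l))" "extrel m (\<lambda>J. var 0 * w J)" for w
          using Suc that unfolding inj_at_def by blast
      qed
    qed
  qed
  have "HF_Omega n I m (int (d + l) + int m) = HF_Omega n I m (int d + int m)" for l
  proof (induction l)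
    case (Suc l)
    have "int (d + Suc l) + int m = int (d + l) + int m + 1" by simp
    moreover have "surj_at (d + l)" by (rule r) (use d in simp)
    ultimately show ?case using HF_Omega_eq_iff[of "d + l"] inj[of l] Suc by (simp only:)
  qed simp
  from this[of "nat (i - int d - int m)"] i show ?thesis by simp
qed

lemma HF_Omega_Suc_le:
  assumes "\<And>d. d \<ge> r \<Longrightarrow> surj_at d" and i: "i \<ge> int r + int m"
  shows "HF_Omega n I m (i + 1) \<le> HF_Omega n I m i"
proof -
  define d where "d = nat (i - int m)"
  have d: "i = int d + int m" "d \<ge> r" using i by (auto simp: d_def)
  show ?thesis unfolding d(1) by (rule HF_Omega_antimono[OF assms(1)[OF d(2)]])
qed

text \<open>If the value did not drop after \<open>i\<close>, the function would be constant from
  \<open>i\<close> on, and the regularity index would be at most \<open>i\<close>.\<close>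

lemma HF_Omega_Suc_less:
  assumes r: "\<And>d. d \<ge> r \<Longrightarrow> surj_at d" and i: "i \<ge> int r + int m"
    and ri: "Fin i < regularity_index (HF_Omega n I m)"
  shows "HF_Omega n I m (i + 1) < HF_Omega n I m i"
proof (rule ccontr)
  define d where "d = nat (i - int m)"
  have d: "i = int d + int m" "d \<ge> r" using i by (auto simp: d_def)
  assume "\<not> HF_Omega n I m (i + 1) < HF_Omega n I m i"
  then have "HF_Omega n I m (int d + int m + 1) = HF_Omega n I m (int d + int m)"
    using HF_Omega_Suc_le[of r i, OF r i] d(1) by simp
  then have "regularity_index (HF_Omega n I m) \<le> Fin i"
    unfolding d(1) by (intro regularity_index_le) (rule HF_Omega_constant[OF r d(2)])
  with ri show False by simp
qed

end

end

theorem proposition4p2: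
  fixes n m :: nat and I :: "'k::field_char_0 mpoly set"
  assumes "1 \<le> n"
    and "zero_dim_scheme n I"
    and "\<forall>P\<in>scheme_points n I. var 0 \<notin> P"
    and "1 \<le> m" and "m \<le> n + 1"
  shows
    "(\<forall>i::int. i < int m \<longrightarrow> HF_Omega n I m i = 0)
   \<and> (\<forall>i::int. int m \<le> i \<and> i < int (initial_degree n I) + int m - 1 \<longrightarrow>
        HF_Omega n I m i = ((n + 1) choose m) * (nat (int n + i - int m) choose n))
   \<and> (is_hilbert_polynomial (HF_Omega n I m) (hilbert_polynomial (HF_Omega n I m))
      \<and> degree (hilbert_polynomial (HF_Omega n I m)) = 0)
   \<and> ((\<forall>i::int. regularity_index (HF_coord n I) + Fin (int m) \<le> Fin i \<longrightarrow>
          HF_Omega n I m i \<ge> HF_Omega n I m (i + 1))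
      \<and> (regularity_index (HF_Omega n I m) \<ge> regularity_index (HF_coord n I) + Fin (int m) \<longrightarrow>
          (\<forall>i::int. regularity_index (HF_coord n I) + Fin (int m) \<le> Fin i
                 \<and> Fin i < regularity_index (HF_Omega n I m) \<longrightarrow>
             HF_Omega n I m i > HF_Omega n I m (i + 1))))"
proof -
  interpret coord_scheme n I by (rule zero_dim_coord_scheme[OF assms(2,3)])
  note m = assms(4)
  obtain r where r: "regularity_index (HF_coord n I) = Fin (int r)" "\<And>d. d \<ge> r \<Longrightarrow> surj_at d"
    using regularity_coord by blast
  have ri: "regularity_index (HF_coord n I) + Fin (int m) \<le> Fin i \<longleftrightarrow> int r + int m \<le> i" for i
    by (simp add: r(1))
  have low: "HF_Omega n I m i = ((n + 1) choose m) * (nat (int n + i - int m) choose n)"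
    if i: "int m \<le> i \<and> i < int (initial_degree n I) + int m - 1" for i
  proof -
    \<comment> \<open>\<open>d\<close> is the coefficient degree; the bound on \<open>i\<close>
      becomes \<open>Suc d < initial_degree n I\<close>.\<close>
    define d where "d = nat (i - int m)"
    have d: "i = int d + int m" "Suc d < initial_degree n I" using i by (auto simp: d_def)
    have "nat (int n + i - int m) = n + d" by (simp add: d(1))
    then show ?thesis using HF_Omega_low_degree[OF m d(2)] by (simp only: d(1))
  qed
  have le: "HF_Omega n I m (i + 1) \<le> HF_Omega n I m i" if "int r + int m \<le> i" for i
    by (rule HF_Omega_Suc_le[OF m _ that]) (rule r(2))
  have less: "HF_Omega n I m (i + 1) < HF_Omega n I m i"
    if "int r + int m \<le> i" "Fin i < regularity_index (HF_Omega n I m)" for i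
    by (rule HF_Omega_Suc_less[OF m _ that]) (rule r(2))
  \<comment> \<open>A sequence of natural numbers that eventually does not increase becomes
    constant; \<open>c\<close> is the value of the Hilbert polynomial.\<close>
  obtain N c where N: "\<And>i. i \<ge> N \<Longrightarrow> HF_Omega n I m i = c"
    using antimono_eventually_const[of "int r + int m" "HF_Omega n I m", OF le] by blast
  have hp: "hilbert_polynomial (HF_Omega n I m) = [:of_nat c:]"
    by (rule hilbert_polynomial_const(2)[OF N])
  have "is_hilbert_polynomial (HF_Omega n I m) [:of_nat c:]"
    by (rule hilbert_polynomial_const(1)[OF N])
  then show ?thesis
    unfolding ri hp using HF_Omega_neg[OF m] low le less by simp
qed

end
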